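(* Let $d\ge 3$ and let $W\in\mathbb{R}^d$ be a random vector with $\mathbb{E}W=0$. Suppose $W$ has a Stein kernel $\tau^W:\mathbb{R}^d\to\mathbb{R}^{d\times d}$, i.e. $$\mathbb{E}[W\cdot\nabla f(W)]=\mathbb{E}\langle \tau^W(W),\nabla^2 f(W)\rangle$$ for every smooth $f:\mathbb{R}^d\to\mathbb{R}$ for which the expectations exist. Let $v_1,\dots,v_d\in\mathbb{R}^d$ be distinct unit vectors, $b_1,\dots,b_d\in\mathbb{R}$, and let $A=\{x\in\mathbb{R}^d: x\cdot v_j\le b_j,\ j=1,\dots,d\}$ (possibly unbounded). Then $$|P(W\in A)-P(Z\in A)|\le C\Delta(\log d)(|\log\Delta|\vee 1),$$ where $C$ is an absolute constant, $Z\sim N(0,I_d)$, $$\Delta:=\mathbb{E}\Big[\max_{j,k}\big(|v_j^\top Mv_j|+|v_j^\top M v_{jk}|+|v_{jk}^\top Mv_{jk}|\big)\Big],\qquad M:=\tau^W(W)-I_d,$$ the maximum being over all $1\le j\ne k\le d$ with $v_k\ne -v_j$, and $v_{jk}\in\mathbb{R}^d$ is the unit vector in the two-dimensional subspace spanned by $\{v_j,v_k\}$ with $v_{jk}\cdot v_j=0$ and $v_{jk}\cdot v_k>0$.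
   Context: $\langle\cdot,\cdot\rangle$ denotes the entrywise (Frobenius) inner product of matrices/tensors; $\nabla^2 f$ is the Hessian. $a\vee b=\max(a,b)$. *)

theory Defs
  imports "HOL-Probability.Probability"
begin

text \<open>Points of R^d are represented as functions nat => real restricted to the
  coordinates 0..d-1 (elements of PiE {..<d} (%_. UNIV), the space of the product
  measure PiM {..<d} (%_. borel)).  Matrices are nat => nat => real, entries i,j < d.\<close>

abbreviation Rd :: "nat \<Rightarrow> (nat \<Rightarrow> real) set" where
  "Rd d \<equiv> PiE {..<d} (\<lambda>_. UNIV)"

definition pd :: "nat \<Rightarrow> ((nat \<Rightarrow> real) \<Rightarrow> real) \<Rightarrow> (nat \<Rightarrow> real) \<Rightarrow> real" where
  "pd i f x = deriv (\<lambda>t. f (x(i := t))) (x i)"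

definition ipd :: "nat list \<Rightarrow> ((nat \<Rightarrow> real) \<Rightarrow> real) \<Rightarrow> (nat \<Rightarrow> real) \<Rightarrow> real" where
  "ipd is f = foldr pd is f"

definition smooth_Rd :: "nat \<Rightarrow> ((nat \<Rightarrow> real) \<Rightarrow> real) \<Rightarrow> bool" where
  "smooth_Rd d f \<longleftrightarrow>
     (\<forall>is. set is \<subseteq> {..<d} \<longrightarrow>
        continuous_on (Rd d) (ipd is f) \<and>
        (\<forall>i<d. \<forall>x\<in>Rd d. (\<lambda>t. ipd is f (x(i := t))) differentiable (at (x i))))"

definition dotd :: "nat \<Rightarrow> (nat \<Rightarrow> real) \<Rightarrow> (nat \<Rightarrow> real) \<Rightarrow> real" where
  "dotd d u w = (\<Sum>i<d. u i * w i)"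

definition qform :: "nat \<Rightarrow> (nat \<Rightarrow> real) \<Rightarrow> (nat \<Rightarrow> nat \<Rightarrow> real) \<Rightarrow> (nat \<Rightarrow> real) \<Rightarrow> real" where
  "qform d u M w = (\<Sum>i<d. \<Sum>l<d. u i * M i l * w l)"

definition stein_kernel :: "nat \<Rightarrow> (nat \<Rightarrow> real) measure \<Rightarrow> ((nat \<Rightarrow> real) \<Rightarrow> nat \<Rightarrow> nat \<Rightarrow> real) \<Rightarrow> bool" where
  "stein_kernel d \<mu> \<tau> \<longleftrightarrow>
     (\<forall>i<d. \<forall>j<d. (\<lambda>x. \<tau> x i j) \<in> borel_measurable \<mu>) \<and>
     (\<forall>f. smooth_Rd d f \<longrightarrow>
        integrable \<mu> (\<lambda>x. \<Sum>i<d. x i * pd i f x) \<longrightarrow>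
        integrable \<mu> (\<lambda>x. \<Sum>i<d. \<Sum>j<d. \<tau> x i j * pd i (pd j f) x) \<longrightarrow>
        (\<integral>x. (\<Sum>i<d. x i * pd i f x) \<partial>\<mu>) =
        (\<integral>x. (\<Sum>i<d. \<Sum>j<d. \<tau> x i j * pd i (pd j f) x) \<partial>\<mu>))"

definition vperp :: "nat \<Rightarrow> (nat \<Rightarrow> real) \<Rightarrow> (nat \<Rightarrow> real) \<Rightarrow> (nat \<Rightarrow> real)" where
  "vperp d vj vk = (THE u. u \<in> Rd d \<and> (\<exists>a b. \<forall>i<d. u i = a * vj i + b * vk i) \<and>
       dotd d u u = 1 \<and> dotd d u vj = 0 \<and> dotd d u vk > 0)"

definition std_gauss :: "nat \<Rightarrow> (nat \<Rightarrow> real) measure" where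
  "std_gauss d = PiM {..<d} (\<lambda>_. density lborel std_normal_density)"

end

theory Submission
  imports Defs
begin

text \<open>Write \<open>V x = (v\<^sub>j \<bullet> x)\<^sub>j\<close> and add an independent Gaussian noise \<open>e n\<close> with independent
  coordinates. Along the path \<open>sin \<theta> W + cos \<theta> Z\<close> from \<open>Z\<close> to \<open>W\<close>, the Stein identity for \<open>W\<close> and
  Gaussian integration by parts give
  \<open>d/d\<theta> P (V (sin \<theta> W + cos \<theta> Z) + e n \<le> b) = sin \<theta> cos \<theta> E (\<Sum>j k. \<langle>v\<^sub>j, M v\<^sub>k\<rangle> \<Phi>\<^sub>j\<^sub>k)\<close>, where \<open>\<Phi>\<^sub>j\<^sub>k\<close> are the
  second derivatives of the distribution function \<open>\<Phi>\<close> of the nondegenerate Gaussian vector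
  \<open>cos \<theta> V Z + e n\<close>, at \<open>b - sin \<theta> V W\<close>. Normalize the variances of that vector to \<open>1\<close> and let \<open>S\<close> be its
  covariance and \<open>c\<close> the normalized argument. Eliminating \<open>\<Phi>\<^sub>j\<^sub>j = - c\<^sub>j \<Phi>\<^sub>j - (\<Sum>k\<noteq>j. S\<^sub>j\<^sub>k \<Phi>\<^sub>j\<^sub>k)\<close> and
  symmetrizing, the coefficient of \<open>\<Phi>\<^sub>j\<^sub>k\<close> becomes at most a constant times \<open>(1 - S\<^sub>j\<^sub>k\<^sup>2) F\<close>.

  The sums \<open>\<Sum>j. \<bar>c\<^sub>j\<bar> \<Phi>\<^sub>j\<close> and \<open>\<Sum>j k. (1 - S\<^sub>j\<^sub>k\<^sup>2) \<Phi>\<^sub>j\<^sub>k\<close> are \<open>O (log d)\<close>, by Nazarov's argument: the outer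
  normal cones over the faces and the ridges of \<open>{y. y \<le> c}\<close> are disjoint, so their probabilities sum to at
  most \<open>1\<close>, and the part of the cone over the ridge \<open>(j, k)\<close> of size \<open>1 / \<surd>log d\<close> has probability of order
  at least \<open>(1 - S\<^sub>j\<^sub>k\<^sup>2) \<Phi>\<^sub>j\<^sub>k / log d\<close>, unless \<open>c\<^sub>j\<close> or \<open>c\<^sub>k\<close> is so large that \<open>(1 - S\<^sub>j\<^sub>k\<^sup>2) \<Phi>\<^sub>j\<^sub>k = O (d\<^sup>-\<^sup>2)\<close>.

  Hence the smoothed probabilities differ by \<open>O (\<Delta> log d log (1 + e\<^sup>-\<^sup>2))\<close>; removing the noise costs
  \<open>O (e log d)\<close>, and one takes \<open>e = \<Delta>\<close>.\<close>

section \<open>The normal distribution function and its derivatives\<close>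

text \<open>The normals may be linearly dependent or antipodal, so V Z can be degenerate and 1 -
  S_jk^2 could vanish. The noise therefore lives in the space of the d thresholds, not in that of W:
  it makes S positive definite and turns each probability into an expectation of a product of
  one-dimensional functions. It amounts to a random shift of b, so removing it is a question about
  shifts of b. The pure derivatives Phi_jj have no sign and no reading as probabilities, whereas
  Phi_j and, for distinct j and k, Phi_jk are densities on faces and ridges; hence the elimination
  of the diagonal. Symmetrizing is essential because M need not be symmetric: with rho = v_j . v_k
  and s = sqrt (1 - rho^2), the single coefficient <v_j, M v_k> - rho <v_j, M v_j> is only of order
  s, but its sum with the mirror image is of order s^2, which the ridges can pay for. The factor log
  (1 + e^-2) is twice the integral of sin cos / (cos^2 + e^2) over the quarter circle: the Gaussian
  part of the path has variance cos^2 + e^2 and nearly degenerates at the end where only W is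
  left.\<close>

lemma has_real_derivative_integral:
  fixes f f' :: "real \<Rightarrow> 'a \<Rightarrow> real"
  assumes int: "\<And>t. integrable M (f t)"
    and deriv: "\<And>t x. x \<in> space M \<Longrightarrow> ((\<lambda>t. f t x) has_real_derivative f' t x) (at t)"
    and bnd: "\<And>t x. x \<in> space M \<Longrightarrow> \<bar>f' t x\<bar> \<le> w x"
    and w: "integrable M w"
    and meas: "f' t0 \<in> borel_measurable M"
  shows "((\<lambda>t. \<integral>x. f t x \<partial>M) has_real_derivative (\<integral>x. f' t0 x \<partial>M)) (at t0)"
  unfolding has_field_derivative_iff tendsto_at_iff_sequentially
proof (intro allI impI)
  fix X :: "nat \<Rightarrow> real"
  assume X: "\<forall>i. X i \<in> UNIV - {t0}" "X \<longlonglongrightarrow> t0"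
  have eq: "(\<integral>x. f (X n) x \<partial>M) - (\<integral>x. f t0 x \<partial>M) = (\<integral>x. f (X n) x - f t0 x \<partial>M)" for n
    using int by simp
  have "(\<lambda>n. \<integral>x. (f (X n) x - f t0 x) / (X n - t0) \<partial>M) \<longlonglongrightarrow> (\<integral>x. f' t0 x \<partial>M)"
  proof (rule integral_dominated_convergence[where w = w])
    show "(\<lambda>x. (f (X n) x - f t0 x) / (X n - t0)) \<in> borel_measurable M" for n
      using int[of "X n"] int[of t0] by (auto dest!: borel_measurable_integrable)
    show "AE x in M. (\<lambda>n. (f (X n) x - f t0 x) / (X n - t0)) \<longlonglongrightarrow> f' t0 x"
    proof (rule AE_I2)
      fix x assume "x \<in> space M"
      from deriv[OF this, of t0] X show "(\<lambda>n. (f (X n) x - f t0 x) / (X n - t0)) \<longlonglongrightarrow> f' t0 x"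
        unfolding has_field_derivative_iff tendsto_at_iff_sequentially o_def by blast
    qed
    show "AE x in M. norm ((f (X n) x - f t0 x) / (X n - t0)) \<le> w x" for n
    proof (rule AE_I2)
      fix x assume x: "x \<in> space M"
      have "norm (f (X n) x - f t0 x) \<le> w x * norm (X n - t0)"
        by (rule field_differentiable_bound[where S = UNIV and f' = "\<lambda>t. f' t x"])
           (use deriv[OF x] bnd[OF x] in auto)
      moreover have "X n - t0 \<noteq> 0" using X(1) by (auto dest!: spec[of _ n])
      ultimately show "norm ((f (X n) x - f t0 x) / (X n - t0)) \<le> w x"
        by (simp add: divide_le_eq)
    qed
  qed (use meas w in auto)
  then show "((\<lambda>y. ((\<integral>x. f y x \<partial>M) - (\<integral>x. f t0 x \<partial>M)) / (y - t0)) \<circ> X) \<longlonglongrightarrow> (\<integral>x. f' t0 x \<partial>M)"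
    unfolding o_def eq by simp
qed

lemma std_normal_density_has_derivative:
  "(std_normal_density has_real_derivative (- t * std_normal_density t)) (at t)"
  unfolding std_normal_density_def[abs_def]
  by (auto intro!: derivative_eq_intros simp: power2_eq_square real_div_sqrt field_simps)

lemma std_normal_density_continuous: "continuous_on S std_normal_density"
  by (intro continuous_at_imp_continuous_on ballI DERIV_isCont[OF std_normal_density_has_derivative])

lemma std_normal_density_bounded_mult_power:
  "\<exists>B. \<forall>t. \<bar>t ^ k * std_normal_density t\<bar> \<le> B"
proof -
  have "\<bar>t ^ k * std_normal_density t\<bar> \<le> real (Suc k) ^ Suc k * exp (1/2)" for t :: real
  proof -
    \<comment> \<open>The exponent \<open>Suc k\<close> makes the following division legitimate for
      k = 0 too. Then (1 + x / n)^n <= exp x, and |t| - t^2 / 2 <= 1 / 2 lets the Gaussian factor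
      absorb the exponential.\<close>
    have "\<bar>t\<bar> ^ k \<le> (1 + \<bar>t\<bar>) ^ Suc k"
      by (rule order_trans[OF power_mono[of "\<bar>t\<bar>" "1 + \<bar>t\<bar>"]]) (auto intro!: mult_le_cancel_right1[THEN iffD2])
    also have "\<dots> \<le> (real (Suc k) * (1 + \<bar>t\<bar> / real (Suc k))) ^ Suc k"
      by (intro power_mono) (auto simp: field_simps)
    also have "\<dots> = real (Suc k) ^ Suc k * (1 + \<bar>t\<bar> / real (Suc k)) ^ Suc k"
      by (simp only: power_mult_distrib)
    also have "\<dots> \<le> real (Suc k) ^ Suc k * exp \<bar>t\<bar>"
      by (intro mult_left_mono exp_ge_one_plus_x_over_n_power_n) auto
    finally have 1: "\<bar>t\<bar> ^ k \<le> real (Suc k) ^ Suc k * exp \<bar>t\<bar>" .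
    have 2: "std_normal_density t \<le> exp (- t\<^sup>2 / 2)"
    proof -
      have "1 \<le> sqrt (2 * pi)" using pi_gt3 by simp
      then show ?thesis unfolding std_normal_density_def by (simp add: field_simps)
    qed
    have 3: "exp \<bar>t\<bar> * exp (- t\<^sup>2 / 2) \<le> exp (1/2)"
    proof -
      have "0 \<le> (\<bar>t\<bar> - 1)\<^sup>2" by simp
      then have "\<bar>t\<bar> + - t\<^sup>2 / 2 \<le> 1/2" by (simp add: power2_diff)
      then show ?thesis by (simp add: exp_add[symmetric])
    qed
    have "\<bar>t ^ k * std_normal_density t\<bar> = \<bar>t\<bar> ^ k * std_normal_density t"
      by (simp add: abs_mult power_abs)
    also have "\<dots> \<le> (real (Suc k) ^ Suc k * exp \<bar>t\<bar>) * exp (- t\<^sup>2 / 2)"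
      by (intro mult_mono 1 2) auto
    also have "\<dots> \<le> real (Suc k) ^ Suc k * exp (1/2)"
      using 3 by (simp only: mult.assoc) (intro mult_left_mono, auto)
    finally show ?thesis .
  qed
  then show ?thesis by blast
qed

text \<open>The Hermite polynomials up to sign: with phi the standard normal density, the derivative
  of p phi is (p' - t p) phi.\<close>

fun gpoly :: "nat \<Rightarrow> real poly" where
  "gpoly 0 = 1"
| "gpoly (Suc m) = pderiv (gpoly m) - [:0, 1:] * gpoly m"

text \<open>\<open>psi m\<close> is the m-th derivative of the standard normal distribution
  function. All orders are provided because the Stein identity is stated for smooth test functions,
  so the smoothed indicator must have partial derivatives of every order.\<close>

fun psi :: "nat \<Rightarrow> real \<Rightarrow> real" where
  "psi 0 t = (\<integral>x. indicator {..t} x * std_normal_density x \<partial>lborel)"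
| "psi (Suc m) t = poly (gpoly m) t * std_normal_density t"

lemma psi_1: "psi (Suc 0) = std_normal_density"
  by (rule ext) simp

lemma psi_2: "psi (Suc (Suc 0)) t = - t * std_normal_density t"
  by simp

lemma psi_0_diff:
  assumes "a \<le> t"
  shows "psi 0 t = psi 0 a + integral {a..t} std_normal_density"
proof -
  have i: "integrable lborel (\<lambda>x. indicator A x * std_normal_density x)" if "A \<in> sets borel" for A
    using integrable_real_mult_indicator[of A lborel std_normal_density] that by (simp add: mult.commute)
  have "psi 0 t = (\<integral>x. indicator {..a} x * std_normal_density x + indicator {a<..t} x * std_normal_density x \<partial>lborel)"
    unfolding psi.simps by (intro Bochner_Integration.integral_cong) (use assms in \<open>auto simp: indicator_def\<close>)
  also have "\<dots> = psi 0 a + (LBINT x:{a<..t}. std_normal_density x)"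
    unfolding psi.simps set_lebesgue_integral_def
    by (subst Bochner_Integration.integral_add) (auto intro!: i)
  also have "(LBINT x:{a<..t}. std_normal_density x) = integral {a<..t} std_normal_density"
    by (intro set_borel_integral_eq_integral) (auto simp: set_integrable_def intro!: i)
  also have "integral {a<..t} std_normal_density = integral {a..t} std_normal_density"
    by (intro integral_spike_set; rule negligible_subset[of "{a}"]) auto
  finally show ?thesis .
qed

lemma psi_has_derivative: "(psi m has_real_derivative psi (Suc m) t) (at t)"
proof (cases m)
  case 0
  have "((\<lambda>u. integral {t - 1..u} std_normal_density) has_vector_derivative std_normal_density t) (at t within {t - 1..t + 1})"
    by (rule integral_has_vector_derivative) (auto intro: std_normal_density_continuous)
  then have "((\<lambda>u. integral {t - 1..u} std_normal_density) has_real_derivative std_normal_density t) (at t)"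
    unfolding has_real_derivative_iff_has_vector_derivative
    by (subst (asm) at_within_interior) auto
  then have "((\<lambda>u. psi 0 (t - 1) + integral {t - 1..u} std_normal_density) has_real_derivative std_normal_density t) (at t)"
    using DERIV_add[OF DERIV_const[of "psi 0 (t - 1)"]] by fastforce
  moreover have "\<forall>\<^sub>F u in nhds t. psi 0 u = psi 0 (t - 1) + integral {t - 1..u} std_normal_density"
  proof (rule eventually_nhds_in_open[of "{t - 1<..}", THEN eventually_mono])
    show "psi 0 u = psi 0 (t - 1) + integral {t - 1..u} std_normal_density" if "u \<in> {t - 1<..}" for u
      using psi_0_diff[of "t - 1" u] that by simp
  qed auto
  ultimately have "(psi 0 has_real_derivative std_normal_density t) (at t)"
    by (simp only: DERIV_cong_ev[OF refl _ refl])
  then show ?thesis using 0 by simp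
next
  case (Suc k)
  show ?thesis unfolding Suc psi.simps(2)[abs_def]
    by (auto intro!: derivative_eq_intros std_normal_density_has_derivative poly_DERIV simp: algebra_simps)
qed

lemma psi_continuous: "continuous_on S (psi m)"
  by (intro continuous_at_imp_continuous_on ballI DERIV_isCont[OF psi_has_derivative])

lemma psi_measurable [measurable]: "psi m \<in> borel_measurable borel"
  by (intro borel_measurable_continuous_onI psi_continuous)

lemma integral_std_normal_ind:
  assumes "A \<in> sets borel"
  shows "(\<integral>x. indicator A x * std_normal_density x \<partial>lborel) = measure std_normal_distribution A"
proof -
  have "measure std_normal_distribution A = integral\<^sup>L std_normal_distribution (indicator A)"
    using assms by simp
  also have "\<dots> = (\<integral>x. std_normal_density x *\<^sub>R indicator A x \<partial>lborel)"
    using assms by (subst integral_density) auto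
  finally show ?thesis by (simp add: mult.commute)
qed

lemma psi_0_measure: "psi 0 t = measure std_normal_distribution {..t}"
  by (simp add: integral_std_normal_ind)

lemma prob_space_std_normal: "prob_space std_normal_distribution"
  by (rule prob_space_normal_density) simp

lemma psi_0_nonneg: "0 \<le> psi 0 t" and psi_0_le_1: "psi 0 t \<le> 1"
  unfolding psi_0_measure using prob_space.prob_le_1[OF prob_space_std_normal] by auto

lemma psi_nonneg: "m \<le> 1 \<Longrightarrow> 0 \<le> psi m t"
  using psi_0_nonneg[of t] by (cases m) auto

lemma psi_bounded: "\<exists>B. \<forall>t. \<bar>psi m t\<bar> \<le> B"
proof (cases m)
  case 0
  then show ?thesis using psi_0_nonneg psi_0_le_1 by (auto intro!: exI[of _ 1] simp del: psi.simps)
next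
  case (Suc k)
  obtain B where B: "\<And>i t. \<bar>t ^ i * std_normal_density t\<bar> \<le> B i"
    using std_normal_density_bounded_mult_power by metis
  have "\<bar>psi m t\<bar> \<le> (\<Sum>i\<le>degree (gpoly k). \<bar>coeff (gpoly k) i\<bar> * B i)" for t
  proof -
    have "psi m t = (\<Sum>i\<le>degree (gpoly k). coeff (gpoly k) i * (t ^ i * std_normal_density t))"
      by (simp add: Suc poly_altdef sum_distrib_right mult.assoc)
    also have "\<bar>\<dots>\<bar> \<le> (\<Sum>i\<le>degree (gpoly k). \<bar>coeff (gpoly k) i * (t ^ i * std_normal_density t)\<bar>)"
      by (rule sum_abs)
    also have "\<dots> \<le> (\<Sum>i\<le>degree (gpoly k). \<bar>coeff (gpoly k) i\<bar> * B i)"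
      by (intro sum_mono) (simp only: abs_mult[of "coeff _ _"], intro mult_left_mono B, simp)
    finally show ?thesis .
  qed
  then show ?thesis by blast
qed

text \<open>The size of this bound never enters the final estimate; it serves integrability and
  dominated convergence only.\<close>

definition psiB :: "nat \<Rightarrow> real" where
  "psiB m = (SOME B. \<forall>t. \<bar>psi m t\<bar> \<le> B)"

lemma psiB: "\<bar>psi m t\<bar> \<le> psiB m"
  using someI_ex[OF psi_bounded[of m]] unfolding psiB_def by blast

lemma psiB_nonneg: "0 \<le> psiB m"
  using psiB[of m 0] by linarith

declare psi.simps [simp del]

text \<open>The fundamental theorem of calculus for g times the density on the whole line. The
  boundary terms vanish because g is bounded and the density is O(1 / |t|).\<close>

lemma normal_stein_1d:
  fixes g g' :: "real \<Rightarrow> real"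
  assumes g: "\<And>t. (g has_real_derivative g' t) (at t)"
    and cont: "continuous_on UNIV g'"
    and bg: "\<And>t. \<bar>g t\<bar> \<le> B" and bg': "\<And>t. \<bar>g' t\<bar> \<le> B"
  shows "(\<integral>t. t * g t \<partial>std_normal_distribution) = (\<integral>t. g' t \<partial>std_normal_distribution)"
proof -
  let ?p = std_normal_density
  have cg: "continuous_on UNIV g" using g by (meson DERIV_isCont continuous_at_imp_continuous_on)
  have [measurable]: "g \<in> borel_measurable borel" "g' \<in> borel_measurable borel"
    using cg cont by (auto intro: borel_measurable_continuous_onI)
  have i1: "integrable lborel (\<lambda>t. ?p t * g' t)"
    by (rule Bochner_Integration.integrable_bound[of _ "\<lambda>t. B * ?p t"])
       (auto simp: abs_mult mult.commute intro!: mult_right_mono order_trans[OF bg'])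
  have i2: "integrable lborel (\<lambda>t. ?p t * (t * g t))"
  proof (rule Bochner_Integration.integrable_bound[of _ "\<lambda>t. B * (?p t * \<bar>t\<bar> ^ 1)"])
    show "AE t in lborel. norm (?p t * (t * g t)) \<le> norm (B * (?p t * \<bar>t\<bar> ^ 1))"
    proof (rule AE_I2)
      fix t :: real
      have "(?p t * \<bar>t\<bar>) * \<bar>g t\<bar> \<le> (?p t * \<bar>t\<bar>) * \<bar>B\<bar>"
        using bg[of t] by (intro mult_left_mono) auto
      then show "norm (?p t * (t * g t)) \<le> norm (B * (?p t * \<bar>t\<bar> ^ 1))"
        by (simp add: abs_mult mult_ac)
    qed
  qed (intro integrable_mult_right integrable_std_normal_moment_abs, measurable)
  obtain K where K: "\<And>t. \<bar>t * ?p t\<bar> \<le> K"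
    using std_normal_density_bounded_mult_power[of 1] by auto
  have lim: "((\<lambda>t. g t * ?p t) \<longlongrightarrow> 0) at_top" "((\<lambda>t. g t * ?p t) \<longlongrightarrow> 0) at_bot"
  proof -
    have n: "norm (g t * ?p t) \<le> B * K / \<bar>t\<bar>" if "t \<noteq> 0" for t
    proof -
      have "\<bar>g t\<bar> * (\<bar>t\<bar> * ?p t) \<le> B * K"
        using bg[of t] K[of t] by (intro mult_mono) (auto simp: abs_mult)
      then show ?thesis using that by (simp add: abs_mult field_simps)
    qed
    have 1: "((\<lambda>t. B * K / \<bar>t\<bar>) \<longlongrightarrow> 0) at_top"
      by (intro tendsto_divide_0[OF tendsto_const] filterlim_at_top_imp_at_infinity filterlim_abs_real)
    then have "((\<lambda>t. B * K / \<bar>t\<bar>) \<longlongrightarrow> 0) at_bot"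
      by (simp add: filterlim_at_bot_mirror)
    note 2 = this
    show "((\<lambda>t. g t * ?p t) \<longlongrightarrow> 0) at_top"
      by (rule Lim_null_comparison[OF eventually_mono[OF eventually_gt_at_top[of 0] n] 1]) simp
    show "((\<lambda>t. g t * ?p t) \<longlongrightarrow> 0) at_bot"
      by (rule Lim_null_comparison[OF eventually_mono[OF eventually_gt_at_bot[of 0] n] 2]) simp
  qed
  have "(LBINT t=-\<infinity>..\<infinity>. ?p t * g' t - ?p t * (t * g t)) = 0 - 0"
  proof (rule interval_integral_FTC_integrable[where F = "\<lambda>t. g t * ?p t"])
    show "((\<lambda>t. g t * ?p t) has_vector_derivative ?p t * g' t - ?p t * (t * g t)) (at t)" for t
      unfolding has_real_derivative_iff_has_vector_derivative[symmetric]
      by (auto intro!: derivative_eq_intros g std_normal_density_has_derivative simp: algebra_simps)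
    show "isCont (\<lambda>t. ?p t * g' t - ?p t * (t * g t)) t" for t
      using cg cont std_normal_density_continuous[of UNIV]
      by (auto intro!: continuous_intros simp: continuous_on_eq_continuous_at)
    show "set_integrable lborel (einterval (-\<infinity>) \<infinity>) (\<lambda>t. ?p t * g' t - ?p t * (t * g t))"
      using i1 i2 by (simp add: set_integrable_def)
    show "(((\<lambda>t. g t * ?p t) \<circ> real_of_ereal) \<longlongrightarrow> 0) (at_right (-\<infinity>))"
      using lim(2) by (simp add: ereal_tendsto_simps)
    show "(((\<lambda>t. g t * ?p t) \<circ> real_of_ereal) \<longlongrightarrow> 0) (at_left \<infinity>)"
      using lim(1) by (simp add: ereal_tendsto_simps)
  qed auto
  then have "(\<integral>t. ?p t * g' t - ?p t * (t * g t) \<partial>lborel) = 0"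
    by (simp add: interval_integral_to_infinity_eq interval_lebesgue_integral_def set_lebesgue_integral_def)
  then have "(\<integral>t. ?p t * g' t \<partial>lborel) = (\<integral>t. ?p t * (t * g t) \<partial>lborel)"
    using i1 i2 by simp
  then show ?thesis by (simp add: integral_density)
qed

section \<open>Smoothed Gaussian probabilities of polytopes\<close>

lemma product_prob_space_std_normal: "product_prob_space (\<lambda>_::nat. std_normal_distribution)"
  by (intro product_prob_spaceI prob_space_std_normal)

lemma prob_space_std_gauss: "prob_space (std_gauss d)"
  unfolding std_gauss_def by (intro prob_space_PiM prob_space_std_normal)

lemma sets_std_gauss [measurable_cong]: "sets (std_gauss d) = sets (PiM {..<d} (\<lambda>_. borel))"
  unfolding std_gauss_def by (intro sets_PiM_cong) auto

lemma space_std_gauss: "space (std_gauss d) = Rd d"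
  using sets_eq_imp_space_eq[OF sets_std_gauss] by (simp add: space_PiM)

lemma borel_measurable_std_gauss: "borel_measurable (std_gauss d) = borel_measurable (PiM {..<d} (\<lambda>_. borel))"
  by (rule measurable_cong_sets[OF sets_std_gauss refl])

lemma coord_measurable: "l < d \<Longrightarrow> (\<lambda>z. z l) \<in> borel_measurable (PiM {..<d} (\<lambda>_. borel))"
  by (rule measurable_component_singleton) simp

lemma dotd_measurable [measurable]: "(\<lambda>z. dotd d z w) \<in> borel_measurable (PiM {..<d} (\<lambda>_. borel))"
  unfolding dotd_def by measurable

lemma dotd_upd: "l < d \<Longrightarrow> dotd d (x(l := t)) w = dotd d x w + (t - x l) * w l"
  unfolding dotd_def by (simp add: sum.remove[of "{..<d}" l] algebra_simps)

lemma dotd_commute: "dotd d x y = dotd d y x"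
  unfolding dotd_def by (simp add: mult.commute)

lemma integrable_std_gauss_coord:
  assumes "l < d"
  shows "integrable (std_gauss d) (\<lambda>z. z l)"
proof -
  interpret product_prob_space "\<lambda>_::nat. std_normal_distribution" "{..<d}"
    by (intro product_prob_spaceI prob_space_std_normal)
  have "integrable std_normal_distribution (\<lambda>t. t)"
    using integrable_std_normal_moment[of 1] by (subst integrable_density) auto
  then have "integrable (distr (std_gauss d) std_normal_distribution (\<lambda>z. z l)) (\<lambda>t. t)"
    unfolding std_gauss_def using PiM_component[of l] assms by simp
  then show ?thesis
    by (rule integrable_distr[rotated]) (use assms in \<open>simp add: std_gauss_def\<close>)
qed

text \<open>Fubini splits off the coordinate l and leaves the one-dimensional identity; boundedness
  and the first moment of z_l give the integrability.\<close>

lemma gauss_ibp: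
  fixes h h' :: "(nat \<Rightarrow> real) \<Rightarrow> real"
  assumes l: "l < d"
    and [measurable]: "h \<in> borel_measurable (PiM {..<d} (\<lambda>_. borel))" "h' \<in> borel_measurable (PiM {..<d} (\<lambda>_. borel))"
    and deriv: "\<And>z t. ((\<lambda>t. h (z(l := t))) has_real_derivative h' (z(l := t))) (at t)"
    and cont: "\<And>z. continuous_on UNIV (\<lambda>t. h' (z(l := t)))"
    and bnd: "\<And>z. \<bar>h z\<bar> \<le> B" "\<And>z. \<bar>h' z\<bar> \<le> B"
  shows "(\<integral>z. z l * h z \<partial>std_gauss d) = (\<integral>z. h' z \<partial>std_gauss d)"
proof -
  interpret G: prob_space "std_gauss d" by (rule prob_space_std_gauss)
  interpret product_prob_space "\<lambda>_::nat. std_normal_distribution" "{..<d}"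
    by (intro product_prob_spaceI prob_space_std_normal)
  define I where "I = {..<d} - {l}"
  have I: "finite I" "l \<notin> I" "insert l I = {..<d}" using l by (auto simp: I_def)
  have i2: "integrable (std_gauss d) h'"
    by (rule G.integrable_const_bound[of _ B]) (use bnd in auto)
  have i1: "integrable (std_gauss d) (\<lambda>z. z l * h z)"
  proof (rule Bochner_Integration.integrable_bound[of _ "\<lambda>z. B * z l"])
    show "integrable (std_gauss d) (\<lambda>z. B * z l)" by (intro integrable_mult_right integrable_std_gauss_coord l)
    show "AE z in std_gauss d. norm (z l * h z) \<le> norm (B * z l)"
    proof (rule AE_I2)
      fix z have "\<bar>z l\<bar> * \<bar>h z\<bar> \<le> \<bar>z l\<bar> * \<bar>B\<bar>" using bnd(1)[of z] by (intro mult_left_mono) auto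
      then show "norm (z l * h z) \<le> norm (B * z l)" by (simp add: abs_mult mult_ac)
    qed
  qed (auto intro!: borel_measurable_times coord_measurable l simp: borel_measurable_std_gauss)
  have "(\<integral>z. z l * h z \<partial>std_gauss d) = (\<integral>x. (\<integral>t. t * h (x(l := t)) \<partial>std_normal_distribution) \<partial>PiM I (\<lambda>_. std_normal_distribution))"
    using product_integral_insert[OF I(1,2), unfolded I(3), of "\<lambda>z. z l * h z"] i1 by (simp add: std_gauss_def)
  also have "\<dots> = (\<integral>x. (\<integral>t. h' (x(l := t)) \<partial>std_normal_distribution) \<partial>PiM I (\<lambda>_. std_normal_distribution))"
    by (intro Bochner_Integration.integral_cong refl normal_stein_1d[where B = B] deriv cont bnd)
  also have "\<dots> = (\<integral>z. h' z \<partial>std_gauss d)"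
    using product_integral_insert[OF I(1,2), unfolded I(3), of h'] i2 by (simp add: std_gauss_def)
  finally show ?thesis .
qed

section \<open>The smoothed distribution function and its partial derivatives\<close>

lemma prod_psi_has_derivative:
  assumes "finite I" "\<And>k. k \<in> I \<Longrightarrow> (a k has_real_derivative a' k) (at t)"
  shows "((\<lambda>t. \<Prod>i\<in>I. psi (m i) (a i t)) has_real_derivative
     (\<Sum>k\<in>I. a' k * (\<Prod>i\<in>I. psi ((m(k := Suc (m k))) i) (a i t)))) (at t)"
  using assms
proof (induction I rule: finite_induct)
  case (insert j I)
  have *: "(\<Prod>i\<in>I. psi ((m(j := Suc (m j))) i) (a i t)) = (\<Prod>i\<in>I. psi (m i) (a i t))"
    using insert by (intro prod.cong) auto
  have D: "((\<lambda>t. psi (m j) (a j t)) has_real_derivative psi (Suc (m j)) (a j t) * a' j) (at t)"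
    using insert.prems by (intro DERIV_chain2[OF psi_has_derivative]) auto
  have "((\<lambda>t. psi (m j) (a j t) * (\<Prod>i\<in>I. psi (m i) (a i t))) has_real_derivative
     a' j * (psi (Suc (m j)) (a j t) * (\<Prod>i\<in>I. psi (m i) (a i t)))
     + (\<Sum>k\<in>I. a' k * (psi (m j) (a j t) * (\<Prod>i\<in>I. psi ((m(k := Suc (m k))) i) (a i t))))) (at t)"
    using DERIV_mult[OF D insert.IH] insert.prems
    by (simp add: sum_distrib_left mult_ac add_ac del: fun_upd_apply)
  moreover have "(\<Sum>k\<in>insert j I. a' k * (\<Prod>i\<in>insert j I. psi ((m(k := Suc (m k))) i) (a i t)))
    = a' j * (psi (Suc (m j)) (a j t) * (\<Prod>i\<in>I. psi (m i) (a i t)))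
     + (\<Sum>k\<in>I. a' k * (psi (m j) (a j t) * (\<Prod>i\<in>I. psi ((m(k := Suc (m k))) i) (a i t))))"
    unfolding sum.insert[OF insert.hyps] prod.insert[OF insert.hyps] * fun_upd_same
    by (intro arg_cong2[where f = "(+)"] refl sum.cong) (use insert.hyps in auto)
  ultimately show ?case
    by (simp only: prod.insert[OF insert.hyps])
qed simp

text \<open>For m = 0 this is the probability of \<beta> V z + e n <= y given z: the noise
  coordinates are independent, so they integrate out to a product.\<close>

definition Jint :: "nat \<Rightarrow> (nat \<Rightarrow> nat \<Rightarrow> real) \<Rightarrow> real \<Rightarrow> (nat \<Rightarrow> nat) \<Rightarrow> real \<Rightarrow> (nat \<Rightarrow> real) \<Rightarrow> (nat \<Rightarrow> real) \<Rightarrow> real" where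
  "Jint d v e m \<beta> y z = (\<Prod>i<d. psi (m i) ((y i - \<beta> * dotd d z (v i)) / e))"

text \<open>This is e^|m| times the mixed partial derivative of order m of y |-> P (\<beta> V Z + e
  n <= y). With the powers of e left in, each differentiation raises one index and divides by
  e.\<close>

definition J :: "nat \<Rightarrow> (nat \<Rightarrow> nat \<Rightarrow> real) \<Rightarrow> real \<Rightarrow> (nat \<Rightarrow> nat) \<Rightarrow> real \<Rightarrow> (nat \<Rightarrow> real) \<Rightarrow> real" where
  "J d v e m \<beta> y = (\<integral>z. Jint d v e m \<beta> y z \<partial>std_gauss d)"

abbreviation inc :: "(nat \<Rightarrow> nat) \<Rightarrow> nat \<Rightarrow> nat \<Rightarrow> nat" where
  "inc m k \<equiv> m(k := Suc (m k))"

definition JB :: "nat \<Rightarrow> (nat \<Rightarrow> nat) \<Rightarrow> real" where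
  "JB d m = (\<Prod>i<d. psiB (m i))"

lemma Jint_bound: "\<bar>Jint d v e m \<beta> y z\<bar> \<le> JB d m"
  unfolding Jint_def JB_def abs_prod by (intro prod_mono) (auto simp: psiB)

lemma JB_nonneg: "0 \<le> JB d m"
  unfolding JB_def by (intro prod_nonneg) (auto simp: psiB_nonneg)

lemma Jint_measurable [measurable]: "Jint d v e m \<beta> y \<in> borel_measurable (PiM {..<d} (\<lambda>_. borel))"
  unfolding Jint_def by measurable

lemma integrable_Jint: "integrable (std_gauss d) (Jint d v e m \<beta> y)"
proof -
  interpret G: prob_space "std_gauss d" by (rule prob_space_std_gauss)
  show ?thesis
    by (rule G.integrable_const_bound[of _ "JB d m"]) (use Jint_bound in auto)
qed

lemma J_bound: "\<bar>J d v e m \<beta> y\<bar> \<le> JB d m"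
proof -
  interpret G: prob_space "std_gauss d" by (rule prob_space_std_gauss)
  have "\<bar>J d v e m \<beta> y\<bar> \<le> (\<integral>z. \<bar>Jint d v e m \<beta> y z\<bar> \<partial>std_gauss d)"
    unfolding J_def by (rule integral_abs_bound)
  also have "\<dots> \<le> JB d m"
    using integrable_Jint by (intro G.integral_le_const AE_I2 Jint_bound) auto
  finally show ?thesis .
qed

lemma Jint_tendsto:
  assumes "\<And>i. i < d \<Longrightarrow> ((\<lambda>n. y n i) \<longlongrightarrow> y0 i) F"
    and "(\<beta> \<longlongrightarrow> \<beta>0) F" and "\<And>i. i < d \<Longrightarrow> ((\<lambda>n. dotd d (z n) (v i)) \<longlongrightarrow> dotd d z0 (v i)) F" and "e \<noteq> 0"
  shows "((\<lambda>n. Jint d v e m (\<beta> n) (y n) (z n)) \<longlongrightarrow> Jint d v e m \<beta>0 y0 z0) F"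
  unfolding Jint_def
proof (intro tendsto_prod)
  fix i assume "i \<in> {..<d}"
  then have *: "((\<lambda>n. (y n i - \<beta> n * dotd d (z n) (v i)) / e) \<longlongrightarrow> (y0 i - \<beta>0 * dotd d z0 (v i)) / e) F"
    using assms by (intro tendsto_intros) auto
  have "isCont (psi (m i)) ((y0 i - \<beta>0 * dotd d z0 (v i)) / e)"
    using psi_has_derivative DERIV_isCont by blast
  from isCont_tendsto_compose[OF this *]
  show "((\<lambda>n. psi (m i) ((y n i - \<beta> n * dotd d (z n) (v i)) / e)) \<longlongrightarrow> psi (m i) ((y0 i - \<beta>0 * dotd d z0 (v i)) / e)) F" .
qed

lemma J_tendsto:
  assumes "\<And>i. i < d \<Longrightarrow> (\<lambda>n. y n i) \<longlonglongrightarrow> y0 i" and "e \<noteq> 0"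
  shows "(\<lambda>n. J d v e m \<beta> (y n)) \<longlonglongrightarrow> J d v e m \<beta> y0"
proof -
  interpret G: prob_space "std_gauss d" by (rule prob_space_std_gauss)
  show ?thesis unfolding J_def
  proof (rule integral_dominated_convergence[where w = "\<lambda>_. JB d m"])
    show "AE z in std_gauss d. (\<lambda>n. Jint d v e m \<beta> (y n) z) \<longlonglongrightarrow> Jint d v e m \<beta> y0 z"
      by (intro AE_I2 Jint_tendsto assms tendsto_const) auto
  qed (auto simp: Jint_bound)
qed

lemma Jint_has_derivative:
  assumes "\<And>k. k < d \<Longrightarrow> ((\<lambda>t. y t k - \<beta> t * dotd d (z t) (v k)) has_real_derivative a' k) (at t)" "e \<noteq> 0"
  shows "((\<lambda>t. Jint d v e m (\<beta> t) (y t) (z t)) has_real_derivative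
     (\<Sum>k<d. a' k / e * Jint d v e (inc m k) (\<beta> t) (y t) (z t))) (at t)"
  unfolding Jint_def by (rule prod_psi_has_derivative) (use assms in \<open>auto intro!: DERIV_cdivide\<close>)

text \<open>Differentiating along an arbitrary line covers both later uses: raising all thresholds
  together, and moving one coordinate of x in b - \<alpha> V x.\<close>

lemma J_has_derivative:
  assumes e: "e \<noteq> 0"
  shows "((\<lambda>t. J d v e m \<beta> (\<lambda>i. p i + t * q i)) has_real_derivative
     (\<Sum>k<d. q k / e * J d v e (inc m k) \<beta> (\<lambda>i. p i + t * q i))) (at t)"
proof -
  interpret G: prob_space "std_gauss d" by (rule prob_space_std_gauss)
  have "((\<lambda>t. J d v e m \<beta> (\<lambda>i. p i + t * q i)) has_real_derivative
      (\<integral>z. (\<Sum>k<d. q k / e * Jint d v e (inc m k) \<beta> (\<lambda>i. p i + t * q i) z) \<partial>std_gauss d)) (at t)"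
    unfolding J_def
  proof (rule has_real_derivative_integral[where w = "\<lambda>_. \<Sum>k<d. \<bar>q k / e\<bar> * JB d (inc m k)"])
    fix t z
    show "((\<lambda>t. Jint d v e m \<beta> (\<lambda>i. p i + t * q i) z) has_real_derivative
        (\<Sum>k<d. q k / e * Jint d v e (inc m k) \<beta> (\<lambda>i. p i + t * q i) z)) (at t)"
      by (rule Jint_has_derivative) (use e in \<open>auto intro!: derivative_eq_intros\<close>)
    show "\<bar>\<Sum>k<d. q k / e * Jint d v e (inc m k) \<beta> (\<lambda>i. p i + t * q i) z\<bar> \<le> (\<Sum>k<d. \<bar>q k / e\<bar> * JB d (inc m k))"
      by (rule order_trans[OF sum_abs]) (auto simp only: abs_mult intro!: sum_mono mult_left_mono Jint_bound abs_ge_zero)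
  qed (auto intro: integrable_Jint)
  also have "(\<integral>z. (\<Sum>k<d. q k / e * Jint d v e (inc m k) \<beta> (\<lambda>i. p i + t * q i) z) \<partial>std_gauss d)
     = (\<Sum>k<d. q k / e * J d v e (inc m k) \<beta> (\<lambda>i. p i + t * q i))"
    unfolding J_def by (simp add: integrable_Jint del: fun_upd_apply)
  finally show ?thesis .
qed

text \<open>\<open>Jint\<close> sees z only through the numbers v_i . z, each with factor - \<beta>
  / e, so integrating the linear form w . z by parts raises one index at a time with weight w .
  v_i.\<close>

lemma J_ibp:
  assumes e: "e \<noteq> 0"
  shows "(\<integral>z. dotd d z w * Jint d v e m \<beta> y z \<partial>std_gauss d)
     = - (\<beta> / e) * (\<Sum>i<d. dotd d w (v i) * J d v e (inc m i) \<beta> y)"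
proof -
  have 1: "(\<integral>z. z l * Jint d v e m \<beta> y z \<partial>std_gauss d) = (\<Sum>i<d. - (\<beta> * v i l) / e * J d v e (inc m i) \<beta> y)"
    if l: "l < d" for l
  proof -
    have "(\<integral>z. z l * Jint d v e m \<beta> y z \<partial>std_gauss d)
      = (\<integral>z. (\<Sum>i<d. - (\<beta> * v i l) / e * Jint d v e (inc m i) \<beta> y z) \<partial>std_gauss d)"
    proof (rule gauss_ibp[where B = "JB d m + (\<Sum>i<d. \<bar>- (\<beta> * v i l) / e\<bar> * JB d (inc m i))"])
      show "((\<lambda>t. Jint d v e m \<beta> y (z(l := t))) has_real_derivative
        (\<Sum>i<d. - (\<beta> * v i l) / e * Jint d v e (inc m i) \<beta> y (z(l := t)))) (at t)" for z t
        by (rule Jint_has_derivative) (use e in \<open>auto simp: dotd_upd[OF l] intro!: derivative_eq_intros\<close>)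
      show "continuous_on UNIV (\<lambda>t. \<Sum>i<d. - (\<beta> * v i l) / e * Jint d v e (inc m i) \<beta> y (z(l := t)))" for z
        using e unfolding continuous_on_def
        by (auto simp del: fun_upd_apply simp: dotd_upd[OF l] intro!: tendsto_intros Jint_tendsto)
      have "0 \<le> (\<Sum>i<d. \<bar>- (\<beta> * v i l) / e\<bar> * JB d (inc m i))"
        by (intro sum_nonneg mult_nonneg_nonneg JB_nonneg) auto
      then show "\<bar>Jint d v e m \<beta> y z\<bar> \<le> JB d m + (\<Sum>i<d. \<bar>- (\<beta> * v i l) / e\<bar> * JB d (inc m i))" for z
        using Jint_bound[of d v e m \<beta> y z] by linarith
      have "\<bar>\<Sum>i<d. - (\<beta> * v i l) / e * Jint d v e (inc m i) \<beta> y z\<bar> \<le> (\<Sum>i<d. \<bar>- (\<beta> * v i l) / e\<bar> * JB d (inc m i))" for z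
        by (rule order_trans[OF sum_abs]) (auto simp only: abs_mult intro!: sum_mono mult_left_mono Jint_bound abs_ge_zero)
      then show "\<bar>\<Sum>i<d. - (\<beta> * v i l) / e * Jint d v e (inc m i) \<beta> y z\<bar> \<le> JB d m + (\<Sum>i<d. \<bar>- (\<beta> * v i l) / e\<bar> * JB d (inc m i))" for z
        using JB_nonneg[of d m] by (meson add_increasing)
    qed (use l in auto)
    then show ?thesis unfolding J_def by (simp add: integrable_Jint del: fun_upd_apply)
  qed
  have int: "integrable (std_gauss d) (\<lambda>z. z l * Jint d v e m \<beta> y z)" if l: "l < d" for l
  proof (rule Bochner_Integration.integrable_bound[of _ "\<lambda>z. JB d m * z l"])
    show "integrable (std_gauss d) (\<lambda>z. JB d m * z l)" by (intro integrable_mult_right integrable_std_gauss_coord l)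
    show "AE z in std_gauss d. norm (z l * Jint d v e m \<beta> y z) \<le> norm (JB d m * z l)"
    proof (rule AE_I2)
      fix z have "\<bar>z l\<bar> * \<bar>Jint d v e m \<beta> y z\<bar> \<le> \<bar>z l\<bar> * \<bar>JB d m\<bar>"
        using Jint_bound[of d v e m \<beta> y z] by (intro mult_left_mono) auto
      then show "norm (z l * Jint d v e m \<beta> y z) \<le> norm (JB d m * z l)" by (simp add: abs_mult mult_ac)
    qed
  qed (auto intro!: borel_measurable_times coord_measurable l simp: borel_measurable_std_gauss)
  have "(\<integral>z. dotd d z w * Jint d v e m \<beta> y z \<partial>std_gauss d) = (\<integral>z. (\<Sum>l<d. w l * (z l * Jint d v e m \<beta> y z)) \<partial>std_gauss d)"
    unfolding dotd_def by (simp add: sum_distrib_left sum_distrib_right mult_ac)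
  also have "\<dots> = (\<Sum>l<d. w l * (\<integral>z. z l * Jint d v e m \<beta> y z \<partial>std_gauss d))"
    by (simp add: int)
  also have "\<dots> = (\<Sum>l<d. \<Sum>i<d. - (\<beta> / e) * (w l * v i l * J d v e (inc m i) \<beta> y))"
    by (auto simp: 1 sum_distrib_left mult_ac intro!: sum.cong simp del: fun_upd_apply)
  also have "\<dots> = - (\<beta> / e) * (\<Sum>i<d. dotd d w (v i) * J d v e (inc m i) \<beta> y)"
    unfolding dotd_def by (subst sum.swap) (simp add: sum_distrib_left sum_distrib_right mult_ac del: fun_upd_apply)
  finally show ?thesis .
qed

section \<open>Gaussian shifts and linear changes of variables\<close>

lemma std_normal_density_shift:
  "std_normal_density (t + s) = std_normal_density t * exp (- s * t - s\<^sup>2 / 2)"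
  unfolding std_normal_density_def
  by (simp add: exp_add[symmetric] power2_sum algebra_simps add_divide_distrib diff_divide_distrib)

lemma nn_integral_std_normal:
  assumes [measurable]: "f \<in> borel_measurable borel"
  shows "(\<integral>\<^sup>+y. f y \<partial>std_normal_distribution) = (\<integral>\<^sup>+y. ennreal (std_normal_density y) * f y \<partial>lborel)"
  by (subst nn_integral_density) auto

text \<open>The one-dimensional Cameron--Martin formula, by translating Lebesgue measure. In
  \<open>ennreal\<close> it covers indicators and products of indicators without integrability
  conditions.\<close>

lemma nn_integral_std_normal_shift:
  assumes [measurable]: "f \<in> borel_measurable borel"
  shows "(\<integral>\<^sup>+y. f y \<partial>std_normal_distribution)
     = (\<integral>\<^sup>+y. f (y + s) * ennreal (exp (- s * y - s\<^sup>2 / 2)) \<partial>std_normal_distribution)"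
proof -
  have eq: "std_normal_density (s + y) = std_normal_density y * exp (- s * y - s\<^sup>2 / 2)" for y
    using std_normal_density_shift[of y s] by (simp add: add.commute)
  have "(\<integral>\<^sup>+y. f y \<partial>std_normal_distribution)
    = (\<integral>\<^sup>+y. ennreal (std_normal_density (s + y)) * f (s + y) \<partial>lborel)"
    using nn_integral_real_affine[of "\<lambda>y. ennreal (std_normal_density y) * f y" 1 s]
    by (subst nn_integral_std_normal) simp_all
  also have "\<dots> = (\<integral>\<^sup>+y. ennreal (std_normal_density y) * (f (y + s) * ennreal (exp (- s * y - s\<^sup>2 / 2))) \<partial>lborel)"
    by (intro nn_integral_cong) (simp add: eq eq[unfolded add.commute[of s]] ennreal_mult mult_ac add.commute)
  also have "\<dots> = (\<integral>\<^sup>+y. f (y + s) * ennreal (exp (- s * y - s\<^sup>2 / 2)) \<partial>std_normal_distribution)"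
    by (subst nn_integral_std_normal) auto
  finally show ?thesis .
qed

text \<open>Coordinates are added one at a time; by Fubini the one-dimensional densities multiply to
  the exponential of the sum.\<close>

lemma nn_integral_PiM_std_normal_shift:
  fixes s :: "nat \<Rightarrow> real"
  assumes "finite I" "f \<in> borel_measurable (PiM I (\<lambda>_. borel))"
  shows "(\<integral>\<^sup>+z. f z \<partial>PiM I (\<lambda>_. std_normal_distribution))
     = (\<integral>\<^sup>+z. f (\<lambda>i\<in>I. z i + s i) * ennreal (exp (- (\<Sum>i\<in>I. s i * z i) - (\<Sum>i\<in>I. s i * s i) / 2))
         \<partial>PiM I (\<lambda>_. std_normal_distribution))"
  using assms
proof (induction I arbitrary: f rule: finite_induct)
  case empty
  have "space (PiM {} (\<lambda>_::nat. std_normal_distribution)) = {\<lambda>_. undefined}" by (simp add: space_PiM)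
  then have "(\<integral>\<^sup>+z. f z \<partial>PiM {} (\<lambda>_. std_normal_distribution)) = (\<integral>\<^sup>+z. f (\<lambda>i\<in>{}. z i + s i) \<partial>PiM {} (\<lambda>_. std_normal_distribution))" for f
    by (intro nn_integral_cong) (simp add: restrict_def)
  from this[of f] show ?case
    by (simp only: sum.empty minus_zero div_0 diff_zero exp_zero ennreal_1 mult_1_right)
next
  case (insert j I)
  interpret product_prob_space "\<lambda>_::nat. std_normal_distribution" "{}"
    by (rule product_prob_space_std_normal)
  have sets_eq: "sets (PiM K (\<lambda>_. std_normal_distribution)) = sets (PiM K (\<lambda>_. borel))" for K :: "nat set"
    by (intro sets_PiM_cong) auto
  note [measurable_cong] = sets_eq
  note [measurable] = insert.prems
  have upd [measurable]: "(\<lambda>(x, y). x(j := y)) \<in> PiM I (\<lambda>_. borel) \<Otimes>\<^sub>M borel \<rightarrow>\<^sub>M PiM (insert j I) (\<lambda>_. borel)"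
    using measurable_add_dim[of j I "\<lambda>_. borel"] by simp
  have g [measurable]: "(\<lambda>x. \<integral>\<^sup>+y. f (x(j := y)) \<partial>std_normal_distribution) \<in> borel_measurable (PiM I (\<lambda>_. borel))"
    by measurable
  let ?e = "\<lambda>I z. ennreal (exp (- (\<Sum>i\<in>I. s i * z i) - (\<Sum>i\<in>I. s i * s i) / 2))"
  have sh [measurable]: "(\<lambda>z. \<lambda>i\<in>K. z i + s i) \<in> PiM K (\<lambda>_. borel) \<rightarrow>\<^sub>M PiM K (\<lambda>_. borel)" for K :: "nat set"
    by (rule measurable_restrict) measurable
  have "(\<integral>\<^sup>+z. f z \<partial>PiM (insert j I) (\<lambda>_. std_normal_distribution))
    = (\<integral>\<^sup>+x. (\<integral>\<^sup>+y. f (x(j := y)) \<partial>std_normal_distribution) \<partial>PiM I (\<lambda>_. std_normal_distribution))"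
    using insert.hyps by (intro product_nn_integral_insert) auto
  also have "\<dots> = (\<integral>\<^sup>+x. (\<integral>\<^sup>+y. f ((\<lambda>i\<in>I. x i + s i)(j := y)) \<partial>std_normal_distribution) * ?e I x \<partial>PiM I (\<lambda>_. std_normal_distribution))"
    by (rule insert.IH[OF g])
  also have "\<dots> = (\<integral>\<^sup>+x. (\<integral>\<^sup>+y. f (\<lambda>i\<in>insert j I. (x(j := y)) i + s i) * ?e (insert j I) (x(j := y)) \<partial>std_normal_distribution) \<partial>PiM I (\<lambda>_. std_normal_distribution))"
  proof (rule nn_integral_cong)
    fix x assume x: "x \<in> space (PiM I (\<lambda>_. std_normal_distribution))"
    have m: "(\<lambda>y. f ((\<lambda>i\<in>I. x i + s i)(j := y))) \<in> borel_measurable borel"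
    proof -
      have "(\<lambda>y. (\<lambda>i\<in>I. x i + s i)(j := y)) \<in> borel \<rightarrow>\<^sub>M PiM (insert j I) (\<lambda>_. borel)"
        using insert.hyps by (intro measurable_fun_upd[where J = I]) (auto simp: space_PiM)
      from measurable_compose[OF this insert.prems] show ?thesis .
    qed
    have eq: "(\<lambda>i\<in>I. x i + s i)(j := y + s j) = (\<lambda>i\<in>insert j I. (x(j := y)) i + s i)" for y
      using insert.hyps by (auto simp: restrict_def fun_eq_iff)
    have e: "?e I x * ennreal (exp (- s j * y - (s j)\<^sup>2 / 2)) = ?e (insert j I) (x(j := y))" for y
    proof -
      have "(\<Sum>i\<in>insert j I. s i * (x(j := y)) i) = s j * y + (\<Sum>i\<in>I. s i * x i)"
        using insert.hyps by (subst sum.insert) (auto intro!: sum.cong)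
      moreover have "(\<Sum>i\<in>insert j I. s i * s i) = s j * s j + (\<Sum>i\<in>I. s i * s i)"
        using insert.hyps by (subst sum.insert) auto
      ultimately show ?thesis
        by (simp add: ennreal_mult[symmetric] exp_add[symmetric] power2_eq_square add_divide_distrib algebra_simps)
    qed
    have "(\<integral>\<^sup>+y. f ((\<lambda>i\<in>I. x i + s i)(j := y)) \<partial>std_normal_distribution) * ?e I x
      = (\<integral>\<^sup>+y. f ((\<lambda>i\<in>I. x i + s i)(j := y + s j)) * ennreal (exp (- s j * y - (s j)\<^sup>2 / 2)) \<partial>std_normal_distribution) * ?e I x"
      by (subst nn_integral_std_normal_shift[OF m, of "s j"]) simp
    also have "\<dots> = (\<integral>\<^sup>+y. f ((\<lambda>i\<in>I. x i + s i)(j := y + s j)) * ennreal (exp (- s j * y - (s j)\<^sup>2 / 2)) * ?e I x \<partial>std_normal_distribution)"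
      by (subst nn_integral_multc) (use measurable_compose[OF _ m, of "\<lambda>y. y + s j" borel] in \<open>auto\<close>)
    also have "\<dots> = (\<integral>\<^sup>+y. f (\<lambda>i\<in>insert j I. (x(j := y)) i + s i) * ?e (insert j I) (x(j := y)) \<partial>std_normal_distribution)"
      unfolding eq e[symmetric] by (intro nn_integral_cong) (simp only: mult_ac)
    finally show "(\<integral>\<^sup>+y. f ((\<lambda>i\<in>I. x i + s i)(j := y)) \<partial>std_normal_distribution) * ?e I x
      = (\<integral>\<^sup>+y. f (\<lambda>i\<in>insert j I. (x(j := y)) i + s i) * ?e (insert j I) (x(j := y)) \<partial>std_normal_distribution)" .
  qed
  also have "\<dots> = (\<integral>\<^sup>+z. f (\<lambda>i\<in>insert j I. z i + s i) * ?e (insert j I) z \<partial>PiM (insert j I) (\<lambda>_. std_normal_distribution))"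
    using insert.hyps by (intro product_nn_integral_insert[symmetric]) (auto, measurable)
  finally show ?case .
qed

lemma nn_integral_std_gauss_shift:
  assumes "f \<in> borel_measurable (PiM {..<d} (\<lambda>_. borel))"
  shows "(\<integral>\<^sup>+z. f z \<partial>std_gauss d)
     = (\<integral>\<^sup>+z. f (\<lambda>i\<in>{..<d}. z i + s i) * ennreal (exp (- dotd d s z - dotd d s s / 2)) \<partial>std_gauss d)"
  unfolding std_gauss_def dotd_def by (rule nn_integral_PiM_std_normal_shift) (use assms in auto)

section \<open>Integrating out the noise coordinates\<close>

lemma nn_integral_std_normal_atMost:
  "(\<integral>\<^sup>+y. indicator {..t} y \<partial>std_normal_distribution) = ennreal (psi 0 t)"
proof -
  interpret prob_space std_normal_distribution by (rule prob_space_std_normal)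
  show ?thesis by (simp add: psi_0_measure emeasure_eq_measure)
qed

lemma nn_integral_PiM_boxes:
  fixes h :: "nat \<Rightarrow> real"
  assumes "finite I"
  shows "(\<integral>\<^sup>+x. (\<Prod>i\<in>I. indicator {..h i} (x i)) \<partial>PiM I (\<lambda>_. std_normal_distribution))
     = (\<Prod>i\<in>I. ennreal (psi 0 (h i)))"
proof -
  interpret product_prob_space "\<lambda>_::nat. std_normal_distribution" "{}"
    by (rule product_prob_space_std_normal)
  show ?thesis
    using assms by (subst product_nn_integral_prod) (auto simp: nn_integral_std_normal_atMost)
qed

lemma measurable_case_prod_compose:
  fixes g :: "real \<Rightarrow> real \<Rightarrow> 'b"
  assumes "case_prod g \<in> measurable (borel \<Otimes>\<^sub>M borel) N" "a \<in> borel_measurable M" "b \<in> borel_measurable M"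
  shows "(\<lambda>n. g (a n) (b n)) \<in> measurable M N"
  using measurable_compose[OF measurable_Pair[OF assms(2,3)] assms(1)] by simp

lemma indicator_atMost_measurable:
  fixes f g :: "'a \<Rightarrow> real"
  assumes [measurable]: "f \<in> borel_measurable M" "g \<in> borel_measurable M"
  shows "(\<lambda>x. indicator {..f x} (g x) :: ennreal) \<in> borel_measurable M"
  unfolding indicator_def atMost_iff by measurable

text \<open>The bounds on the other coordinates depend on n_j alone. Given n_j those coordinates are
  still independent, so every indicator integrates to a value of the distribution function.\<close>

lemma nn_integral_std_gauss_boxes1:
  fixes g :: "real \<Rightarrow> ennreal" and h :: "nat \<Rightarrow> real \<Rightarrow> real"
  assumes j: "j < d" and [measurable]: "g \<in> borel_measurable borel" "\<And>i. h i \<in> borel_measurable borel"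
  shows "(\<integral>\<^sup>+n. g (n j) * (\<Prod>i\<in>{..<d} - {j}. indicator {..h i (n j)} (n i)) \<partial>std_gauss d)
     = (\<integral>\<^sup>+y. g y * (\<Prod>i\<in>{..<d} - {j}. ennreal (psi 0 (h i y))) \<partial>std_normal_distribution)"
proof -
  interpret product_prob_space "\<lambda>_::nat. std_normal_distribution" "{}"
    by (rule product_prob_space_std_normal)
  define I where "I = {..<d} - {j}"
  have I: "finite I" "j \<notin> I" "{..<d} = insert j I" using j by (auto simp: I_def)
  have c: "(\<lambda>n. n i) \<in> borel_measurable (PiM K (\<lambda>_. std_normal_distribution))" if "i \<in> K" for i :: nat and K
    using measurable_component_singleton[of i K "\<lambda>_. std_normal_distribution"] that by simp
  have m: "(\<lambda>n. g (n j) * (\<Prod>i\<in>I. indicator {..h i (n j)} (n i))) \<in> borel_measurable (PiM (insert j I) (\<lambda>_. std_normal_distribution))"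
    by (intro borel_measurable_times_ennreal borel_measurable_prod_ennreal indicator_atMost_measurable c
        measurable_compose[OF c assms(2)] measurable_compose[OF c assms(3)]) auto
  have "(\<integral>\<^sup>+n. g (n j) * (\<Prod>i\<in>I. indicator {..h i (n j)} (n i)) \<partial>PiM (insert j I) (\<lambda>_. std_normal_distribution))
    = (\<integral>\<^sup>+y. \<integral>\<^sup>+x. g y * (\<Prod>i\<in>I. indicator {..h i y} (x i)) \<partial>PiM I (\<lambda>_. std_normal_distribution) \<partial>std_normal_distribution)"
    unfolding product_nn_integral_insert_rev[OF I(1,2) m]
    using I(2) by (intro nn_integral_cong arg_cong2[where f = "(*)"] prod.cong) auto
  also have "\<dots> = (\<integral>\<^sup>+y. g y * (\<Prod>i\<in>I. ennreal (psi 0 (h i y))) \<partial>std_normal_distribution)"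
    by (intro nn_integral_cong, subst nn_integral_cmult)
       (auto intro!: borel_measurable_prod_ennreal measurable_compose[OF measurable_component_singleton] simp: nn_integral_PiM_boxes[OF I(1)])
  finally show ?thesis unfolding std_gauss_def I_def[symmetric] unfolding I(3) .
qed

lemma nn_integral_std_gauss_boxes2:
  fixes g :: "real \<Rightarrow> real \<Rightarrow> ennreal" and h :: "nat \<Rightarrow> real \<Rightarrow> real \<Rightarrow> real"
  assumes j: "j < d" "k < d" "j \<noteq> k"
    and [measurable]: "case_prod g \<in> borel_measurable (borel \<Otimes>\<^sub>M borel)"
      "\<And>i. case_prod (h i) \<in> borel_measurable (borel \<Otimes>\<^sub>M borel)"
  shows "(\<integral>\<^sup>+n. g (n j) (n k) * (\<Prod>i\<in>{..<d} - {j, k}. indicator {..h i (n j) (n k)} (n i)) \<partial>std_gauss d)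
     = (\<integral>\<^sup>+y. (\<integral>\<^sup>+y'. g y y' * (\<Prod>i\<in>{..<d} - {j, k}. ennreal (psi 0 (h i y y'))) \<partial>std_normal_distribution) \<partial>std_normal_distribution)"
proof -
  interpret product_prob_space "\<lambda>_::nat. std_normal_distribution" "{}"
    by (rule product_prob_space_std_normal)
  define I where "I = {..<d} - {j, k}"
  have I: "finite I" "k \<notin> I" "finite (insert k I)" "j \<notin> insert k I" "{..<d} = insert j (insert k I)" "{..<d} - {j, k} = I"
    using j by (auto simp: I_def)
  have c: "(\<lambda>n. n i) \<in> borel_measurable (PiM K (\<lambda>_. std_normal_distribution))" if "i \<in> K" for i :: nat and K
    using measurable_component_singleton[of i K "\<lambda>_. std_normal_distribution"] that by simp
  have m: "(\<lambda>n. g (n j) (n k) * (\<Prod>i\<in>I. indicator {..h i (n j) (n k)} (n i))) \<in> borel_measurable (PiM (insert j (insert k I)) (\<lambda>_. std_normal_distribution))"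
    by (intro borel_measurable_times_ennreal borel_measurable_prod_ennreal indicator_atMost_measurable measurable_case_prod_compose[OF assms(4)] measurable_case_prod_compose[OF assms(5)] c) auto
  have m2: "(\<lambda>n. g y (n k) * (\<Prod>i\<in>I. indicator {..h i y (n k)} (n i))) \<in> borel_measurable (PiM (insert k I) (\<lambda>_. std_normal_distribution))" for y
    by (intro borel_measurable_times_ennreal borel_measurable_prod_ennreal indicator_atMost_measurable measurable_case_prod_compose[OF assms(4)] measurable_case_prod_compose[OF assms(5)] c borel_measurable_const) auto
  have "(\<integral>\<^sup>+n. g (n j) (n k) * (\<Prod>i\<in>I. indicator {..h i (n j) (n k)} (n i)) \<partial>PiM (insert j (insert k I)) (\<lambda>_. std_normal_distribution))
    = (\<integral>\<^sup>+y. \<integral>\<^sup>+x. g y (x k) * (\<Prod>i\<in>I. indicator {..h i y (x k)} (x i)) \<partial>PiM (insert k I) (\<lambda>_. std_normal_distribution) \<partial>std_normal_distribution)"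
    unfolding product_nn_integral_insert_rev[OF I(3,4) m]
    using I(4) j by (intro nn_integral_cong arg_cong2[where f = "(*)"] prod.cong) auto
  also have "\<dots> = (\<integral>\<^sup>+y. \<integral>\<^sup>+y'. g y y' * (\<Prod>i\<in>I. ennreal (psi 0 (h i y y'))) \<partial>std_normal_distribution \<partial>std_normal_distribution)"
  proof (rule nn_integral_cong)
    fix y
    have "(\<integral>\<^sup>+x. g y (x k) * (\<Prod>i\<in>I. indicator {..h i y (x k)} (x i)) \<partial>PiM (insert k I) (\<lambda>_. std_normal_distribution))
      = (\<integral>\<^sup>+y'. \<integral>\<^sup>+x. g y y' * (\<Prod>i\<in>I. indicator {..h i y y'} (x i)) \<partial>PiM I (\<lambda>_. std_normal_distribution) \<partial>std_normal_distribution)"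
      unfolding product_nn_integral_insert_rev[OF I(1,2) m2]
      using I(2) by (intro nn_integral_cong arg_cong2[where f = "(*)"] prod.cong) auto
    also have "\<dots> = (\<integral>\<^sup>+y'. g y y' * (\<Prod>i\<in>I. ennreal (psi 0 (h i y y'))) \<partial>std_normal_distribution)"
      by (intro nn_integral_cong, subst nn_integral_cmult)
         (auto intro!: borel_measurable_prod_ennreal measurable_compose[OF measurable_component_singleton] simp: nn_integral_PiM_boxes[OF I(1)])
    finally show "(\<integral>\<^sup>+x. g y (x k) * (\<Prod>i\<in>I. indicator {..h i y (x k)} (x i)) \<partial>PiM (insert k I) (\<lambda>_. std_normal_distribution))
      = (\<integral>\<^sup>+y'. g y y' * (\<Prod>i\<in>I. ennreal (psi 0 (h i y y'))) \<partial>std_normal_distribution)" .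
  qed
  finally show ?thesis unfolding std_gauss_def I(6) unfolding I(5) .
qed

text \<open>The substitution y = (p + a + r g) / e, y' = (q + r a + g) / e with Jacobian (1 - r^2) /
  e^2, carried out one variable at a time.\<close>

lemma nn_integral_linear_change2:
  fixes F :: "real \<Rightarrow> real \<Rightarrow> ennreal"
  assumes [measurable]: "case_prod F \<in> borel_measurable (borel \<Otimes>\<^sub>M borel)" and e: "e > 0" and r: "r\<^sup>2 < 1"
  shows "(\<integral>\<^sup>+y. \<integral>\<^sup>+y'. F y y' \<partial>lborel \<partial>lborel)
    = ennreal ((1 - r\<^sup>2) / e\<^sup>2) * (\<integral>\<^sup>+a. \<integral>\<^sup>+g. F ((p + a + r * g) / e) ((q + r * a + g) / e) \<partial>lborel \<partial>lborel)"
proof -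
  let ?D = "(1 - r\<^sup>2) / e"
  have D: "?D > 0" using e r by simp
  \<comment> \<open>For fixed y one has a = e y - p - r g, which makes y' affine in g with slope (1
    - r^2) / e.\<close>
  have "(\<integral>\<^sup>+y. \<integral>\<^sup>+y'. F y y' \<partial>lborel \<partial>lborel)
    = (\<integral>\<^sup>+y. ennreal ?D * (\<integral>\<^sup>+g. F y ((q + r * (e * y - p)) / e + ?D * g) \<partial>lborel) \<partial>lborel)"
  proof (intro nn_integral_cong)
    fix y
    show "(\<integral>\<^sup>+y'. F y y' \<partial>lborel) = ennreal ?D * (\<integral>\<^sup>+g. F y ((q + r * (e * y - p)) / e + ?D * g) \<partial>lborel)"
      using nn_integral_real_affine[of "F y" ?D "(q + r * (e * y - p)) / e"] D
e r
      by (simp add: power2_eq_square)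
  qed
  also have "\<dots> = ennreal ?D * (\<integral>\<^sup>+y. \<integral>\<^sup>+g. F y ((q + r * (e * y - p)) / e + ?D * g) \<partial>lborel \<partial>lborel)"
    by (intro nn_integral_cmult) measurable
  also have "(\<integral>\<^sup>+y. \<integral>\<^sup>+g. F y ((q + r * (e * y - p)) / e + ?D * g) \<partial>lborel \<partial>lborel)
    = (\<integral>\<^sup>+g. \<integral>\<^sup>+y. F y ((q + r * (e * y - p)) / e + ?D * g) \<partial>lborel \<partial>lborel)"
    by (rule lborel_pair.Fubini'[symmetric]) measurable
  also have "\<dots> = (\<integral>\<^sup>+g. ennreal (1 / e) * (\<integral>\<^sup>+a. F ((p + a + r * g) / e) ((q + r * a + g) / e) \<partial>lborel) \<partial>lborel)"
  proof (intro nn_integral_cong)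
    fix g
    have 1: "(p + r * g) / e + 1 / e * a = (p + a + r * g) / e" for a
      using e by (simp add: field_simps)
    have 2: "(q + r * (e * ((p + a + r * g) / e) - p)) / e + ?D * g = (q + r * a + g) / e" for a
      using e by (simp add: field_simps power2_eq_square)
    show "(\<integral>\<^sup>+y. F y ((q + r * (e * y - p)) / e + ?D * g) \<partial>lborel)
      = ennreal (1 / e) * (\<integral>\<^sup>+a. F ((p + a + r * g) / e) ((q + r * a + g) / e) \<partial>lborel)"
      using nn_integral_real_affine[of "\<lambda>y. F y ((q + r * (e * y - p)) / e + ?D * g)" "1 / e" "(p + r * g) / e"] e
      unfolding 1 2 by simp
  qed
  also have "\<dots> = ennreal (1 / e) * (\<integral>\<^sup>+g. \<integral>\<^sup>+a. F ((p + a + r * g) / e) ((q + r * a + g) / e) \<partial>lborel \<partial>lborel)"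
    by (intro nn_integral_cmult) measurable
  also have "(\<integral>\<^sup>+g. \<integral>\<^sup>+a. F ((p + a + r * g) / e) ((q + r * a + g) / e) \<partial>lborel \<partial>lborel)
    = (\<integral>\<^sup>+a. \<integral>\<^sup>+g. F ((p + a + r * g) / e) ((q + r * a + g) / e) \<partial>lborel \<partial>lborel)"
    by (rule lborel_pair.Fubini') measurable
  finally show ?thesis
    using e D by (simp add: mult.assoc[symmetric] ennreal_mult[symmetric] power2_eq_square)
qed

section \<open>Normal cones over faces and ridges\<close>

abbreviation e1 :: "nat \<Rightarrow> nat \<Rightarrow> nat" where
  "e1 j \<equiv> inc (\<lambda>_. 0) j"

abbreviation e2 :: "nat \<Rightarrow> nat \<Rightarrow> nat \<Rightarrow> nat" where
  "e2 j k \<equiv> inc (e1 j) k"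

text \<open>Under this normalization every coordinate of \<beta> V z + e n has variance 1, and
  \<open>S\<close> below is the covariance of that vector. \<open>polytope_scaled\<close> reduces
  the general case to this one.\<close>

locale polytope =
  fixes d :: nat and v :: "nat \<Rightarrow> nat \<Rightarrow> real" and \<beta> e :: real
  assumes e_pos: "0 < e" and norm1: "\<beta>\<^sup>2 + e\<^sup>2 = 1"
    and unit: "\<And>i. i < d \<Longrightarrow> dotd d (v i) (v i) = 1"
begin

definition S :: "nat \<Rightarrow> nat \<Rightarrow> real" where
  "S i j = \<beta>\<^sup>2 * dotd d (v i) (v j) + (if i = j then e\<^sup>2 else 0)"

lemma S_diag: "j < d \<Longrightarrow> S j j = 1"
  using unit norm1 by (simp add: S_def)

lemma S_commute: "S i j = S j i"
  unfolding S_def by (simp add: dotd_commute)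

lemma Jint_nonneg: "(\<And>i. m i \<le> 1) \<Longrightarrow> 0 \<le> Jint d v e' m b y z"
  unfolding Jint_def by (intro prod_nonneg psi_nonneg) auto

lemma J_nonneg: "(\<And>i. m i \<le> 1) \<Longrightarrow> 0 \<le> J d v e' m b y"
  unfolding J_def by (intro Bochner_Integration.integral_nonneg Jint_nonneg)

lemma nn_integral_Jint: "(\<And>i. m i \<le> 1) \<Longrightarrow> (\<integral>\<^sup>+z. ennreal (Jint d v e' m b y z) \<partial>std_gauss d) = ennreal (J d v e' m b y)"
  unfolding J_def by (intro nn_integral_eq_integral integrable_Jint AE_I2 Jint_nonneg)

lemma dotd_dir1: "dotd d (\<lambda>l. \<beta> * (\<Sum>k<d. w k * v k l)) z = \<beta> * (\<Sum>k<d. w k * dotd d z (v k))"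
  unfolding dotd_def
  by (simp add: sum_distrib_left sum_distrib_right mult_ac) (subst sum.swap, simp)

lemma dotd_shift:
  "dotd d (\<lambda>l\<in>{..<d}. z l + \<beta> * (\<Sum>k<d. w k * v k l)) (v i)
    = dotd d z (v i) + \<beta> * (\<Sum>k<d. w k * dotd d (v i) (v k))"
proof -
  have "dotd d (\<lambda>l\<in>{..<d}. z l + \<beta> * (\<Sum>k<d. w k * v k l)) (v i)
    = dotd d z (v i) + dotd d (\<lambda>l. \<beta> * (\<Sum>k<d. w k * v k l)) (v i)"
    unfolding dotd_def by (simp only: sum.distrib[symmetric]) (intro sum.cong, auto simp: distrib_right)
  then show ?thesis by (simp only: dotd_dir1)
qed

lemma dotd_dir2: "dotd d (\<lambda>l. \<beta> * (\<Sum>k<d. w k * v k l)) (\<lambda>l. \<beta> * (\<Sum>k<d. w k * v k l))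
    = \<beta>\<^sup>2 * (\<Sum>i<d. \<Sum>k<d. w i * w k * dotd d (v i) (v k))"
proof -
  have "dotd d (\<lambda>l. \<beta> * (\<Sum>k<d. w k * v k l)) (\<lambda>l. \<beta> * (\<Sum>k<d. w k * v k l))
    = \<beta> * (\<Sum>i<d. w i * dotd d (\<lambda>l. \<beta> * (\<Sum>k<d. w k * v k l)) (v i))"
    by (rule dotd_dir1)
  also have "\<dots> = \<beta> * (\<Sum>i<d. w i * (\<beta> * (\<Sum>k<d. w k * dotd d (v i) (v k))))"
    by (simp only: dotd_dir1)
  finally show ?thesis by (simp add: sum_distrib_left power2_eq_square mult_ac)
qed

lemma sum_S: "i < d \<Longrightarrow> (\<Sum>k<d. w k * S i k) = \<beta>\<^sup>2 * (\<Sum>k<d. w k * dotd d (v i) (v k)) + e\<^sup>2 * w i"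
proof -
  assume i: "i < d"
  have "(\<Sum>k<d. w k * S i k) = (\<Sum>k<d. \<beta>\<^sup>2 * (w k * dotd d (v i) (v k)) + (if k = i then e\<^sup>2 * w i else 0))"
    unfolding S_def by (intro sum.cong) (auto simp: algebra_simps)
  then show ?thesis using i by (simp add: sum.distrib sum_distrib_left)
qed

text \<open>By the Cameron--Martin shift of \<open>Z\<close> by \<open>\<beta> (\<Sum>k. w k * v k)\<close>.\<close>

lemma nn_integral_Jint_shift:
  assumes m: "\<And>i. m i \<le> 1" and w: "\<And>i. i < d \<Longrightarrow> m i = 0 \<Longrightarrow> w i = 0"
  shows "(\<integral>\<^sup>+z. ennreal (Jint d v e m \<beta> (\<lambda>i. c i + (\<Sum>k<d. w k * S i k)) z) \<partial>std_gauss d)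
    = ennreal (exp (- (\<Sum>i<d. w i * c i) - (\<Sum>i<d. \<Sum>k<d. w i * w k * S i k) / 2) * J d v e m \<beta> c)"
proof -
  define s where "s l = \<beta> * (\<Sum>k<d. w k * v k l)" for l
  let ?E = "exp (- (\<Sum>i<d. w i * c i) - (\<Sum>i<d. \<Sum>k<d. w i * w k * S i k) / 2)"
  let ?sh = "\<lambda>z. \<lambda>l\<in>{..<d}. z l + s l"
  \<comment> \<open>S w consists of \<beta>^2 V V^T w and e^2 w. The shift of z cancels the first
    part, and the second leaves e w_i in the argument of the i-th factor. A density factor turns
    this into an exponential; a distribution function cannot, which is why w vanishes where m
    does.\<close>
  have 1: "Jint d v e m \<beta> (\<lambda>i. c i + (\<Sum>k<d. w k * S i k)) (?sh z)
    = Jint d v e m \<beta> c z * exp (\<Sum>i<d. - w i * (c i - \<beta> * dotd d z (v i)) - e\<^sup>2 * (w i)\<^sup>2 / 2)" for z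
  proof -
    have "psi (m i) ((c i + (\<Sum>k<d. w k * S i k) - \<beta> * dotd d (?sh z) (v i)) / e)
      = psi (m i) ((c i - \<beta> * dotd d z (v i)) / e) * exp (- w i * (c i - \<beta> * dotd d z (v i)) - e\<^sup>2 * (w i)\<^sup>2 / 2)"
      if i: "i < d" for i
    proof -
      let ?t = "(c i - \<beta> * dotd d z (v i)) / e"
      have arg: "(c i + (\<Sum>k<d. w k * S i k) - \<beta> * dotd d (?sh z) (v i)) / e = ?t + e * w i"
        using e_pos unfolding sum_S[OF i] s_def dotd_shift by (simp add: field_simps power2_eq_square)
      show ?thesis
      proof (cases "m i = 0")
        case True
        then show ?thesis unfolding arg using w[OF i True] by simp
      next
        case False
        then have mi: "m i = Suc 0" using m[of i] by simp
        have "std_normal_density (?t + e * w i) = std_normal_density ?t * exp (- (e * w i) * ?t - (e * w i)\<^sup>2 / 2)"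
          by (rule std_normal_density_shift)
        also have "- (e * w i) * ?t - (e * w i)\<^sup>2 / 2 = - w i * (c i - \<beta> * dotd d z (v i)) - e\<^sup>2 * (w i)\<^sup>2 / 2"
          using e_pos by (simp add: field_simps power_mult_distrib)
        finally show ?thesis unfolding arg mi psi_1 .
      qed
    qed
    then show ?thesis
      unfolding Jint_def by (simp add: exp_sum prod.distrib[symmetric])
  qed
  \<comment> \<open>The terms linear in z cancel, and |s|^2 + e^2 |w|^2 = w^T S w, so the remaining
    weight does not depend on z.\<close>
  have 2: "exp (\<Sum>i<d. - w i * (c i - \<beta> * dotd d z (v i)) - e\<^sup>2 * (w i)\<^sup>2 / 2) * exp (- dotd d s z - dotd d s s / 2) = ?E" for z
  proof -
    have "(\<Sum>i<d. \<Sum>k<d. w i * w k * S i k) = (\<Sum>i<d. w i * (\<Sum>k<d. w k * S i k))"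
      by (simp add: sum_distrib_left mult_ac)
    also have "\<dots> = (\<Sum>i<d. w i * (\<beta>\<^sup>2 * (\<Sum>k<d. w k * dotd d (v i) (v k)) + e\<^sup>2 * w i))"
      by (intro sum.cong refl) (simp only: lessThan_iff sum_S)
    also have "\<dots> = dotd d s s + e\<^sup>2 * (\<Sum>i<d. (w i)\<^sup>2)"
      unfolding s_def dotd_dir2
      by (simp add: sum_distrib_left sum.distrib distrib_left power2_eq_square mult_ac)
    finally have q: "(\<Sum>i<d. \<Sum>k<d. w i * w k * S i k) = dotd d s s + e\<^sup>2 * (\<Sum>i<d. (w i)\<^sup>2)" .
    have l: "dotd d s z = (\<Sum>i<d. w i * (\<beta> * dotd d z (v i)))"
      unfolding s_def dotd_dir1 by (simp add: sum_distrib_left mult_ac)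
    show ?thesis
      unfolding exp_add[symmetric] q l
      by (simp add: sum_subtractf sum.distrib right_diff_distrib sum_distrib_left sum_negf add_divide_distrib sum_divide_distrib)
  qed
  have "(\<integral>\<^sup>+z. ennreal (Jint d v e m \<beta> (\<lambda>i. c i + (\<Sum>k<d. w k * S i k)) z) \<partial>std_gauss d)
    = (\<integral>\<^sup>+z. ennreal (Jint d v e m \<beta> (\<lambda>i. c i + (\<Sum>k<d. w k * S i k)) (?sh z)) * ennreal (exp (- dotd d s z - dotd d s s / 2)) \<partial>std_gauss d)"
    by (rule nn_integral_std_gauss_shift) measurable
  also have "\<dots> = (\<integral>\<^sup>+z. ennreal ?E * ennreal (Jint d v e m \<beta> c z) \<partial>std_gauss d)"
  proof (intro nn_integral_cong)
    fix z
    have "Jint d v e m \<beta> (\<lambda>i. c i + (\<Sum>k<d. w k * S i k)) (?sh z) * exp (- dotd d s z - dotd d s s / 2) = ?E * Jint d v e m \<beta> c z"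
      unfolding 1 2[of z, symmetric] by simp
    then show "ennreal (Jint d v e m \<beta> (\<lambda>i. c i + (\<Sum>k<d. w k * S i k)) (?sh z)) * ennreal (exp (- dotd d s z - dotd d s s / 2))
      = ennreal ?E * ennreal (Jint d v e m \<beta> c z)"
      by (simp only: ennreal_mult[OF Jint_nonneg[OF m] exp_ge_zero, symmetric] ennreal_mult[OF exp_ge_zero Jint_nonneg[OF m], symmetric])
  qed
  also have "\<dots> = ennreal (?E * J d v e m \<beta> c)"
    by (subst nn_integral_cmult)
       (simp_all only: nn_integral_Jint[OF m] ennreal_mult[OF exp_ge_zero J_nonneg[OF m]] borel_measurable_std_gauss, measurable)
  finally show ?thesis .
qed

text \<open>With the powers of e divided out, \<open>D1\<close> and \<open>D2\<close> are the first
  and second partial derivatives at c of the distribution function of \<beta> V Z + e n. For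
  distinct j and k they are the densities carried by the faces and ridges of {y. y <= c}.\<close>

definition D1 :: "(nat \<Rightarrow> real) \<Rightarrow> nat \<Rightarrow> real" where
  "D1 c j = J d v e (e1 j) \<beta> c / e"

definition D2 :: "(nat \<Rightarrow> real) \<Rightarrow> nat \<Rightarrow> nat \<Rightarrow> real" where
  "D2 c j k = J d v e (e2 j k) \<beta> c / e\<^sup>2"

lemma D1_nonneg: "0 \<le> D1 c j"
  unfolding D1_def using e_pos by (intro divide_nonneg_pos J_nonneg) auto

lemma D2_nonneg: "j \<noteq> k \<Longrightarrow> 0 \<le> D2 c j k"
  unfolding D2_def using e_pos by (intro divide_nonneg_pos J_nonneg) auto

definition exc :: "(nat \<Rightarrow> real) \<Rightarrow> nat \<Rightarrow> (nat \<Rightarrow> real) \<Rightarrow> (nat \<Rightarrow> real) \<Rightarrow> real" where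
  "exc c i z n = \<beta> * dotd d z (v i) + e * n i - c i"

text \<open>With \<open>y = \<beta> V z + e n\<close>, \<open>X1\<close> is the indicator of the event that \<open>y - a S e\<^sub>j\<close> lies on the
  \<open>j\<close>-th face of \<open>{y. y \<le> c}\<close> for some \<open>a \<in> B\<close>, and \<open>X2\<close> of the event that \<open>y - a S e\<^sub>j - g S e\<^sub>k\<close>
  lies on the ridge \<open>y\<^sub>j = c\<^sub>j, y\<^sub>k = c\<^sub>k\<close> for some \<open>(a, g) \<in> B\<close>.\<close>

definition X1 :: "(nat \<Rightarrow> real) \<Rightarrow> real set \<Rightarrow> nat \<Rightarrow> (nat \<Rightarrow> real) \<Rightarrow> (nat \<Rightarrow> real) \<Rightarrow> ennreal" where
  "X1 c B j z n = indicator B (exc c j z n) *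
     (\<Prod>i\<in>{..<d} - {j}. indicator {..(c i + exc c j z n * S i j - \<beta> * dotd d z (v i)) / e} (n i))"

definition X2 :: "(nat \<Rightarrow> real) \<Rightarrow> (real \<times> real) set \<Rightarrow> nat \<Rightarrow> nat \<Rightarrow> (nat \<Rightarrow> real) \<Rightarrow> (nat \<Rightarrow> real) \<Rightarrow> ennreal" where
  "X2 c B j k z n =
    (let r = S j k; a = (exc c j z n - r * exc c k z n) / (1 - r\<^sup>2); g = (exc c k z n - r * exc c j z n) / (1 - r\<^sup>2)
     in indicator B (a, g) *
       (\<Prod>i\<in>{..<d} - {j, k}. indicator {..(c i + (a * S i j + g * S i k) - \<beta> * dotd d z (v i)) / e} (n i)))"

text \<open>Given z, integrating out all noise but n_j and substituting the multiplier a for n_j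
  costs a factor 1 / e. The remaining \<open>Jint\<close> is taken at c + a S e_j; shifting back to
  c by \<open>nn_integral_Jint_shift\<close> leaves the weight exp (- a c_j - a^2 / 2).\<close>

lemma X1_integral:
  assumes j: "j < d" and B [measurable]: "B \<in> sets borel"
  shows "(\<integral>\<^sup>+z. \<integral>\<^sup>+n. X1 c B j z n \<partial>std_gauss d \<partial>std_gauss d)
    = ennreal (D1 c j) * (\<integral>\<^sup>+a. indicator B a * ennreal (exp (- a * c j - a\<^sup>2 / 2)) \<partial>lborel)"
proof -
  interpret G: prob_space "std_gauss d" by (rule prob_space_std_gauss)
  interpret P: pair_sigma_finite "std_gauss d" lborel ..
  let ?I = "{..<d} - {j}"
  let ?Y = "\<lambda>a i. c i + a * S i j"
  have J1: "Jint d v e (e1 j) \<beta> (?Y a) z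
    = std_normal_density ((c j + a - \<beta> * dotd d z (v j)) / e) * (\<Prod>i\<in>?I. psi 0 ((c i + a * S i j - \<beta> * dotd d z (v i)) / e))" for a z
    unfolding Jint_def using j
    by (subst prod.remove[of _ j]) (auto simp: psi_1 S_diag intro!: prod.cong)
  have "(\<integral>\<^sup>+n. X1 c B j z n \<partial>std_gauss d)
    = ennreal (1 / e) * (\<integral>\<^sup>+a. indicator B a * ennreal (Jint d v e (e1 j) \<beta> (?Y a) z) \<partial>lborel)" for z
  proof -
    let ?x = "\<lambda>y. \<beta> * dotd d z (v j) + e * y - c j"
    define F where "F y = ennreal (std_normal_density y) * (indicator B (?x y) * (\<Prod>i\<in>?I. ennreal (psi 0 ((c i + ?x y * S i j - \<beta> * dotd d z (v i)) / e))))" for y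
    have Fm: "F \<in> borel_measurable borel" unfolding F_def by measurable
    have "(\<integral>\<^sup>+n. X1 c B j z n \<partial>std_gauss d)
      = (\<integral>\<^sup>+y. indicator B (?x y) * (\<Prod>i\<in>?I. ennreal (psi 0 ((c i + ?x y * S i j - \<beta> * dotd d z (v i)) / e))) \<partial>std_normal_distribution)"
      unfolding X1_def exc_def
      using nn_integral_std_gauss_boxes1[OF j, of "\<lambda>y. indicator B (?x y)" "\<lambda>i y. (c i + ?x y * S i j - \<beta> * dotd d z (v i)) / e"]
      by simp
    also have "\<dots> = (\<integral>\<^sup>+y. F y \<partial>lborel)"
      unfolding F_def by (rule nn_integral_std_normal) measurable
    also have "\<dots> = ennreal (1 / e) * (\<integral>\<^sup>+a. F ((c j - \<beta> * dotd d z (v j)) / e + 1 / e * a) \<partial>lborel)"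
      using nn_integral_real_affine[of F "1 / e" "(c j - \<beta> * dotd d z (v j)) / e"] e_pos by (simp add: Fm)
    also have "\<dots> = ennreal (1 / e) * (\<integral>\<^sup>+a. indicator B a * ennreal (Jint d v e (e1 j) \<beta> (?Y a) z) \<partial>lborel)"
    proof (intro arg_cong2[where f = "(*)"] refl nn_integral_cong)
      fix a :: real
      have 1: "?x ((c j - \<beta> * dotd d z (v j)) / e + 1 / e * a) = a"
        using e_pos by (simp add: field_simps)
      have 2: "(c j - \<beta> * dotd d z (v j)) / e + 1 / e * a = (c j + a - \<beta> * dotd d z (v j)) / e"
        by (simp add: add_divide_distrib diff_divide_distrib)
      have 3: "(\<Prod>i\<in>?I. ennreal (psi 0 ((c i + a * S i j - \<beta> * dotd d z (v i)) / e))) = ennreal (\<Prod>i\<in>?I. psi 0 ((c i + a * S i j - \<beta> * dotd d z (v i)) / e))"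
        by (rule prod_ennreal) (simp add: psi_0_nonneg)
      show "F ((c j - \<beta> * dotd d z (v j)) / e + 1 / e * a) = indicator B a * ennreal (Jint d v e (e1 j) \<beta> (?Y a) z)"
        unfolding F_def 1 unfolding 2 3 J1 by (subst ennreal_mult) (auto simp: psi_0_nonneg prod_nonneg mult_ac)
    qed
    finally show ?thesis .
  qed
  then have "(\<integral>\<^sup>+z. \<integral>\<^sup>+n. X1 c B j z n \<partial>std_gauss d \<partial>std_gauss d)
    = (\<integral>\<^sup>+z. ennreal (1 / e) * (\<integral>\<^sup>+a. indicator B a * ennreal (Jint d v e (e1 j) \<beta> (?Y a) z) \<partial>lborel) \<partial>std_gauss d)"
    by simp
  also have "\<dots> = ennreal (1 / e) * (\<integral>\<^sup>+z. (\<integral>\<^sup>+a. indicator B a * ennreal (Jint d v e (e1 j) \<beta> (?Y a) z) \<partial>lborel) \<partial>std_gauss d)"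
    unfolding Jint_def by (intro nn_integral_cmult) measurable
  also have "(\<integral>\<^sup>+z. (\<integral>\<^sup>+a. indicator B a * ennreal (Jint d v e (e1 j) \<beta> (?Y a) z) \<partial>lborel) \<partial>std_gauss d)
    = (\<integral>\<^sup>+a. (\<integral>\<^sup>+z. indicator B a * ennreal (Jint d v e (e1 j) \<beta> (?Y a) z) \<partial>std_gauss d) \<partial>lborel)"
    unfolding Jint_def by (intro P.Fubini'[symmetric]) measurable
  also have "\<dots> = (\<integral>\<^sup>+a. ennreal (J d v e (e1 j) \<beta> c) * (indicator B a * ennreal (exp (- a * c j - a\<^sup>2 / 2))) \<partial>lborel)"
  proof (intro nn_integral_cong)
    fix a :: real
    define w where "w i = (if i = j then a else 0)" for i
    have Y: "?Y a = (\<lambda>i. c i + (\<Sum>k<d. w k * S i k))"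
      using j by (simp add: w_def if_distrib[of "\<lambda>x. x * _"] sum.delta cong: if_cong)
    have s1: "(\<Sum>i<d. w i * c i) = a * c j"
      using j by (simp add: w_def if_distrib[of "\<lambda>x. x * _"] sum.delta cong: if_cong)
    have s2: "(\<Sum>i<d. \<Sum>k<d. w i * w k * S i k) = a\<^sup>2"
      using j S_diag[OF j] by (simp add: w_def if_distrib[of "\<lambda>x. x * _"] if_distrib[of "\<lambda>x. _ * x"] sum.delta power2_eq_square cong: if_cong)
    have "(\<integral>\<^sup>+z. ennreal (Jint d v e (e1 j) \<beta> (?Y a) z) \<partial>std_gauss d)
      = ennreal (exp (- (a * c j) - a\<^sup>2 / 2) * J d v e (e1 j) \<beta> c)"
      unfolding Y by (rule nn_integral_Jint_shift[of "e1 j" w c, unfolded s1 s2]) (auto simp: w_def split: if_splits)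
    then show "(\<integral>\<^sup>+z. indicator B a * ennreal (Jint d v e (e1 j) \<beta> (?Y a) z) \<partial>std_gauss d)
      = ennreal (J d v e (e1 j) \<beta> c) * (indicator B a * ennreal (exp (- a * c j - a\<^sup>2 / 2)))"
      by (subst nn_integral_cmult) (auto simp: borel_measurable_std_gauss ennreal_mult J_nonneg mult_ac)
  qed
  also have "\<dots> = ennreal (J d v e (e1 j) \<beta> c) * (\<integral>\<^sup>+a. indicator B a * ennreal (exp (- a * c j - a\<^sup>2 / 2)) \<partial>lborel)"
    by (intro nn_integral_cmult) measurable
  finally show ?thesis
    using e_pos by (simp add: mult.assoc[symmetric] ennreal_mult[symmetric] D1_def J_nonneg)
qed

text \<open>The same computation with two multipliers. The factor 1 - S_jk^2 is the Jacobian of (a,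
  g) |-> (a + S_jk g, S_jk a + g), the excesses of y_j and y_k over their thresholds.\<close>

lemma X2_integral:
  assumes jk: "j < d" "k < d" "j \<noteq> k" and B [measurable]: "B \<in> sets (borel \<Otimes>\<^sub>M borel)" and r: "(S j k)\<^sup>2 < 1"
  shows "(\<integral>\<^sup>+z. \<integral>\<^sup>+n. X2 c B j k z n \<partial>std_gauss d \<partial>std_gauss d)
    = ennreal ((1 - (S j k)\<^sup>2) * D2 c j k) *
      (\<integral>\<^sup>+a. \<integral>\<^sup>+g. indicator B (a, g) * ennreal (exp (- a * c j - g * c k - (a\<^sup>2 + 2 * S j k * a * g + g\<^sup>2) / 2)) \<partial>lborel \<partial>lborel)"
proof -
  interpret G: prob_space "std_gauss d" by (rule prob_space_std_gauss)
  interpret N: prob_space std_normal_distribution by (rule prob_space_std_normal)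
  interpret P: pair_sigma_finite "std_gauss d" lborel ..
  let ?r = "S j k"
  let ?K = "ennreal ((1 - ?r\<^sup>2) / e\<^sup>2)"
  let ?I = "{..<d} - {j, k}"
  let ?Y = "\<lambda>a g i. c i + (a * S i j + g * S i k)"
  have r': "1 - ?r\<^sup>2 \<noteq> 0" using r by simp
  have J2: "Jint d v e (e2 j k) \<beta> (?Y a g) z
    = std_normal_density ((c j - \<beta> * dotd d z (v j) + a + ?r * g) / e) * (std_normal_density ((c k - \<beta> * dotd d z (v k) + ?r * a + g) / e)
      * (\<Prod>i\<in>?I. psi 0 ((?Y a g i - \<beta> * dotd d z (v i)) / e)))" for a g z
  proof -
    have I: "{..<d} - {j} - {k} = ?I" by auto
    have q: "(\<Prod>i\<in>?I. psi (e2 j k i) ((?Y a g i - \<beta> * dotd d z (v i)) / e)) = (\<Prod>i\<in>?I. psi 0 ((?Y a g i - \<beta> * dotd d z (v i)) / e))"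
      by (intro prod.cong) auto
    have s: "S j j = 1" "S k k = 1" "S k j = ?r" using jk S_diag S_commute by auto
    have a: "?Y a g j - \<beta> * dotd d z (v j) = c j - \<beta> * dotd d z (v j) + a + ?r * g"
      "?Y a g k - \<beta> * dotd d z (v k) = c k - \<beta> * dotd d z (v k) + ?r * a + g"
      unfolding s by (simp_all add: algebra_simps)
    have m: "e2 j k j = Suc 0" "e2 j k k = Suc 0" using jk by auto
    have p: "Jint d v e (e2 j k) \<beta> (?Y a g) z = psi (e2 j k j) ((?Y a g j - \<beta> * dotd d z (v j)) / e)
      * (psi (e2 j k k) ((?Y a g k - \<beta> * dotd d z (v k)) / e)
      * (\<Prod>i\<in>{..<d} - {j} - {k}. psi (e2 j k i) ((?Y a g i - \<beta> * dotd d z (v i)) / e)))"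
      unfolding Jint_def using jk by (subst prod.remove[of _ j], simp, simp, subst prod.remove[of _ k], auto)
    show ?thesis unfolding p I q m psi_1 a ..
  qed
  have "(\<integral>\<^sup>+n. X2 c B j k z n \<partial>std_gauss d)
    = ?K * (\<integral>\<^sup>+a. \<integral>\<^sup>+g. indicator B (a, g) * ennreal (Jint d v e (e2 j k) \<beta> (?Y a g) z) \<partial>lborel \<partial>lborel)" for z
  proof -
    let ?x = "\<lambda>y. \<beta> * dotd d z (v j) + e * y - c j"
    let ?x' = "\<lambda>y. \<beta> * dotd d z (v k) + e * y - c k"
    define al where "al y y' = (?x y - ?r * ?x' y') / (1 - ?r\<^sup>2)" for y y'
    define ga where "ga y y' = (?x' y' - ?r * ?x y) / (1 - ?r\<^sup>2)" for y y'
    have [measurable]: "case_prod al \<in> borel_measurable (borel \<Otimes>\<^sub>M borel)" "case_prod ga \<in> borel_measurable (borel \<Otimes>\<^sub>M borel)"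
      unfolding al_def ga_def by measurable
    define h where "h i y y' = (?Y (al y y') (ga y y') i - \<beta> * dotd d z (v i)) / e" for i y y'
    have hm [measurable]: "case_prod (h i) \<in> borel_measurable (borel \<Otimes>\<^sub>M borel)" for i
      unfolding h_def by measurable
    define F where "F y y' = ennreal (std_normal_density y) * (ennreal (std_normal_density y') * (indicator B (al y y', ga y y') * (\<Prod>i\<in>?I. ennreal (psi 0 (h i y y')))))" for y y'
    have Fm: "case_prod F \<in> borel_measurable (borel \<Otimes>\<^sub>M borel)" unfolding F_def by measurable
    have "(\<integral>\<^sup>+n. X2 c B j k z n \<partial>std_gauss d)
      = (\<integral>\<^sup>+y. \<integral>\<^sup>+y'. indicator B (al y y', ga y y') * (\<Prod>i\<in>?I. ennreal (psi 0 (h i y y'))) \<partial>std_normal_distribution \<partial>std_normal_distribution)"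
      using nn_integral_std_gauss_boxes2[OF jk, of "\<lambda>y y'. indicator B (al y y', ga y y')" h]
      unfolding X2_def exc_def Let_def h_def al_def ga_def by simp
    also have "\<dots> = (\<integral>\<^sup>+y. ennreal (std_normal_density y) * (\<integral>\<^sup>+y'. indicator B (al y y', ga y y') * (\<Prod>i\<in>?I. ennreal (psi 0 (h i y y'))) \<partial>std_normal_distribution) \<partial>lborel)"
      by (rule nn_integral_std_normal) measurable
    also have "\<dots> = (\<integral>\<^sup>+y. ennreal (std_normal_density y) * (\<integral>\<^sup>+y'. ennreal (std_normal_density y') * (indicator B (al y y', ga y y') * (\<Prod>i\<in>?I. ennreal (psi 0 (h i y y')))) \<partial>lborel) \<partial>lborel)"
      by (intro nn_integral_cong arg_cong2[where f = "(*)"] refl nn_integral_std_normal) measurable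
    also have "\<dots> = (\<integral>\<^sup>+y. \<integral>\<^sup>+y'. F y y' \<partial>lborel \<partial>lborel)"
      unfolding F_def by (intro nn_integral_cong nn_integral_cmult[symmetric]) measurable
    also have "\<dots> = ?K * (\<integral>\<^sup>+a. \<integral>\<^sup>+g. F ((c j - \<beta> * dotd d z (v j) + a + ?r * g) / e) ((c k - \<beta> * dotd d z (v k) + ?r * a + g) / e) \<partial>lborel \<partial>lborel)"
      by (rule nn_integral_linear_change2[OF Fm e_pos r])
    also have "\<dots> = ?K * (\<integral>\<^sup>+a. \<integral>\<^sup>+g. indicator B (a, g) * ennreal (Jint d v e (e2 j k) \<beta> (?Y a g) z) \<partial>lborel \<partial>lborel)"
    proof (intro arg_cong2[where f = "(*)"] refl nn_integral_cong)
      fix a g :: real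
      let ?y = "(c j - \<beta> * dotd d z (v j) + a + ?r * g) / e"
      let ?y' = "(c k - \<beta> * dotd d z (v k) + ?r * a + g) / e"
      have x: "?x ?y = a + ?r * g" "?x' ?y' = ?r * a + g" using e_pos by (simp_all add: field_simps)
      have 1: "al ?y ?y' = a"
      proof -
        have "?x ?y - ?r * ?x' ?y' = a * (1 - ?r\<^sup>2)" unfolding x by (simp add: algebra_simps power2_eq_square)
        then have "al ?y ?y' = a * (1 - ?r\<^sup>2) / (1 - ?r\<^sup>2)" unfolding al_def by (simp only:)
        then show ?thesis by (simp only: nonzero_mult_div_cancel_right[OF r'])
      qed
      have 2: "ga ?y ?y' = g"
      proof -
        have "?x' ?y' - ?r * ?x ?y = g * (1 - ?r\<^sup>2)" unfolding x by (simp add: algebra_simps power2_eq_square)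
        then have "ga ?y ?y' = g * (1 - ?r\<^sup>2) / (1 - ?r\<^sup>2)" unfolding ga_def by (simp only:)
        then show ?thesis by (simp only: nonzero_mult_div_cancel_right[OF r'])
      qed
      have 3: "(\<Prod>i\<in>?I. ennreal (psi 0 ((?Y a g i - \<beta> * dotd d z (v i)) / e))) = ennreal (\<Prod>i\<in>?I. psi 0 ((?Y a g i - \<beta> * dotd d z (v i)) / e))"
        by (rule prod_ennreal) (simp add: psi_0_nonneg)
      show "F ?y ?y' = indicator B (a, g) * ennreal (Jint d v e (e2 j k) \<beta> (?Y a g) z)"
        unfolding F_def h_def 1 2 3 J2
        by (subst ennreal_mult, simp, simp add: psi_0_nonneg prod_nonneg, subst ennreal_mult)
           (auto simp: psi_0_nonneg prod_nonneg mult_ac)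
    qed
    finally show ?thesis .
  qed
  then have "(\<integral>\<^sup>+z. \<integral>\<^sup>+n. X2 c B j k z n \<partial>std_gauss d \<partial>std_gauss d)
    = (\<integral>\<^sup>+z. ?K * (\<integral>\<^sup>+a. \<integral>\<^sup>+g. indicator B (a, g) * ennreal (Jint d v e (e2 j k) \<beta> (?Y a g) z) \<partial>lborel \<partial>lborel) \<partial>std_gauss d)"
    by simp
  also have "\<dots> = ?K * (\<integral>\<^sup>+z. (\<integral>\<^sup>+a. \<integral>\<^sup>+g. indicator B (a, g) * ennreal (Jint d v e (e2 j k) \<beta> (?Y a g) z) \<partial>lborel \<partial>lborel) \<partial>std_gauss d)"
    unfolding Jint_def by (intro nn_integral_cmult) measurable
  also have "(\<integral>\<^sup>+z. (\<integral>\<^sup>+a. \<integral>\<^sup>+g. indicator B (a, g) * ennreal (Jint d v e (e2 j k) \<beta> (?Y a g) z) \<partial>lborel \<partial>lborel) \<partial>std_gauss d)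
    = (\<integral>\<^sup>+a. (\<integral>\<^sup>+z. \<integral>\<^sup>+g. indicator B (a, g) * ennreal (Jint d v e (e2 j k) \<beta> (?Y a g) z) \<partial>lborel \<partial>std_gauss d) \<partial>lborel)"
    unfolding Jint_def by (intro P.Fubini'[symmetric]) measurable
  also have "\<dots> = (\<integral>\<^sup>+a. \<integral>\<^sup>+g. (\<integral>\<^sup>+z. indicator B (a, g) * ennreal (Jint d v e (e2 j k) \<beta> (?Y a g) z) \<partial>std_gauss d) \<partial>lborel \<partial>lborel)"
    unfolding Jint_def by (intro nn_integral_cong P.Fubini'[symmetric]) measurable
  also have "\<dots> = (\<integral>\<^sup>+a. \<integral>\<^sup>+g. ennreal (J d v e (e2 j k) \<beta> c) * (indicator B (a, g) * ennreal (exp (- a * c j - g * c k - (a\<^sup>2 + 2 * ?r * a * g + g\<^sup>2) / 2))) \<partial>lborel \<partial>lborel)"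
  proof (intro nn_integral_cong)
    fix a g :: real
    define w where "w i = (if i = j then a else 0) + (if i = k then g else 0)" for i
    have sw: "(\<Sum>i<d. w i * f i) = a * f j + g * f k" for f
      using jk by (simp add: w_def distrib_right sum.distrib if_distrib[of "\<lambda>x. x * _"] cong: if_cong)
    have s1: "- (\<Sum>i<d. w i * c i) = - a * c j - g * c k"
      unfolding sw by simp
    have Y: "?Y a g = (\<lambda>i. c i + (\<Sum>k<d. w k * S i k))"
      unfolding sw ..
    have s2: "(\<Sum>i<d. \<Sum>k<d. w i * w k * S i k) = a\<^sup>2 + 2 * ?r * a * g + g\<^sup>2"
    proof -
      have "(\<Sum>i<d. \<Sum>k<d. w i * w k * S i k) = (\<Sum>i<d. w i * (\<Sum>k<d. w k * S i k))"
        by (simp add: sum_distrib_left mult_ac)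
      also have "\<dots> = a\<^sup>2 + 2 * ?r * a * g + g\<^sup>2"
        unfolding sw using jk by (simp add: S_diag S_commute[of k j] power2_eq_square algebra_simps)
      finally show ?thesis .
    qed
    have "(\<integral>\<^sup>+z. ennreal (Jint d v e (e2 j k) \<beta> (?Y a g) z) \<partial>std_gauss d)
      = ennreal (exp (- a * c j - g * c k - (a\<^sup>2 + 2 * ?r * a * g + g\<^sup>2) / 2) * J d v e (e2 j k) \<beta> c)"
      unfolding Y by (rule nn_integral_Jint_shift[of "e2 j k" w c, unfolded s2 s1]) (use jk in \<open>auto simp: w_def split: if_splits\<close>)
    then show "(\<integral>\<^sup>+z. indicator B (a, g) * ennreal (Jint d v e (e2 j k) \<beta> (?Y a g) z) \<partial>std_gauss d)
      = ennreal (J d v e (e2 j k) \<beta> c) * (indicator B (a, g) * ennreal (exp (- a * c j - g * c k - (a\<^sup>2 + 2 * ?r * a * g + g\<^sup>2) / 2)))"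
      using jk by (subst nn_integral_cmult) (simp_all add: borel_measurable_std_gauss ennreal_mult J_nonneg mult_ac)
  qed
  also have "\<dots> = ennreal (J d v e (e2 j k) \<beta> c) * (\<integral>\<^sup>+a. \<integral>\<^sup>+g. indicator B (a, g) * ennreal (exp (- a * c j - g * c k - (a\<^sup>2 + 2 * ?r * a * g + g\<^sup>2) / 2)) \<partial>lborel \<partial>lborel)"
  proof -
    have "(\<integral>\<^sup>+a. \<integral>\<^sup>+g. ennreal (J d v e (e2 j k) \<beta> c) * (indicator B (a, g) * ennreal (exp (- a * c j - g * c k - (a\<^sup>2 + 2 * ?r * a * g + g\<^sup>2) / 2))) \<partial>lborel \<partial>lborel)
      = (\<integral>\<^sup>+a. ennreal (J d v e (e2 j k) \<beta> c) * (\<integral>\<^sup>+g. indicator B (a, g) * ennreal (exp (- a * c j - g * c k - (a\<^sup>2 + 2 * ?r * a * g + g\<^sup>2) / 2)) \<partial>lborel) \<partial>lborel)"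
      by (intro nn_integral_cong nn_integral_cmult) measurable
    then show ?thesis by (simp only:) (intro nn_integral_cmult, measurable)
  qed
  finally show ?thesis
    using e_pos r jk by (simp add: mult.assoc[symmetric] ennreal_mult[symmetric] D2_def J_nonneg)
qed

end

section \<open>Disjointness of the cones and bounds for their probabilities\<close>

lemma sum_le_one_ennreal:
  fixes f :: "'i \<Rightarrow> ennreal"
  assumes "\<And>i. i \<in> A \<Longrightarrow> f i \<le> 1"
    and "\<And>i j. i \<in> A \<Longrightarrow> j \<in> A \<Longrightarrow> f i \<noteq> 0 \<Longrightarrow> f j \<noteq> 0 \<Longrightarrow> i = j"
  shows "sum f A \<le> 1"
proof (cases "\<exists>i\<in>A. f i \<noteq> 0")
  case True
  then obtain i where i: "i \<in> A" "f i \<noteq> 0" by blast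
  show ?thesis
  proof (cases "finite A")
    case True
    have "sum f A = sum f {i}"
      by (rule sum.mono_neutral_right) (use True i assms(2) in auto)
    then show ?thesis using assms(1)[OF i(1)] by simp
  qed simp
qed simp

lemma nn_integral_interval_ge:
  fixes f :: "real \<Rightarrow> ennreal"
  assumes "a < b" "0 \<le> m" "\<And>x. x \<in> {a<..<b} \<Longrightarrow> ennreal m \<le> f x"
  shows "ennreal ((b - a) * m) \<le> (\<integral>\<^sup>+x. indicator {a<..<b} x * f x \<partial>lborel)"
proof -
  have "ennreal ((b - a) * m) = (\<integral>\<^sup>+x. ennreal m * indicator {a<..<b} x \<partial>lborel)"
    using assms(1,2) by (subst nn_integral_cmult_indicator) (auto simp: ennreal_mult mult.commute)
  also have "\<dots> \<le> (\<integral>\<^sup>+x. indicator {a<..<b} x * f x \<partial>lborel)"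
    by (intro nn_integral_mono) (use assms(3) in \<open>auto simp: indicator_def\<close>)
  finally show ?thesis .
qed

lemma ennreal_sum_mult:
  assumes "\<And>i. i \<in> A \<Longrightarrow> 0 \<le> f i" "0 \<le> K"
  shows "ennreal (sum f A * K) = (\<Sum>i\<in>A. ennreal (f i) * ennreal K)"
proof -
  have "(\<Sum>i\<in>A. ennreal (f i) * ennreal K) = (\<Sum>i\<in>A. ennreal (f i * K))"
    using assms by (intro sum.cong) (auto simp: ennreal_mult)
  then show ?thesis using assms by (simp add: sum_distrib_right)
qed

lemma dotd_nonneg: "0 \<le> dotd d u u"
  unfolding dotd_def by (intro sum_nonneg) auto

lemma dotd_unit_bound:
  assumes "dotd d u u = 1" "dotd d w w = 1"
  shows "\<bar>dotd d u w\<bar> \<le> 1"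
proof -
  have "dotd d (\<lambda>i. u i + w i) (\<lambda>i. u i + w i) = dotd d u u + 2 * dotd d u w + dotd d w w"
    "dotd d (\<lambda>i. u i - w i) (\<lambda>i. u i - w i) = dotd d u u - 2 * dotd d u w + dotd d w w"
    unfolding dotd_def by (simp_all add: sum.distrib sum_subtractf sum_distrib_left algebra_simps)
  then show ?thesis
    using dotd_nonneg[of d "\<lambda>i. u i + w i"] dotd_nonneg[of d "\<lambda>i. u i - w i"] assms by linarith
qed

context polytope
begin

text \<open>Strict even for antipodal normals: off the diagonal S is \<beta>^2 times an inner
  product of unit vectors, and the noise forces \<beta>^2 < 1.\<close>

lemma S_lt_1:
  assumes "j < d" "k < d" "j \<noteq> k"
  shows "(S j k)\<^sup>2 < 1"
proof -
  have "\<bar>S j k\<bar> \<le> \<beta>\<^sup>2 * 1"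
    using assms dotd_unit_bound[of d "v j" "v k"] unit unfolding S_def
    by (simp add: abs_mult) (intro mult_left_le, auto)
  also have "\<beta>\<^sup>2 < 1" using norm1 e_pos zero_less_power[OF e_pos, of 2] by linarith
  finally have "\<bar>S j k\<bar> < 1" by simp
  then show ?thesis by (simp add: abs_square_less_1)
qed

text \<open>w^T S w = |\<beta> V^T w|^2 + e^2 |w|^2; the noise makes S positive definite.\<close>

lemma S_form_nonneg: "e\<^sup>2 * (\<Sum>i<d. (w i)\<^sup>2) \<le> (\<Sum>i<d. w i * (\<Sum>k<d. w k * S i k))"
proof -
  have "(\<Sum>i<d. w i * (\<Sum>k<d. w k * S i k)) = (\<Sum>i<d. w i * (\<beta>\<^sup>2 * (\<Sum>k<d. w k * dotd d (v i) (v k)) + e\<^sup>2 * w i))"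
    by (intro sum.cong refl) (simp only: lessThan_iff sum_S)
  also have "\<dots> = dotd d (\<lambda>l. \<beta> * (\<Sum>k<d. w k * v k l)) (\<lambda>l. \<beta> * (\<Sum>k<d. w k * v k l)) + e\<^sup>2 * (\<Sum>i<d. (w i)\<^sup>2)"
    unfolding dotd_dir2
    by (simp add: sum_distrib_left sum.distrib distrib_left power2_eq_square mult_ac)
  finally show ?thesis using dotd_nonneg by simp
qed

text \<open>The outer normal cones of a polytope are disjoint: the multipliers of the projection
  of a point onto the polytope (in the metric given by \<open>S\<close>) are unique.\<close>

lemma multipliers_unique:
  assumes w: "\<And>i. i < d \<Longrightarrow> 0 \<le> w i" "\<And>i. i < d \<Longrightarrow> y i \<le> (\<Sum>k<d. w k * S i k)"
      "\<And>i. i < d \<Longrightarrow> w i \<noteq> 0 \<Longrightarrow> y i = (\<Sum>k<d. w k * S i k)"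
    and w': "\<And>i. i < d \<Longrightarrow> 0 \<le> w' i" "\<And>i. i < d \<Longrightarrow> y i \<le> (\<Sum>k<d. w' k * S i k)"
      "\<And>i. i < d \<Longrightarrow> w' i \<noteq> 0 \<Longrightarrow> y i = (\<Sum>k<d. w' k * S i k)"
    and i: "i < d"
  shows "w i = w' i"
proof -
  let ?u = "\<lambda>i. w i - w' i"
  let ?s = "\<lambda>w i. \<Sum>k<d. w k * S i k"
  have "e\<^sup>2 * (\<Sum>i<d. (?u i)\<^sup>2) \<le> (\<Sum>i<d. ?u i * ?s ?u i)"
    by (rule S_form_nonneg)
  also have "\<dots> \<le> 0"
  proof (rule sum_nonpos)
    fix i assume "i \<in> {..<d}"
    then have i: "i < d" by simp
    have su: "?s ?u i = ?s w i - ?s w' i"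
      by (simp add: left_diff_distrib sum_subtractf)
    \<comment> \<open>Complementary slackness: a multiplier times its own slack is 0, while a
      multiplier times the slack of the other family is nonpositive.\<close>
    have "?u i * ?s ?u i = w i * (y i - ?s w' i) - w i * (y i - ?s w i) - w' i * (y i - ?s w' i) + w' i * (y i - ?s w i)"
      unfolding su by (simp add: algebra_simps)
    moreover have "w i * (y i - ?s w i) = 0" "w' i * (y i - ?s w' i) = 0"
      using w(3)[OF i] w'(3)[OF i] by auto
    moreover have "w i * (y i - ?s w' i) \<le> 0" "w' i * (y i - ?s w i) \<le> 0"
      using w(1,2)[OF i] w'(1,2)[OF i] by (auto intro: mult_nonneg_nonpos)
    ultimately show "?u i * ?s ?u i \<le> 0" by linarith
  qed
  finally have "(\<Sum>i<d. (?u i)\<^sup>2) \<le> 0"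
    using e_pos by (simp add: mult_le_0_iff)
  moreover have "(?u i)\<^sup>2 \<le> (\<Sum>i<d. (?u i)\<^sup>2)"
    using i by (intro member_le_sum) auto
  ultimately have "(?u i)\<^sup>2 \<le> 0" by linarith
  then show ?thesis by simp
qed

lemma prod_indicator_le_1: "(\<Prod>i\<in>I. indicator (A i) (f i) :: ennreal) \<le> 1"
proof (induction I rule: infinite_finite_induct)
  case (insert i I)
  have "indicator (A i) (f i) * (\<Prod>i\<in>I. indicator (A i) (f i) :: ennreal) \<le> 1 * 1"
    by (intro mult_mono insert.IH) (auto simp: indicator_def)
  then show ?case using insert.hyps by simp
qed auto

lemma X1_le_1: "X1 c B j z n \<le> 1"
proof -
  have "X1 c B j z n \<le> 1 * 1"
    unfolding X1_def by (intro mult_mono prod_indicator_le_1) (auto simp: indicator_def)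
  then show ?thesis by simp
qed

lemma X2_le_1: "X2 c B j k z n \<le> 1"
proof -
  have "X2 c B j k z n \<le> 1 * 1"
    unfolding X2_def Let_def by (intro mult_mono prod_indicator_le_1) (auto simp: indicator_def)
  then show ?thesis by simp
qed

text \<open>A nonzero indicator yields the multipliers w = a e_j in the form that
  \<open>multipliers_unique\<close> expects: w >= 0 and y - c <= S w, with equality wherever w is
  nonzero.\<close>

lemma X1_witness:
  assumes j: "j < d" and X: "X1 c {0<..<\<rho>} j z n \<noteq> 0"
  defines "w \<equiv> \<lambda>i. if i = j then exc c j z n else 0"
  shows "0 < exc c j z n"
    and "\<And>i. i < d \<Longrightarrow> 0 \<le> w i" "\<And>i. i < d \<Longrightarrow> exc c i z n \<le> (\<Sum>k<d. w k * S i k)"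
    and "\<And>i. i < d \<Longrightarrow> w i \<noteq> 0 \<Longrightarrow> exc c i z n = (\<Sum>k<d. w k * S i k)"
proof -
  let ?a = "exc c j z n"
  have B: "0 < ?a" and le: "\<And>i. i < d \<Longrightarrow> i \<noteq> j \<Longrightarrow> n i \<le> (c i + ?a * S i j - \<beta> * dotd d z (v i)) / e"
    using X unfolding X1_def by (auto simp: indicator_def split: if_splits)
  have sw: "(\<Sum>k<d. w k * S i k) = ?a * S i j" for i
    using j by (simp add: w_def if_distrib[of "\<lambda>x. x * _"] cong: if_cong)
  show "0 < exc c j z n" "\<And>i. i < d \<Longrightarrow> 0 \<le> w i" using B by (auto simp: w_def)
  show eq: "exc c i z n = (\<Sum>k<d. w k * S i k)" if "i < d" "w i \<noteq> 0" for i
    using that unfolding sw by (auto simp: w_def S_diag split: if_splits)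
  show "exc c i z n \<le> (\<Sum>k<d. w k * S i k)" if i: "i < d" for i
  proof (cases "i = j")
    case True then show ?thesis using S_diag[OF j] unfolding sw by simp
  next
    case False
    from le[OF i False] show ?thesis unfolding sw exc_def using e_pos by (simp add: field_simps)
  qed
qed

lemma X2_witness:
  assumes jk: "j < d" "k < d" "j \<noteq> k" and X: "X2 c ({0<..<\<rho>} \<times> {0<..<\<rho>}) j k z n \<noteq> 0"
  obtains a g w where "0 < a" "0 < g" "w = (\<lambda>i. (if i = j then a else 0) + (if i = k then g else 0))"
    and "\<And>i. i < d \<Longrightarrow> 0 \<le> w i" "\<And>i. i < d \<Longrightarrow> exc c i z n \<le> (\<Sum>k<d. w k * S i k)"
    and "\<And>i. i < d \<Longrightarrow> w i \<noteq> 0 \<Longrightarrow> exc c i z n = (\<Sum>k<d. w k * S i k)"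
proof -
  let ?r = "S j k"
  define a where "a = (exc c j z n - ?r * exc c k z n) / (1 - ?r\<^sup>2)"
  define g where "g = (exc c k z n - ?r * exc c j z n) / (1 - ?r\<^sup>2)"
  define w where "w = (\<lambda>i. (if i = j then a else 0) + (if i = k then g else 0))"
  have r: "1 - ?r\<^sup>2 \<noteq> 0" using S_lt_1[OF jk] by simp
  have B: "0 < a" "0 < g" and le: "\<And>i. i < d \<Longrightarrow> i \<noteq> j \<Longrightarrow> i \<noteq> k \<Longrightarrow> n i \<le> (c i + (a * S i j + g * S i k) - \<beta> * dotd d z (v i)) / e"
    using X unfolding X2_def Let_def a_def[symmetric] g_def[symmetric] by (auto simp: indicator_def split: if_splits)
  have sw: "(\<Sum>k<d. w k * S i k) = a * S i j + g * S i k" for i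
    using jk by (simp add: w_def distrib_right sum.distrib if_distrib[of "\<lambda>x. x * _"] cong: if_cong)
  \<comment> \<open>The definitions of a and g solve the 2 x 2 system with rows (1, r) and (r, 1),
    whose determinant is 1 - r^2.\<close>
  have ag: "a + ?r * g = exc c j z n" "?r * a + g = exc c k z n"
  proof -
    have "a * (1 - ?r\<^sup>2) = exc c j z n - ?r * exc c k z n" "g * (1 - ?r\<^sup>2) = exc c k z n - ?r * exc c j z n"
      unfolding a_def g_def using r by simp_all
    moreover have "(a + ?r * g) * (1 - ?r\<^sup>2) = a * (1 - ?r\<^sup>2) + ?r * (g * (1 - ?r\<^sup>2))"
      "(?r * a + g) * (1 - ?r\<^sup>2) = ?r * (a * (1 - ?r\<^sup>2)) + g * (1 - ?r\<^sup>2)"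
      by (simp_all add: algebra_simps)
    ultimately have "(a + ?r * g) * (1 - ?r\<^sup>2) = exc c j z n * (1 - ?r\<^sup>2)" "(?r * a + g) * (1 - ?r\<^sup>2) = exc c k z n * (1 - ?r\<^sup>2)"
      by (simp_all only:) (simp_all add: algebra_simps power2_eq_square)
    then show "a + ?r * g = exc c j z n" "?r * a + g = exc c k z n" using r by simp_all
  qed
  have s: "S j j = 1" "S k k = 1" "S k j = ?r" using jk S_diag S_commute by auto
  have eqj: "exc c j z n = (\<Sum>k<d. w k * S j k)" and eqk: "exc c k z n = (\<Sum>l<d. w l * S k l)"
    unfolding sw s ag[symmetric] by (simp_all add: mult.commute)
  show ?thesis
  proof (rule that[OF B w_def])
    show "0 \<le> w i" for i using B by (auto simp: w_def)
    show "exc c i z n = (\<Sum>k<d. w k * S i k)" if "w i \<noteq> 0" for i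
      using that eqj eqk by (auto simp: w_def split: if_splits)
    show "exc c i z n \<le> (\<Sum>k<d. w k * S i k)" if i: "i < d" for i
    proof (cases "i = j \<or> i = k")
      case True then show ?thesis using eqj eqk by auto
    next
      case False
      then have "n i \<le> (c i + (a * S i j + g * S i k) - \<beta> * dotd d z (v i)) / e" using le i by blast
      then show ?thesis unfolding sw exc_def using e_pos by (simp add: field_simps)
    qed
  qed
qed

lemma snd_coord_measurable: "i < d \<Longrightarrow> (\<lambda>x. snd x i) \<in> borel_measurable (std_gauss d \<Otimes>\<^sub>M std_gauss d)"
  by (rule measurable_compose[OF measurable_snd, of "\<lambda>n. n i"]) (simp add: borel_measurable_std_gauss coord_measurable)

lemma exc_measurable: "i < d \<Longrightarrow> (\<lambda>(z, n). exc c i z n) \<in> borel_measurable (std_gauss d \<Otimes>\<^sub>M std_gauss d)"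
proof -
  assume i: "i < d"
  have [measurable]: "(\<lambda>x. snd x i) \<in> borel_measurable (std_gauss d \<Otimes>\<^sub>M std_gauss d)"
    using i by (rule snd_coord_measurable)
  show ?thesis unfolding exc_def case_prod_beta by measurable
qed

lemma X1_measurable:
  assumes j: "j < d" and B: "B \<in> sets borel"
  shows "(\<lambda>(z, n). X1 c B j z n) \<in> borel_measurable (std_gauss d \<Otimes>\<^sub>M std_gauss d)"
proof -
  note [measurable] = B
  have [measurable]: "(\<lambda>x. exc c j (fst x) (snd x)) \<in> borel_measurable (std_gauss d \<Otimes>\<^sub>M std_gauss d)"
    using exc_measurable[OF j] by (simp add: case_prod_beta)
  have c: "(\<lambda>x. snd x i) \<in> borel_measurable (std_gauss d \<Otimes>\<^sub>M std_gauss d)" if "i < d" for i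
    using that by (rule snd_coord_measurable)
  have 1: "(\<lambda>x. indicator B (exc c j (fst x) (snd x)) :: ennreal) \<in> borel_measurable (std_gauss d \<Otimes>\<^sub>M std_gauss d)"
    by measurable
  have 2: "(\<lambda>x. (c i + exc c j (fst x) (snd x) * S i j - \<beta> * dotd d (fst x) (v i)) / e) \<in> borel_measurable (std_gauss d \<Otimes>\<^sub>M std_gauss d)" for i
    by measurable
  show ?thesis unfolding X1_def case_prod_beta
    by (intro borel_measurable_times_ennreal borel_measurable_prod_ennreal indicator_atMost_measurable c 1 2) auto
qed

lemma X2_measurable:
  assumes jk: "j < d" "k < d" and B: "B \<in> sets (borel \<Otimes>\<^sub>M borel)"
  shows "(\<lambda>(z, n). X2 c B j k z n) \<in> borel_measurable (std_gauss d \<Otimes>\<^sub>M std_gauss d)"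
proof -
  note [measurable] = B
  have [measurable]: "(\<lambda>x. exc c j (fst x) (snd x)) \<in> borel_measurable (std_gauss d \<Otimes>\<^sub>M std_gauss d)"
    "(\<lambda>x. exc c k (fst x) (snd x)) \<in> borel_measurable (std_gauss d \<Otimes>\<^sub>M std_gauss d)"
    using exc_measurable[OF jk(1)] exc_measurable[OF jk(2)] by (simp_all add: case_prod_beta)
  have c: "(\<lambda>x. snd x i) \<in> borel_measurable (std_gauss d \<Otimes>\<^sub>M std_gauss d)" if "i < d" for i
    using that by (rule snd_coord_measurable)
  define a where "a x = (exc c j (fst x) (snd x) - S j k * exc c k (fst x) (snd x)) / (1 - (S j k)\<^sup>2)" for x
  define g where "g x = (exc c k (fst x) (snd x) - S j k * exc c j (fst x) (snd x)) / (1 - (S j k)\<^sup>2)" for x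
  have [measurable]: "a \<in> borel_measurable (std_gauss d \<Otimes>\<^sub>M std_gauss d)" "g \<in> borel_measurable (std_gauss d \<Otimes>\<^sub>M std_gauss d)"
    unfolding a_def g_def by measurable
  have 1: "(\<lambda>x. indicator B (a x, g x) :: ennreal) \<in> borel_measurable (std_gauss d \<Otimes>\<^sub>M std_gauss d)"
    by measurable
  have 2: "(\<lambda>x. (c i + (a x * S i j + g x * S i k) - \<beta> * dotd d (fst x) (v i)) / e) \<in> borel_measurable (std_gauss d \<Otimes>\<^sub>M std_gauss d)" for i
    by measurable
  show ?thesis unfolding X2_def case_prod_beta Let_def a_def[symmetric] g_def[symmetric]
    by (intro borel_measurable_times_ennreal borel_measurable_prod_ennreal indicator_atMost_measurable c 1 2) auto
qed

lemma sum_nn_integral_le_1: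
  assumes "finite A" "\<And>p. p \<in> A \<Longrightarrow> (\<lambda>(z, n). X p z n) \<in> borel_measurable (std_gauss d \<Otimes>\<^sub>M std_gauss d)"
    and "\<And>z n. (\<Sum>p\<in>A. X p z n) \<le> (1 :: ennreal)"
  shows "(\<Sum>p\<in>A. \<integral>\<^sup>+z. \<integral>\<^sup>+n. X p z n \<partial>std_gauss d \<partial>std_gauss d) \<le> 1"
proof -
  interpret G: prob_space "std_gauss d" by (rule prob_space_std_gauss)
  have "(\<Sum>p\<in>A. \<integral>\<^sup>+z. \<integral>\<^sup>+n. X p z n \<partial>std_gauss d \<partial>std_gauss d)
    = (\<integral>\<^sup>+z. (\<Sum>p\<in>A. \<integral>\<^sup>+n. X p z n \<partial>std_gauss d) \<partial>std_gauss d)"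
    by (intro nn_integral_sum[symmetric] G.borel_measurable_nn_integral assms(2))
  also have "\<dots> = (\<integral>\<^sup>+z. \<integral>\<^sup>+n. (\<Sum>p\<in>A. X p z n) \<partial>std_gauss d \<partial>std_gauss d)"
  proof (intro nn_integral_cong nn_integral_sum[symmetric])
    fix z p assume z: "z \<in> space (std_gauss d)" and p: "p \<in> A"
    show "X p z \<in> borel_measurable (std_gauss d)"
      using measurable_compose[OF measurable_Pair1'[OF z] assms(2)[OF p]] by simp
  qed
  also have "\<dots> \<le> (\<integral>\<^sup>+z. \<integral>\<^sup>+n. 1 \<partial>std_gauss d \<partial>std_gauss d)"
    by (intro nn_integral_mono assms(3))
  also have "\<dots> = 1" by (simp add: G.emeasure_space_1)
  finally show ?thesis .
qed

text \<open>The weight exp (- a c_j - a^2 / 2) = exp (c_j^2 / 2 - (a + c_j)^2 / 2) peaks at a = -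
  c_j. A window of length 1 there has mass at least exp (c_j^2 / 2 - 1 / 2), and \<open>D1\<close>
  times this mass is at most the probability of a single event. The window may consist of negative
  a, so the event is in general no part of a normal cone.\<close>

lemma D1_tail:
  assumes j: "j < d"
  shows "D1 c j \<le> exp (1 / 2 - (c j)\<^sup>2 / 2)"
proof -
  let ?B = "{- c j<..<- c j + 1}"
  let ?m = "exp ((c j)\<^sup>2 / 2 - 1 / 2)"
  have "ennreal ((- c j + 1 - (- c j)) * ?m) \<le> (\<integral>\<^sup>+a. indicator ?B a * ennreal (exp (- a * c j - a\<^sup>2 / 2)) \<partial>lborel)"
  proof (rule nn_integral_interval_ge)
    fix a assume "a \<in> ?B"
    then have "0 \<le> a + c j" "a + c j \<le> 1" by auto
    then have "(a + c j)\<^sup>2 \<le> 1" by (simp add: power_le_one)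
    then have "(c j)\<^sup>2 / 2 - 1 / 2 \<le> - a * c j - a\<^sup>2 / 2" by (simp add: power2_sum algebra_simps)
    then show "ennreal ?m \<le> ennreal (exp (- a * c j - a\<^sup>2 / 2))" by simp
  qed simp_all
  then have "ennreal (D1 c j) * ennreal ?m \<le> ennreal (D1 c j) * (\<integral>\<^sup>+a. indicator ?B a * ennreal (exp (- a * c j - a\<^sup>2 / 2)) \<partial>lborel)"
    by (intro mult_left_mono) simp_all
  also have "\<dots> = (\<Sum>i\<in>{j}. \<integral>\<^sup>+z. \<integral>\<^sup>+n. X1 c ?B i z n \<partial>std_gauss d \<partial>std_gauss d)"
    using X1_integral[OF j, of ?B c] by simp
  also have "\<dots> \<le> 1"
    by (rule sum_nn_integral_le_1) (use j in \<open>auto intro!: X1_measurable X1_le_1\<close>)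
  finally have "D1 c j * ?m \<le> 1" by (simp add: ennreal_mult[symmetric] D1_nonneg)
  then have "D1 c j \<le> 1 / ?m" by (simp add: field_simps)
  moreover have "exp (1 / 2 - (c j)\<^sup>2 / 2) = 1 / ?m"
    using exp_minus[of "(c j)\<^sup>2 / 2 - 1 / 2"] by (simp add: inverse_eq_divide)
  ultimately show ?thesis by simp
qed

text \<open>With t = a + c_j + r g the exponent equals c_j^2 / 2 - t^2 / 2 + g (r c_j - c_k) - (1 -
  r^2) g^2 / 2. The window takes t in (0, 1) and g in a unit interval next to 0. The tail in c_k
  follows by exchanging j and k.\<close>

lemma D2_tail:
  assumes jk: "j < d" "k < d" "j \<noteq> k"
  shows "(1 - (S j k)\<^sup>2) * D2 c j k \<le> exp (1 - (c j)\<^sup>2 / 2)"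
proof -
  let ?r = "S j k"
  let ?m = "exp ((c j)\<^sup>2 / 2 - 1)"
  \<comment> \<open>The interval (p, p + 1) lies on the side of 0 on which g (r c_j - c_k) is
    nonnegative.\<close>
  define p where "p = (if ?r * c j - c k \<ge> 0 then 0 else -1 :: real)"
  define B where "B = {(a, g). p < g \<and> g < p + 1 \<and> - c j - ?r * g < a \<and> a < - c j - ?r * g + 1}"
  have "B = {x \<in> space (borel \<Otimes>\<^sub>M borel). p < snd x \<and> snd x < p + 1 \<and> - c j - ?r * snd x < fst x \<and> fst x < - c j - ?r * snd x + 1}"
    by (auto simp: B_def space_pair_measure)
  then have Bm [measurable]: "B \<in> sets (borel \<Otimes>\<^sub>M borel)" by simp
  let ?E = "\<lambda>a g. exp (- a * c j - g * c k - (a\<^sup>2 + 2 * ?r * a * g + g\<^sup>2) / 2)"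
  have r: "?r\<^sup>2 < 1" by (rule S_lt_1[OF jk])
  have lower: "?m \<le> ?E a g" if "(a, g) \<in> B" for a g
  proof -
    define t where "t = a + c j + ?r * g"
    have t: "0 \<le> t" "t \<le> 1" and g: "g\<^sup>2 \<le> 1" and s: "0 \<le> g * (?r * c j - c k)"
      using that by (auto simp: t_def B_def p_def abs_square_le_1 zero_le_mult_iff split: if_splits)
    have "t\<^sup>2 \<le> 1" using t by (simp add: power_le_one)
    moreover have "- a * c j - g * c k - (a\<^sup>2 + 2 * ?r * a * g + g\<^sup>2) / 2
      = (c j)\<^sup>2 / 2 - t\<^sup>2 / 2 + g * (?r * c j - c k) - (1 - ?r\<^sup>2) * g\<^sup>2 / 2"
      unfolding t_def by (simp add: power2_eq_square algebra_simps add_divide_distrib diff_divide_distrib)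
    moreover have "(1 - ?r\<^sup>2) * g\<^sup>2 \<le> 1 * 1"
      using g r by (intro mult_mono) auto
    ultimately have "(c j)\<^sup>2 / 2 - 1 \<le> - a * c j - g * c k - (a\<^sup>2 + 2 * ?r * a * g + g\<^sup>2) / 2"
      using s by linarith
    then show ?thesis by simp
  qed
  have "ennreal ?m = ennreal ((p + 1 - p) * ?m)" by simp
  also have "\<dots> \<le> (\<integral>\<^sup>+g. indicator {p<..<p + 1} g * (\<integral>\<^sup>+a. indicator B (a, g) * ennreal (?E a g) \<partial>lborel) \<partial>lborel)"
  proof (rule nn_integral_interval_ge)
    fix g assume g: "g \<in> {p<..<p + 1}"
    let ?l = "- c j - ?r * g"
    have "ennreal ?m = ennreal ((?l + 1 - ?l) * ?m)" by simp
    also have "\<dots> \<le> (\<integral>\<^sup>+a. indicator {?l<..<?l + 1} a * ennreal (?E a g) \<partial>lborel)"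
    proof (rule nn_integral_interval_ge)
      fix a assume "a \<in> {?l<..<?l + 1}"
      with g have "(a, g) \<in> B" by (auto simp: B_def)
      then show "ennreal ?m \<le> ennreal (?E a g)" by (intro ennreal_leI lower)
    qed auto
    also have "\<dots> = (\<integral>\<^sup>+a. indicator B (a, g) * ennreal (?E a g) \<partial>lborel)"
      by (intro nn_integral_cong) (use g in \<open>auto simp: indicator_def B_def\<close>)
    finally show "ennreal ?m \<le> (\<integral>\<^sup>+a. indicator B (a, g) * ennreal (?E a g) \<partial>lborel)" .
  qed simp_all
  also have "\<dots> \<le> (\<integral>\<^sup>+g. (\<integral>\<^sup>+a. indicator B (a, g) * ennreal (?E a g) \<partial>lborel) \<partial>lborel)"
    by (intro nn_integral_mono) (auto simp: indicator_def)
  also have "\<dots> = (\<integral>\<^sup>+a. \<integral>\<^sup>+g. indicator B (a, g) * ennreal (?E a g) \<partial>lborel \<partial>lborel)"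
    by (rule lborel_pair.Fubini') measurable
  finally have "ennreal ((1 - ?r\<^sup>2) * D2 c j k) * ennreal ?m
    \<le> ennreal ((1 - ?r\<^sup>2) * D2 c j k) * (\<integral>\<^sup>+a. \<integral>\<^sup>+g. indicator B (a, g) * ennreal (?E a g) \<partial>lborel \<partial>lborel)"
    by (intro mult_left_mono) simp_all
  also have "\<dots> = (\<Sum>i\<in>{j}. \<integral>\<^sup>+z. \<integral>\<^sup>+n. X2 c B i k z n \<partial>std_gauss d \<partial>std_gauss d)"
    using X2_integral[OF jk Bm r, of c] by simp
  also have "\<dots> \<le> 1"
    by (rule sum_nn_integral_le_1) (use jk in \<open>auto intro!: X2_measurable X2_le_1\<close>)
  finally have "(1 - ?r\<^sup>2) * D2 c j k * ?m \<le> 1"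
    using r jk by (simp add: ennreal_mult[symmetric] D2_nonneg)
  then have "(1 - ?r\<^sup>2) * D2 c j k \<le> 1 / ?m" by (simp add: field_simps)
  moreover have "exp (1 - (c j)\<^sup>2 / 2) = 1 / ?m"
    using exp_minus[of "(c j)\<^sup>2 / 2 - 1"] by (simp add: inverse_eq_divide)
  ultimately show ?thesis by simp
qed

text \<open>For 0 < a < 1 / L both a c_j and a^2 are at most 1, so the weight is at least exp (- 3 /
  2); negative c_j only increase it. The truncated cones are disjoint, so the masses D1 exp (- 3 /
  2) / L add up to at most 1.\<close>

lemma sum_D1_le:
  assumes L: "1 \<le> L"
  shows "(\<Sum>j | j < d \<and> c j \<le> L. D1 c j) \<le> L * exp (3 / 2)"
proof -
  let ?A = "{j. j < d \<and> c j \<le> L}"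
  let ?B = "{0<..<1 / L}"
  have fin: "finite ?A" by simp
  have "ennreal ((\<Sum>j\<in>?A. D1 c j) * (1 / L * exp (- 3 / 2))) = (\<Sum>j\<in>?A. ennreal (D1 c j) * ennreal (1 / L * exp (- 3 / 2)))"
    using L by (intro ennreal_sum_mult D1_nonneg) auto
  also have "\<dots> = (\<Sum>j\<in>?A. ennreal (D1 c j) * ennreal ((1 / L - 0) * exp (- 3 / 2)))"
    by simp
  also have "\<dots> \<le> (\<Sum>j\<in>?A. \<integral>\<^sup>+z. \<integral>\<^sup>+n. X1 c ?B j z n \<partial>std_gauss d \<partial>std_gauss d)"
  proof (rule sum_mono)
    fix j assume j: "j \<in> ?A"
    then have X: "(\<integral>\<^sup>+z. \<integral>\<^sup>+n. X1 c ?B j z n \<partial>std_gauss d \<partial>std_gauss d)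
      = ennreal (D1 c j) * (\<integral>\<^sup>+a. indicator ?B a * ennreal (exp (- a * c j - a\<^sup>2 / 2)) \<partial>lborel)"
      by (intro X1_integral) auto
    have "ennreal ((1 / L - 0) * exp (- 3 / 2)) \<le> (\<integral>\<^sup>+a. indicator ?B a * ennreal (exp (- a * c j - a\<^sup>2 / 2)) \<partial>lborel)"
    proof (rule nn_integral_interval_ge)
      fix a assume a: "a \<in> ?B"
      then have aL: "0 < a" "a * L < 1" using L by (auto simp: field_simps)
      have "a * c j \<le> a * L" "a * 1 \<le> a * L" using j aL L by (auto intro!: mult_left_mono simp del: mult_1_right)
      then have "a * c j \<le> 1" "a \<le> 1" using aL by linarith+
      moreover note this(1)
      moreover have "a\<^sup>2 \<le> 1" using aL \<open>a \<le> 1\<close> by (simp add: power_le_one)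
      ultimately show "ennreal (exp (- 3 / 2)) \<le> ennreal (exp (- a * c j - a\<^sup>2 / 2))" by simp
    qed (use L in simp_all)
    then show "ennreal (D1 c j) * ennreal ((1 / L - 0) * exp (- 3 / 2)) \<le> (\<integral>\<^sup>+z. \<integral>\<^sup>+n. X1 c ?B j z n \<partial>std_gauss d \<partial>std_gauss d)"
      unfolding X by (intro mult_left_mono) simp_all
  qed
  also have "\<dots> \<le> 1"
  proof (rule sum_nn_integral_le_1[OF fin])
    show "(\<lambda>(z, n). X1 c ?B j z n) \<in> borel_measurable (std_gauss d \<Otimes>\<^sub>M std_gauss d)" if "j \<in> ?A" for j
      using that by (intro X1_measurable) auto
    show "(\<Sum>j\<in>?A. X1 c ?B j z n) \<le> 1" for z n
    proof (rule sum_le_one_ennreal)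
      fix i j assume i: "i \<in> ?A" and j: "j \<in> ?A" and X: "X1 c ?B i z n \<noteq> 0" "X1 c ?B j z n \<noteq> 0"
      have d: "i < d" "j < d" using i j by auto
      note Wi = X1_witness[OF d(1) X(1)] and Wj = X1_witness[OF d(2) X(2)]
      have "(if i = i then exc c i z n else 0) = (if i = j then exc c j z n else 0)"
        by (rule multipliers_unique[where w = "\<lambda>l. if l = i then exc c i z n else 0" and w' = "\<lambda>l. if l = j then exc c j z n else 0"
              and y = "\<lambda>i. exc c i z n", OF Wi(2-4) Wj(2-4) d(1)])
      then show "i = j" using Wi(1) by (simp split: if_splits)
    qed (rule X1_le_1)
  qed
  finally have "(\<Sum>j\<in>?A. D1 c j) * (1 / L * exp (- 3 / 2)) \<le> 1" by simp
  then show ?thesis using L by (simp add: field_simps exp_minus)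
qed

text \<open>On the square of side 1 / L each of a c_j, g c_k, a^2, g^2 and S_jk a g is at most 1, so
  the exponent is at least - 1 - 1 - (1 + 2 + 1) / 2 = - 4. Only pairs with j < k are summed, since
  (k, j) names the same cone.\<close>

lemma sum_D2_le:
  assumes L: "1 \<le> L"
  shows "(\<Sum>(j, k) | j < k \<and> k < d \<and> c j \<le> L \<and> c k \<le> L. (1 - (S j k)\<^sup>2) * D2 c j k) \<le> L\<^sup>2 * exp 4"
proof -
  let ?A = "{(j, k). j < k \<and> k < d \<and> c j \<le> L \<and> c k \<le> L}"
  let ?I = "{0<..<1 / L}"
  let ?B = "?I \<times> ?I"
  let ?D = "\<lambda>p. (1 - (S (fst p) (snd p))\<^sup>2) * D2 c (fst p) (snd p)"
  let ?X = "\<lambda>p. X2 c ?B (fst p) (snd p)"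
  have fin: "finite ?A" by (rule finite_subset[of _ "{..<d} \<times> {..<d}"]) auto
  have Bm: "?B \<in> sets (borel \<Otimes>\<^sub>M borel)" by simp
  have A: "fst p < d" "snd p < d" "fst p \<noteq> snd p" if "p \<in> ?A" for p using that by auto
  have D0: "0 \<le> ?D p" if "p \<in> ?A" for p
    using S_lt_1[OF A[OF that]] A[OF that] by (intro mult_nonneg_nonneg D2_nonneg) auto
  have "ennreal ((\<Sum>p\<in>?A. ?D p) * ((1 / L)\<^sup>2 * exp (- 4))) = (\<Sum>p\<in>?A. ennreal (?D p) * ennreal ((1 / L)\<^sup>2 * exp (- 4)))"
    using D0 by (intro ennreal_sum_mult) auto
  also have "\<dots> \<le> (\<Sum>p\<in>?A. \<integral>\<^sup>+z. \<integral>\<^sup>+n. ?X p z n \<partial>std_gauss d \<partial>std_gauss d)"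
  proof (rule sum_mono)
    fix p assume p: "p \<in> ?A"
    obtain j k where pjk: "p = (j, k)" by (cases p)
    note jk = A[OF p, unfolded pjk fst_conv snd_conv]
    let ?r = "S j k"
    let ?E = "\<lambda>a g. exp (- a * c j - g * c k - (a\<^sup>2 + 2 * ?r * a * g + g\<^sup>2) / 2)"
    have X: "(\<integral>\<^sup>+z. \<integral>\<^sup>+n. ?X p z n \<partial>std_gauss d \<partial>std_gauss d)
      = ennreal (?D p) * (\<integral>\<^sup>+a. \<integral>\<^sup>+g. indicator ?B (a, g) * ennreal (?E a g) \<partial>lborel \<partial>lborel)"
      unfolding pjk fst_conv snd_conv by (rule X2_integral[OF jk Bm S_lt_1[OF jk]])
    have lower: "exp (- 4) \<le> ?E a g" if a: "a \<in> ?I" and g: "g \<in> ?I" for a g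
    proof -
      have aL: "0 < a" "a * L < 1" "0 < g" "g * L < 1" using a g L by (auto simp: field_simps)
      have "a * c j \<le> a * L" "g * c k \<le> g * L"
        using p pjk aL by (auto intro!: mult_left_mono)
      then have "a * c j \<le> 1" "g * c k \<le> 1" using aL by linarith+
      moreover have "a * 1 \<le> a * L" "g * 1 \<le> g * L" using aL L by (auto intro!: mult_left_mono simp del: mult_1_right)
      then have ag: "a \<le> 1" "g \<le> 1" using aL by linarith+
      then have "a\<^sup>2 \<le> 1" "g\<^sup>2 \<le> 1" using aL by (simp_all add: power_le_one)
      moreover have "?r * (a * g) \<le> 1 * 1"
      proof (rule mult_mono)
        show "?r \<le> 1" using S_lt_1[OF jk] abs_square_less_1[of ?r] by auto
        show "a * g \<le> 1" using ag aL mult_mono[of a 1 g 1] by simp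
      qed (use aL in auto)
      moreover have "- 4 \<le> - x - y - (p + 2 * q + r) / 2" if "x \<le> 1" "y \<le> 1" "p \<le> 1" "r \<le> 1" "q \<le> 1" for x y p q r :: real
        using that by (simp add: field_simps)
      ultimately have "- 4 \<le> - (a * c j) - g * c k - (a\<^sup>2 + 2 * (?r * (a * g)) + g\<^sup>2) / 2" by simp
      then show ?thesis by (simp add: mult.assoc)
    qed
    have "ennreal ((1 / L)\<^sup>2 * exp (- 4)) = ennreal ((1 / L - 0) * ((1 / L - 0) * exp (- 4)))" by (simp add: power2_eq_square)
    also have "\<dots> \<le> (\<integral>\<^sup>+a. indicator ?I a * (\<integral>\<^sup>+g. indicator ?I g * ennreal (?E a g) \<partial>lborel) \<partial>lborel)"
      by (intro nn_integral_interval_ge ennreal_leI lower) (use L in auto)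
    also have "\<dots> = (\<integral>\<^sup>+a. \<integral>\<^sup>+g. indicator ?B (a, g) * ennreal (?E a g) \<partial>lborel \<partial>lborel)"
      by (intro nn_integral_cong, subst nn_integral_cmult[symmetric]) (auto intro!: nn_integral_cong simp: indicator_def)
    finally show "ennreal (?D p) * ennreal ((1 / L)\<^sup>2 * exp (- 4)) \<le> (\<integral>\<^sup>+z. \<integral>\<^sup>+n. ?X p z n \<partial>std_gauss d \<partial>std_gauss d)"
      unfolding X by (intro mult_left_mono) simp_all
  qed
  also have "\<dots> \<le> 1"
  proof (rule sum_nn_integral_le_1[OF fin])
    show "(\<lambda>(z, n). ?X p z n) \<in> borel_measurable (std_gauss d \<Otimes>\<^sub>M std_gauss d)" if "p \<in> ?A" for p
      by (rule X2_measurable[OF A(1,2)[OF that] Bm])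
    show "(\<Sum>p\<in>?A. ?X p z n) \<le> 1" for z n
    proof (rule sum_le_one_ennreal)
      fix p q assume pq: "p \<in> ?A" "q \<in> ?A" and X: "?X p z n \<noteq> 0" "?X q z n \<noteq> 0"
      obtain a g w where w: "0 < a" "0 < g" "w = (\<lambda>i. (if i = fst p then a else 0) + (if i = snd p then g else 0))"
        "\<And>i. i < d \<Longrightarrow> 0 \<le> w i" "\<And>i. i < d \<Longrightarrow> exc c i z n \<le> (\<Sum>k<d. w k * S i k)"
        "\<And>i. i < d \<Longrightarrow> w i \<noteq> 0 \<Longrightarrow> exc c i z n = (\<Sum>k<d. w k * S i k)"
        using X2_witness[OF A[OF pq(1)] X(1)] by blast
      obtain a' g' w' where w': "0 < a'" "0 < g'" "w' = (\<lambda>i. (if i = fst q then a' else 0) + (if i = snd q then g' else 0))"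
        "\<And>i. i < d \<Longrightarrow> 0 \<le> w' i" "\<And>i. i < d \<Longrightarrow> exc c i z n \<le> (\<Sum>k<d. w' k * S i k)"
        "\<And>i. i < d \<Longrightarrow> w' i \<noteq> 0 \<Longrightarrow> exc c i z n = (\<Sum>k<d. w' k * S i k)"
        using X2_witness[OF A[OF pq(2)] X(2)] by blast
      have eq: "w i = w' i" if "i < d" for i
        by (rule multipliers_unique[OF w(4-6) w'(4-6) that])
      have "{i. i < d \<and> w i \<noteq> 0} = {fst p, snd p}" "{i. i < d \<and> w' i \<noteq> 0} = {fst q, snd q}"
        using w(1-3) w'(1-3) A[OF pq(1)] A[OF pq(2)] by (auto split: if_splits)
      moreover have "{i. i < d \<and> w i \<noteq> 0} = {i. i < d \<and> w' i \<noteq> 0}" using eq by auto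
      ultimately have "{fst p, snd p} = {fst q, snd q}" by simp
      then show "p = q" using pq by (auto simp: doubleton_eq_iff)
    qed (rule X2_le_1)
  qed
  finally have "(\<Sum>p\<in>?A. ?D p) * ((1 / L)\<^sup>2 * exp (- 4)) \<le> 1" by simp
  then have "(\<Sum>p\<in>?A. ?D p) \<le> L\<^sup>2 * exp 4" using L by (simp add: field_simps exp_minus)
  then show ?thesis by (simp add: case_prod_beta)
qed

end

section \<open>Bounds of order log d for the weighted sums of derivatives\<close>

lemma ln_ge_1:
  assumes "3 \<le> (d :: nat)"
  shows "1 \<le> ln (real d)"
proof -
  have "exp 1 \<le> real d" using assms exp_le by linarith
  then show ?thesis using assms by (subst ln_ge_iff) auto
qed

lemma integrable_dotd: "integrable (std_gauss d) (\<lambda>z. dotd d z w)"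
  unfolding dotd_def by (intro Bochner_Integration.integrable_sum integrable_mult_left integrable_std_gauss_coord) auto

lemma integrable_dotd_Jint: "integrable (std_gauss d) (\<lambda>z. dotd d z w * Jint d v e m \<beta> y z)"
proof (rule Bochner_Integration.integrable_bound[of _ "\<lambda>z. JB d m * dotd d z w"])
  show "integrable (std_gauss d) (\<lambda>z. JB d m * dotd d z w)"
    by (intro integrable_mult_right integrable_dotd)
  show "AE z in std_gauss d. norm (dotd d z w * Jint d v e m \<beta> y z) \<le> norm (JB d m * dotd d z w)"
  proof (rule AE_I2)
    fix z have "\<bar>dotd d z w\<bar> * \<bar>Jint d v e m \<beta> y z\<bar> \<le> \<bar>dotd d z w\<bar> * \<bar>JB d m\<bar>"
      using Jint_bound[of d v e m \<beta> y z] by (intro mult_left_mono) auto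
    then show "norm (dotd d z w * Jint d v e m \<beta> y z) \<le> norm (JB d m * dotd d z w)" by (simp add: abs_mult mult_ac)
  qed
qed (simp add: borel_measurable_std_gauss)

context polytope
begin

lemma D2_commute: "D2 c j k = D2 c k j"
  by (cases "j = k") (simp_all add: D2_def fun_upd_twist)

text \<open>Integration by parts, using \<open>\<phi>'(t) = - t \<phi>(t)\<close>.\<close>

lemma D2_diag:
  assumes j: "j < d"
  shows "D2 c j j = - c j * D1 c j - (\<Sum>k<d. if j \<noteq> k then S j k * D2 c j k else 0)"
proof -
  let ?T = "\<Sum>k\<in>{..<d} - {j}. dotd d (v j) (v k) * J d v e (e2 j k) \<beta> c"
  have e: "e \<noteq> 0" using e_pos by simp
  have Jj: "Jint d v e (e2 j j) \<beta> c z = - (c j / e) * Jint d v e (e1 j) \<beta> c z + \<beta> / e * (dotd d z (v j) * Jint d v e (e1 j) \<beta> c z)" for z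
  proof -
    have "(\<Prod>i\<in>{..<d} - {j}. psi (e2 j j i) ((c i - \<beta> * dotd d z (v i)) / e)) = (\<Prod>i\<in>{..<d} - {j}. psi (e1 j i) ((c i - \<beta> * dotd d z (v i)) / e))"
      by (intro prod.cong) auto
    then have "Jint d v e (e2 j j) \<beta> c z = - ((c j - \<beta> * dotd d z (v j)) / e) * Jint d v e (e1 j) \<beta> c z"
      unfolding Jint_def using j by (simp add: prod.remove[of _ j] psi_1 psi_2)
    then show ?thesis using e by (simp add: field_simps)
  qed
  have "J d v e (e2 j j) \<beta> c = - (c j / e) * J d v e (e1 j) \<beta> c + \<beta> / e * (\<integral>z. dotd d z (v j) * Jint d v e (e1 j) \<beta> c z \<partial>std_gauss d)"
    unfolding J_def Jj by (subst Bochner_Integration.integral_add)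
      (auto intro!: integrable_mult_right integrable_Jint integrable_dotd_Jint simp del: fun_upd_apply)
  also have "\<dots> = - (c j / e) * J d v e (e1 j) \<beta> c - \<beta>\<^sup>2 / e\<^sup>2 * (\<Sum>k<d. dotd d (v j) (v k) * J d v e (e2 j k) \<beta> c)"
    unfolding J_ibp[OF e] by (simp add: power2_eq_square)
  also have "(\<Sum>k<d. dotd d (v j) (v k) * J d v e (e2 j k) \<beta> c) = J d v e (e2 j j) \<beta> c + ?T"
    using j unit[OF j] by (subst sum.remove[of _ j]) auto
  finally have A: "J d v e (e2 j j) \<beta> c = - (c j / e) * J d v e (e1 j) \<beta> c - \<beta>\<^sup>2 / e\<^sup>2 * (J d v e (e2 j j) \<beta> c + ?T)" .
  \<comment> \<open>The integration by parts reproduces the unknown itself, because v_j . v_j = 1.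
    After clearing e^2 its coefficients add up to \<beta>^2 + e^2 = 1.\<close>
  have "e\<^sup>2 * x = - (p * e) * q - \<beta>\<^sup>2 * (x + r)" if "x = - (p / e) * q - \<beta>\<^sup>2 / e\<^sup>2 * (x + r)" for x p q r
  proof -
    have "e\<^sup>2 * x = e\<^sup>2 * (- (p / e) * q - \<beta>\<^sup>2 / e\<^sup>2 * (x + r))" using that by (rule arg_cong)
    also have "\<dots> = - (p * e) * q - \<beta>\<^sup>2 * (x + r)" using e by (simp add: right_diff_distrib power2_eq_square)
    finally show ?thesis .
  qed
  from this[OF A] have "e\<^sup>2 * J d v e (e2 j j) \<beta> c = - (c j * e) * J d v e (e1 j) \<beta> c - \<beta>\<^sup>2 * (J d v e (e2 j j) \<beta> c + ?T)" .
  then have "(\<beta>\<^sup>2 + e\<^sup>2) * J d v e (e2 j j) \<beta> c = - (c j * e) * J d v e (e1 j) \<beta> c - \<beta>\<^sup>2 * ?T"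
    by (simp add: algebra_simps)
  then have "J d v e (e2 j j) \<beta> c = - (c j * e) * J d v e (e1 j) \<beta> c - \<beta>\<^sup>2 * ?T"
    by (simp add: norm1)
  then have "D2 c j j = - (c j * e) * J d v e (e1 j) \<beta> c / e\<^sup>2 - \<beta>\<^sup>2 * ?T / e\<^sup>2"
    unfolding D2_def by (simp add: diff_divide_distrib)
  also have "- (c j * e) * J d v e (e1 j) \<beta> c / e\<^sup>2 = - c j * D1 c j"
    using e unfolding D1_def by (simp add: power2_eq_square)
  also have "\<beta>\<^sup>2 * ?T / e\<^sup>2 = (\<Sum>k\<in>{..<d} - {j}. S j k * D2 c j k)"
    unfolding D2_def S_def by (auto simp: sum_distrib_left sum_divide_distrib intro!: sum.cong)
  also have "\<dots> = (\<Sum>k<d. if j \<noteq> k then S j k * D2 c j k else 0)"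
    by (intro sum.mono_neutral_cong_left) auto
  finally show ?thesis .
qed

context
  assumes d: "3 \<le> d"
begin

text \<open>exp (- L^2 / 4) = 1 / d and exp (- L^2 / 2) = 1 / d^2, so thresholds beyond L contribute
  O(1) even when summed over d faces or d^2 ridges, while windows of size 1 / L cost at most L^2 = 4
  log d.\<close>

definition L :: real where "L = 2 * sqrt (ln (real d))"

lemma ln_d: "1 \<le> ln (real d)"
  by (rule ln_ge_1[OF d])

lemma L_ge_1: "1 \<le> L"
proof -
  have "1 \<le> sqrt (ln (real d))" using ln_d by simp
  then show ?thesis unfolding L_def by linarith
qed

lemma L_sq: "L\<^sup>2 = 4 * ln (real d)"
  unfolding L_def using ln_d by (simp add: power_mult_distrib)

lemma exp_le_of_L:
  assumes "L < x"
  shows "exp (- x\<^sup>2 / 4) \<le> 1 / real d"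
proof -
  have "4 * ln (real d) \<le> x\<^sup>2"
    using assms L_ge_1 power_mono[of L x 2] by (simp add: L_sq)
  then have "exp (- x\<^sup>2 / 4) \<le> exp (- ln (real d))" by simp
  also have "\<dots> = 1 / real d" using d by (simp add: exp_minus inverse_eq_divide)
  finally show ?thesis .
qed

lemma exp_half_le_of_L:
  assumes "L < x"
  shows "exp (- x\<^sup>2 / 2) \<le> 1 / (real d)\<^sup>2"
proof -
  have "exp (- x\<^sup>2 / 2) = (exp (- x\<^sup>2 / 4))\<^sup>2"
    by (simp add: exp_double[symmetric])
  also have "\<dots> \<le> (1 / real d)\<^sup>2" by (intro power_mono exp_le_of_L assms) simp
  finally show ?thesis by (simp add: power_divide)
qed

text \<open>Half of the Gaussian exponent absorbs the factor |c_j|, the other half supplies 1 /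
  d.\<close>

lemma abs_D1_tail:
  assumes j: "j < d" and x: "L < \<bar>c j\<bar>"
  shows "\<bar>c j\<bar> * D1 c j \<le> 2 * exp (3 / 2) / real d"
proof -
  let ?x = "\<bar>c j\<bar>"
  have "?x \<le> 2 * (1 + ?x\<^sup>2 / 4)"
    using zero_le_power2[of "?x - 1"] by (simp add: power2_diff)
  also have "\<dots> \<le> 2 * exp (?x\<^sup>2 / 4)" by (intro mult_left_mono exp_ge_add_one_self) simp
  finally have 1: "?x \<le> 2 * exp (?x\<^sup>2 / 4)" .
  have "?x * D1 c j \<le> (2 * exp (?x\<^sup>2 / 4)) * exp (1 / 2 - (c j)\<^sup>2 / 2)"
    by (intro mult_mono 1 D1_tail j D1_nonneg) auto
  also have "\<dots> = 2 * (exp (1 / 2) * exp (- ?x\<^sup>2 / 4))"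
    by (simp add: exp_add[symmetric] field_simps)
  also have "\<dots> \<le> 2 * (exp (3 / 2) * (1 / real d))"
    by (intro mult_left_mono mult_mono exp_le_of_L x) auto
  finally show ?thesis by simp
qed

text \<open>Nazarov's bound on the rate of change of the Gaussian probability when all thresholds
  are raised together. The constant is 2 from L and 2 from the thresholds beyond L.\<close>

lemma sum_D1: "(\<Sum>j<d. D1 c j) \<le> 4 * exp (3 / 2) * sqrt (ln (real d))"
proof -
  have "(\<Sum>j<d. D1 c j) = (\<Sum>j | j < d \<and> c j \<le> L. D1 c j) + (\<Sum>j | j < d \<and> L < c j. D1 c j)"
    by (subst sum.union_disjoint[symmetric]) (auto intro!: sum.cong)
  also have "(\<Sum>j | j < d \<and> L < c j. D1 c j) \<le> (\<Sum>j | j < d \<and> L < c j. 2 * exp (3 / 2) / real d)"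
  proof (rule sum_mono)
    fix j assume j: "j \<in> {j. j < d \<and> L < c j}"
    have "1 * D1 c j \<le> \<bar>c j\<bar> * D1 c j" using j L_ge_1 by (intro mult_right_mono D1_nonneg) auto
    also have "\<dots> \<le> 2 * exp (3 / 2) / real d" using j by (intro abs_D1_tail) auto
    finally show "D1 c j \<le> 2 * exp (3 / 2) / real d" by simp
  qed
  also have "\<dots> \<le> (\<Sum>j<d. 2 * exp (3 / 2) / real d)"
    by (intro sum_mono2) auto
  also have "\<dots> = 2 * exp (3 / 2)" using d by simp
  also have "\<dots> \<le> 2 * exp (3 / 2) * sqrt (ln (real d))"
    using ln_d by simp
  also have "(\<Sum>j | j < d \<and> c j \<le> L. D1 c j) \<le> L * exp (3 / 2)"
    by (rule sum_D1_le[OF L_ge_1])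
  finally show ?thesis by (simp add: L_def mult_ac)
qed

text \<open>The weight |c_j| is large for very negative thresholds too, so the cutoff is two-sided;
  below it the weight costs a second factor L. The constant is 4 from L^2 plus 2 from the
  tail.\<close>

lemma sum_abs_D1: "(\<Sum>j<d. \<bar>c j\<bar> * D1 c j) \<le> 6 * exp (3 / 2) * ln (real d)"
proof -
  have "(\<Sum>j<d. \<bar>c j\<bar> * D1 c j) = (\<Sum>j | j < d \<and> \<bar>c j\<bar> \<le> L. \<bar>c j\<bar> * D1 c j) + (\<Sum>j | j < d \<and> L < \<bar>c j\<bar>. \<bar>c j\<bar> * D1 c j)"
    by (subst sum.union_disjoint[symmetric]) (auto intro!: sum.cong)
  also have "(\<Sum>j | j < d \<and> L < \<bar>c j\<bar>. \<bar>c j\<bar> * D1 c j) \<le> (\<Sum>j | j < d \<and> L < \<bar>c j\<bar>. 2 * exp (3 / 2) / real d)"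
    by (intro sum_mono abs_D1_tail) auto
  also have "\<dots> \<le> (\<Sum>j<d. 2 * exp (3 / 2) / real d)"
    by (intro sum_mono2) auto
  also have "\<dots> = 2 * exp (3 / 2)" using d by simp
  also have "\<dots> \<le> 2 * exp (3 / 2) * ln (real d)"
    using ln_d by simp
  also have "(\<Sum>j | j < d \<and> \<bar>c j\<bar> \<le> L. \<bar>c j\<bar> * D1 c j) \<le> (\<Sum>j | j < d \<and> \<bar>c j\<bar> \<le> L. L * D1 c j)"
    by (intro sum_mono mult_right_mono D1_nonneg) auto
  also have "\<dots> \<le> (\<Sum>j | j < d \<and> c j \<le> L. L * D1 c j)"
    using L_ge_1 by (intro sum_mono2) (auto intro!: mult_nonneg_nonneg D1_nonneg)
  also have "\<dots> = L * (\<Sum>j | j < d \<and> c j \<le> L. D1 c j)" by (simp add: sum_distrib_left)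
  also have "\<dots> \<le> L * (L * exp (3 / 2))"
    using L_ge_1 by (intro mult_left_mono sum_D1_le) auto
  also have "\<dots> = 4 * exp (3 / 2) * ln (real d)"
    using L_sq by (simp add: power2_eq_square)
  finally show ?thesis by (simp add: mult_ac)
qed

text \<open>A pair with a threshold beyond L contributes at most e / d^2, by \<open>D2_tail\<close>
  with that threshold in first place; here e is Euler's number. Counting both orders, 2 (4 e^4 log d
  + e) <= 10 e^4 log d.\<close>

lemma sum_D2: "(\<Sum>j<d. \<Sum>k<d. if j \<noteq> k then (1 - (S j k)\<^sup>2) * D2 c j k else 0) \<le> 10 * exp 4 * ln (real d)"
proof -
  let ?D = "\<lambda>j k. (1 - (S j k)\<^sup>2) * D2 c j k"
  let ?A = "{(j, k). j < k \<and> k < d \<and> c j \<le> L \<and> c k \<le> L}"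
  have D0: "0 \<le> ?D j k" if "j < d" "k < d" "j \<noteq> k" for j k
    using S_lt_1[OF that] D2_nonneg[of j k] that by simp
  let ?P = "\<Sum>j<d. \<Sum>k<d. if j < k then ?D j k else 0"
  have 1: "(\<Sum>j<d. \<Sum>k<d. if j \<noteq> k then ?D j k else 0) = (\<Sum>j<d. \<Sum>k<d. if j < k then ?D j k else 0) + (\<Sum>j<d. \<Sum>k<d. if k < j then ?D j k else 0)"
    unfolding sum.distrib[symmetric] by (intro sum.cong refl) auto
  have 2: "(\<Sum>j<d. \<Sum>k<d. if k < j then ?D j k else 0) = (\<Sum>j<d. \<Sum>k<d. if j < k then ?D j k else 0)"
    by (subst sum.swap) (simp only: S_commute D2_commute)
  have 3: "?P \<le> (\<Sum>j<d. \<Sum>k<d. (if (j, k) \<in> ?A then ?D j k else 0) + exp 1 / (real d)\<^sup>2)"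
  proof (intro sum_mono)
    fix j k assume "j \<in> {..<d}" "k \<in> {..<d}"
    then have jk: "j < d" "k < d" by auto
    have t: "?D j k \<le> exp 1 / (real d)\<^sup>2" if "j < k" "L < c j \<or> L < c k"
    proof -
      have tail: "exp (1 - x\<^sup>2 / 2) \<le> exp 1 / (real d)\<^sup>2" if "L < x" for x
      proof -
        have "exp (1 - x\<^sup>2 / 2) = exp 1 * exp (- x\<^sup>2 / 2)" by (simp add: exp_add[symmetric])
        also have "\<dots> \<le> exp 1 * (1 / (real d)\<^sup>2)" by (intro mult_left_mono exp_half_le_of_L that) auto
        finally show ?thesis by simp
      qed
      show ?thesis
      proof (cases "L < c j")
        case True
        then show ?thesis using D2_tail[of j k c] tail[of "c j"] jk that by auto
      next
        case False
        then have "L < c k" using that by simp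
        then show ?thesis using D2_tail[of k j c] tail[of "c k"] jk that S_commute[of j k] D2_commute[of c j k] by auto
      qed
    qed
    show "(if j < k then ?D j k else 0) \<le> (if (j, k) \<in> ?A then ?D j k else 0) + exp 1 / (real d)\<^sup>2"
    proof (cases "j < k \<and> (L < c j \<or> L < c k)")
      case True then show ?thesis using t by auto
    next
      case False then show ?thesis using jk by auto
    qed
  qed
  have 4: "(\<Sum>j<d. \<Sum>k<d. (if (j, k) \<in> ?A then ?D j k else 0) + exp 1 / (real d)\<^sup>2)
    = (\<Sum>j<d. \<Sum>k<d. if (j, k) \<in> ?A then ?D j k else 0) + exp 1"
  proof -
    have "(\<Sum>j<d. \<Sum>k<d. exp 1 / (real d)\<^sup>2) = exp 1" using d by (simp add: power2_eq_square)
    then show ?thesis by (simp only: sum.distrib)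
  qed
  have 5: "(\<Sum>j<d. \<Sum>k<d. if (j, k) \<in> ?A then ?D j k else 0) = (\<Sum>(j, k)\<in>?A. ?D j k)"
  proof -
    have "(\<Sum>j<d. \<Sum>k<d. if (j, k) \<in> ?A then ?D j k else 0) = (\<Sum>p\<in>{..<d} \<times> {..<d}. if p \<in> ?A then (case p of (j, k) \<Rightarrow> ?D j k) else 0)"
      unfolding sum.cartesian_product by (intro sum.cong refl) (simp only: split_paired_all prod.case)
    also have "\<dots> = (\<Sum>p\<in>?A. case p of (j, k) \<Rightarrow> ?D j k)"
      by (intro sum.mono_neutral_cong_right) auto
    finally show ?thesis .
  qed
  have "?P \<le> L\<^sup>2 * exp 4 + exp 1"
    using 3 sum_D2_le[OF L_ge_1, of c] unfolding 4 5 by linarith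
  then have *: "(\<Sum>j<d. \<Sum>k<d. if j \<noteq> k then ?D j k else 0) \<le> 2 * (4 * exp 4 * ln (real d) + exp 1)"
    unfolding 1 2 L_sq by (simp add: mult_ac)
  have "exp 1 * 1 \<le> exp 4 * ln (real d)" using ln_d by (intro mult_mono) auto
  then show ?thesis using * by simp
qed

text \<open>\<open>m2\<close> speaks of the symmetrized coefficients alone. These are what survives
  the elimination of the diagonal, because \<open>D2\<close> is symmetric.\<close>

lemma key_bound_normalized:
  assumes F: "0 \<le> F" and K: "0 \<le> K"
    and m1: "\<And>j. j < d \<Longrightarrow> \<bar>m j j\<bar> \<le> F"
    and m2: "\<And>j k. j < d \<Longrightarrow> k < d \<Longrightarrow> j \<noteq> k \<Longrightarrow> \<bar>m j k + m k j - S j k * (m j j + m k k)\<bar> \<le> K * F * (1 - (S j k)\<^sup>2)"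
  shows "\<bar>\<Sum>j<d. \<Sum>k<d. m j k * D2 c j k\<bar> \<le> (6 * exp (3 / 2) + 5 * K * exp 4) * F * ln (real d)"
proof -
  let ?t = "\<lambda>j k. if j \<noteq> k then (m j k - S j k * m j j) * D2 c j k else 0"
  define T where "T = (\<Sum>j<d. \<Sum>k<d. ?t j k)"
  have "(\<Sum>k<d. m j k * D2 c j k) = - (m j j * c j * D1 c j) + (\<Sum>k<d. ?t j k)" if j: "j < d" for j
  proof -
    have "(\<Sum>k<d. m j k * D2 c j k) = m j j * D2 c j j + (\<Sum>k<d. if j \<noteq> k then m j k * D2 c j k else 0)"
    proof -
      have "(\<Sum>k\<in>{..<d} - {j}. m j k * D2 c j k) = (\<Sum>k<d. if j \<noteq> k then m j k * D2 c j k else 0)"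
        by (intro sum.mono_neutral_cong_left) auto
      then show ?thesis using j by (subst sum.remove[of _ j]) auto
    qed
    also have "\<dots> = - (m j j * c j * D1 c j) + ((\<Sum>k<d. if j \<noteq> k then m j k * D2 c j k else 0) - m j j * (\<Sum>k<d. if j \<noteq> k then S j k * D2 c j k else 0))"
      unfolding D2_diag[OF j] by (simp add: algebra_simps)
    also have "(\<Sum>k<d. if j \<noteq> k then m j k * D2 c j k else 0) - m j j * (\<Sum>k<d. if j \<noteq> k then S j k * D2 c j k else 0) = (\<Sum>k<d. ?t j k)"
      unfolding sum_distrib_left sum_subtractf[symmetric] by (intro sum.cong refl) (simp add: algebra_simps)
    finally show ?thesis .
  qed
  then have eq: "(\<Sum>j<d. \<Sum>k<d. m j k * D2 c j k) = - (\<Sum>j<d. m j j * c j * D1 c j) + T"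
    unfolding T_def by (simp add: sum.distrib sum_negf sum_subtractf)
  have "\<bar>\<Sum>j<d. m j j * c j * D1 c j\<bar> \<le> (\<Sum>j<d. F * (\<bar>c j\<bar> * D1 c j))"
  proof (rule order_trans[OF sum_abs], rule sum_mono)
    fix j assume "j \<in> {..<d}"
    then have "\<bar>m j j\<bar> * (\<bar>c j\<bar> * D1 c j) \<le> F * (\<bar>c j\<bar> * D1 c j)"
      by (intro mult_right_mono m1) (auto simp: D1_nonneg)
    then show "\<bar>m j j * c j * D1 c j\<bar> \<le> F * (\<bar>c j\<bar> * D1 c j)"
      by (simp add: abs_mult D1_nonneg mult.assoc)
  qed
  also have "\<dots> = F * (\<Sum>j<d. \<bar>c j\<bar> * D1 c j)" by (simp add: sum_distrib_left)
  also have "\<dots> \<le> F * (6 * exp (3 / 2) * ln (real d))" by (intro mult_left_mono sum_abs_D1 F)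
  finally have b1: "\<bar>\<Sum>j<d. m j j * c j * D1 c j\<bar> \<le> F * (6 * exp (3 / 2) * ln (real d))" .
  \<comment> \<open>Adding the transposed sum symmetrizes the coefficients. It bounds 2 T, so the
    constant 10 of \<open>sum_D2\<close> becomes 5.\<close>
  have "T + T = (\<Sum>j<d. \<Sum>k<d. ?t j k) + (\<Sum>j<d. \<Sum>k<d. ?t k j)"
    unfolding T_def by (subst (3) sum.swap) simp
  also have "\<dots> = (\<Sum>j<d. \<Sum>k<d. if j \<noteq> k then (m j k + m k j - S j k * (m j j + m k k)) * D2 c j k else 0)"
    unfolding sum.distrib[symmetric] by (intro sum.cong refl) (simp add: S_commute[of _ _] D2_commute algebra_simps)
  finally have TT: "T + T = (\<Sum>j<d. \<Sum>k<d. if j \<noteq> k then (m j k + m k j - S j k * (m j j + m k k)) * D2 c j k else 0)" .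
  have "\<bar>T + T\<bar> \<le> (\<Sum>j<d. \<Sum>k<d. K * F * (if j \<noteq> k then (1 - (S j k)\<^sup>2) * D2 c j k else 0))"
    unfolding TT
  proof (rule order_trans[OF sum_abs], rule sum_mono, rule order_trans[OF sum_abs], rule sum_mono)
    fix j k assume "j \<in> {..<d}" "k \<in> {..<d}"
    then have jk: "j < d" "k < d" by auto
    show "\<bar>if j \<noteq> k then (m j k + m k j - S j k * (m j j + m k k)) * D2 c j k else 0\<bar> \<le> K * F * (if j \<noteq> k then (1 - (S j k)\<^sup>2) * D2 c j k else 0)"
    proof (cases "j = k")
      case False
      have "\<bar>m j k + m k j - S j k * (m j j + m k k)\<bar> * D2 c j k \<le> (K * F * (1 - (S j k)\<^sup>2)) * D2 c j k"
        by (intro mult_right_mono m2 D2_nonneg jk False)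
      then show ?thesis using False by (simp add: abs_mult D2_nonneg mult.assoc)
    qed simp
  qed
  also have "\<dots> = K * F * (\<Sum>j<d. \<Sum>k<d. if j \<noteq> k then (1 - (S j k)\<^sup>2) * D2 c j k else 0)"
    by (simp only: sum_distrib_left)
  also have "\<dots> \<le> K * F * (10 * exp 4 * ln (real d))"
    using K F by (intro mult_left_mono sum_D2) auto
  finally have b2: "\<bar>T\<bar> \<le> K * F * (5 * exp 4 * ln (real d))" by simp
  have "\<bar>- (\<Sum>j<d. m j j * c j * D1 c j) + T\<bar> \<le> \<bar>\<Sum>j<d. m j j * c j * D1 c j\<bar> + \<bar>T\<bar>" by linarith
  also have "\<dots> \<le> F * (6 * exp (3 / 2) * ln (real d)) + K * F * (5 * exp 4 * ln (real d))"
    using b1 b2 by linarith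
  finally show ?thesis unfolding eq by (simp add: algebra_simps)
qed

end

end

section \<open>Undoing the normalization of the variances\<close>

lemma J_scale:
  assumes "0 < t"
  shows "J d v e m \<beta> y = J d v (e / t) m (\<beta> / t) (\<lambda>i. y i / t)"
proof -
  have "(y i - \<beta> * x) / e = (y i / t - \<beta> / t * x) / (e / t)" for i x
    using assms by (cases "e = 0") (simp_all add: field_simps)
  then show ?thesis unfolding J_def Jint_def by (simp only:)
qed

lemma polytope_scaled:
  fixes e \<beta> :: real
  assumes "0 < e" and unit: "\<And>i. i < d \<Longrightarrow> dotd d (v i) (v i) = 1"
  defines "t \<equiv> sqrt (\<beta>\<^sup>2 + e\<^sup>2)"
  shows "0 < t" "t\<^sup>2 = \<beta>\<^sup>2 + e\<^sup>2" "polytope d v (\<beta> / t) (e / t)"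
proof -
  have "0 < e\<^sup>2" using assms(1) by simp
  then have p: "0 < \<beta>\<^sup>2 + e\<^sup>2" using zero_le_power2[of \<beta>] by linarith
  then show t: "0 < t" by (simp add: t_def)
  show t2: "t\<^sup>2 = \<beta>\<^sup>2 + e\<^sup>2" using p by (simp add: t_def)
  show "polytope d v (\<beta> / t) (e / t)"
  proof
    show "(\<beta> / t)\<^sup>2 + (e / t)\<^sup>2 = 1"
      unfolding power_divide add_divide_distrib[symmetric] t2 by (rule divide_self) (use p in linarith)
  qed (use assms t in auto)
qed

text \<open>The prefactor is the square of the normalized noise level e / t, which the definition of
  \<open>D2\<close> divides out. Its e^2 will cancel the 1 / e^2 that differentiation along the path
  produces, leaving 1 / (\<beta>^2 + e^2).\<close>

lemma key_bound:
  assumes d: "3 \<le> d" and e: "0 < e" and unit: "\<And>i. i < d \<Longrightarrow> dotd d (v i) (v i) = 1"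
    and F: "0 \<le> F" and K: "0 \<le> K"
    and m1: "\<And>j. j < d \<Longrightarrow> \<bar>m j j\<bar> \<le> F"
    and m2: "\<And>j k. j < d \<Longrightarrow> k < d \<Longrightarrow> j \<noteq> k \<Longrightarrow>
      \<bar>m j k + m k j - \<beta>\<^sup>2 / (\<beta>\<^sup>2 + e\<^sup>2) * dotd d (v j) (v k) * (m j j + m k k)\<bar>
        \<le> K * F * (1 - (\<beta>\<^sup>2 / (\<beta>\<^sup>2 + e\<^sup>2) * dotd d (v j) (v k))\<^sup>2)"
  shows "\<bar>\<Sum>j<d. \<Sum>k<d. m j k * J d v e (e2 j k) \<beta> y\<bar>
    \<le> e\<^sup>2 / (\<beta>\<^sup>2 + e\<^sup>2) * ((6 * exp (3 / 2) + 5 * K * exp 4) * F * ln (real d))"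
proof -
  define t where "t = sqrt (\<beta>\<^sup>2 + e\<^sup>2)"
  have t: "0 < t" "t\<^sup>2 = \<beta>\<^sup>2 + e\<^sup>2" "polytope d v (\<beta> / t) (e / t)"
    unfolding t_def by (rule polytope_scaled[OF e]; erule unit)+
  interpret P: polytope d v "\<beta> / t" "e / t" by (rule t(3))
  have S: "P.S j k = \<beta>\<^sup>2 / (\<beta>\<^sup>2 + e\<^sup>2) * dotd d (v j) (v k)" if "j \<noteq> k" for j k
    unfolding P.S_def using that t by (simp add: power_divide)
  have "\<bar>\<Sum>j<d. \<Sum>k<d. m j k * P.D2 (\<lambda>i. y i / t) j k\<bar> \<le> (6 * exp (3 / 2) + 5 * K * exp 4) * F * ln (real d)"
    by (rule P.key_bound_normalized[OF d F K m1]) (use S m2 in auto)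
  moreover have "m j k * J d v e (e2 j k) \<beta> y = e\<^sup>2 / (\<beta>\<^sup>2 + e\<^sup>2) * (m j k * P.D2 (\<lambda>i. y i / t) j k)" for j k
  proof -
    have "P.D2 (\<lambda>i. y i / t) j k = J d v e (e2 j k) \<beta> y * ((\<beta>\<^sup>2 + e\<^sup>2) / e\<^sup>2)"
      unfolding P.D2_def J_scale[OF t(1), where d = d and v = v and e = e, symmetric] using e t by (simp add: power_divide)
    then show ?thesis using e t(1,2) by (simp add: field_simps)
  qed
  ultimately show ?thesis
    using e by (simp only: sum_distrib_left[symmetric] abs_mult) (intro mult_mono, auto)
qed

text \<open>For \<beta> = 1 the standard deviation t is at least 1, so passing from the normalized
  noise level e / t to e only loses.\<close>

lemma sum_J_e1_bound:
  assumes d: "3 \<le> d" and e: "0 < e" and unit: "\<And>i. i < d \<Longrightarrow> dotd d (v i) (v i) = 1"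
  shows "(\<Sum>j<d. J d v e (e1 j) 1 y) \<le> e * (4 * exp (3 / 2) * sqrt (ln (real d)))"
proof -
  define t where "t = sqrt (1\<^sup>2 + e\<^sup>2)"
  have t: "0 < t" "t\<^sup>2 = 1\<^sup>2 + e\<^sup>2" "polytope d v (1 / t) (e / t)"
    unfolding t_def by (rule polytope_scaled[OF e]; erule unit)+
  interpret P: polytope d v "1 / t" "e / t" by (rule t(3))
  have t1: "1 \<le> t" unfolding t_def using e by simp
  have "J d v e (e1 j) 1 y = e / t * P.D1 (\<lambda>i. y i / t) j" for j
    unfolding P.D1_def J_scale[OF t(1), where d = d and v = v and e = e, symmetric] using e t by simp
  then have "(\<Sum>j<d. J d v e (e1 j) 1 y) = e / t * (\<Sum>j<d. P.D1 (\<lambda>i. y i / t) j)"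
    by (simp add: sum_distrib_left)
  also have "\<dots> \<le> e * (4 * exp (3 / 2) * sqrt (ln (real d)))"
    using e t1 P.sum_D1[OF d, of "\<lambda>i. y i / t"] d
    by (intro mult_mono) (auto simp: divide_le_eq P.D1_nonneg intro!: sum_nonneg)
  finally show ?thesis .
qed

section \<open>Entries of \<open>M\<close> in the plane of two normals\<close>

lemma qform_cong:
  assumes "\<And>i. i < d \<Longrightarrow> u i = u' i" "\<And>i. i < d \<Longrightarrow> w i = w' i"
  shows "qform d u M w = qform d u' M w'"
  unfolding qform_def using assms by (intro sum.cong) auto

lemma qform_lin_left: "qform d (\<lambda>i. a * x i + b * y i) M w = a * qform d x M w + b * qform d y M w"
  unfolding qform_def by (simp add: distrib_right sum.distrib sum_distrib_left mult.assoc)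

lemma qform_lin_right: "qform d w M (\<lambda>i. a * x i + b * y i) = a * qform d w M x + b * qform d w M y"
  unfolding qform_def by (simp add: distrib_left sum.distrib sum_distrib_left mult_ac)

lemma dotd_lin_left: "dotd d (\<lambda>i. a * x i + b * y i) w = a * dotd d x w + b * dotd d y w"
  unfolding dotd_def by (simp add: distrib_right sum.distrib sum_distrib_left mult.assoc)

lemma dotd_lin_right: "dotd d w (\<lambda>i. a * x i + b * y i) = a * dotd d w x + b * dotd d w y"
  unfolding dotd_def by (simp add: distrib_left sum.distrib sum_distrib_left mult_ac)

lemma dotd_cong:
  assumes "\<And>i. i < d \<Longrightarrow> u i = u' i" "\<And>i. i < d \<Longrightarrow> w i = w' i"
  shows "dotd d u w = dotd d u' w'"
  unfolding dotd_def using assms by (intro sum.cong) auto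

lemma dotd_eq_0_iff: "dotd d u u = 0 \<longleftrightarrow> (\<forall>i<d. u i = 0)"
  unfolding dotd_def by (subst sum_nonneg_eq_0_iff) auto

text \<open>The equality case of Cauchy--Schwarz: |u + w|^2 = 2 + 2 u . w and |u - w|^2 = 2 - 2 u .
  w are both nonzero.\<close>

lemma dotd_strict_bound:
  assumes u: "dotd d u u = 1" "dotd d w w = 1"
    and ne: "\<exists>i<d. u i \<noteq> w i" "\<not> (\<forall>i<d. w i = - u i)"
  shows "(dotd d u w)\<^sup>2 < 1"
proof -
  have e1: "dotd d (\<lambda>i. 1 * u i + 1 * w i) (\<lambda>i. 1 * u i + 1 * w i) = 2 + 2 * dotd d u w"
    and e2: "dotd d (\<lambda>i. 1 * u i + (-1) * w i) (\<lambda>i. 1 * u i + (-1) * w i) = 2 - 2 * dotd d u w"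
    using u unfolding dotd_lin_left dotd_lin_right by (simp_all add: dotd_commute[of d w u])
  have "dotd d (\<lambda>i. 1 * u i + 1 * w i) (\<lambda>i. 1 * u i + 1 * w i) \<noteq> 0"
    using ne(2) unfolding dotd_eq_0_iff by (auto simp: add_eq_0_iff)
  moreover have "dotd d (\<lambda>i. 1 * u i + (-1) * w i) (\<lambda>i. 1 * u i + (-1) * w i) \<noteq> 0"
    using ne(1) unfolding dotd_eq_0_iff by auto
  ultimately have "\<bar>dotd d u w\<bar> \<noteq> 1" unfolding e1 e2 by (auto simp: abs_if split: if_splits)
  then have "\<bar>dotd d u w\<bar> < 1" using dotd_unit_bound[OF u] by simp
  then show ?thesis by (simp add: abs_square_less_1)
qed

text \<open>The vector is (v_k - \<rho> v_j) / s. Most of the work is to show that the description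
  in \<open>vperp\<close> determines it uniquely.\<close>

lemma vperp_props:
  assumes u: "dotd d vj vj = 1" "dotd d vk vk = 1" and r: "(dotd d vj vk)\<^sup>2 < 1"
  defines "\<rho> \<equiv> dotd d vj vk"
  defines "s \<equiv> sqrt (1 - \<rho>\<^sup>2)"
  shows "0 < s" "s\<^sup>2 = 1 - \<rho>\<^sup>2" "\<And>i. i < d \<Longrightarrow> vk i = \<rho> * vj i + s * vperp d vj vk i"
proof -
  show s: "0 < s" and s2: "s\<^sup>2 = 1 - \<rho>\<^sup>2" using r by (simp_all add: s_def \<rho>_def)
  have rk: "dotd d vk vj = \<rho>" by (simp add: \<rho>_def dotd_commute)
  define u0 where "u0 = (\<lambda>i\<in>{..<d}. (- \<rho> / s) * vj i + (1 / s) * vk i)"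
  have "vperp d vj vk = u0"
    unfolding vperp_def
  proof (rule the_equality)
    have c: "dotd d u0 w = (- \<rho> / s) * dotd d vj w + (1 / s) * dotd d vk w" for w
      unfolding dotd_lin_left[symmetric] by (rule dotd_cong) (simp_all add: u0_def)
    have a1: "dotd d u0 vj = 0" unfolding c by (simp add: u rk)
    have a2: "dotd d u0 vk = s"
    proof -
      have "dotd d u0 vk = (1 - \<rho>\<^sup>2) / s" unfolding c using u by (simp add: \<rho>_def[symmetric] power2_eq_square diff_divide_distrib)
      then show ?thesis using s unfolding s2[symmetric] by (simp add: power2_eq_square)
    qed
    have "dotd d vj u0 = 0" "dotd d vk u0 = s" using a1 a2 by (simp_all add: dotd_commute)
    then have "dotd d u0 u0 = 1" using c[of u0] s by simp
    moreover have "\<exists>a b. \<forall>i<d. u0 i = a * vj i + b * vk i" unfolding u0_def by (intro exI[of _ "- \<rho> / s"] exI[of _ "1 / s"]) auto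
    ultimately show "u0 \<in> Rd d \<and> (\<exists>a b. \<forall>i<d. u0 i = a * vj i + b * vk i) \<and> dotd d u0 u0 = 1 \<and> dotd d u0 vj = 0 \<and> 0 < dotd d u0 vk"
      using s a1 a2 by (auto simp: u0_def)
  next
    fix x assume x: "x \<in> Rd d \<and> (\<exists>a b. \<forall>i<d. x i = a * vj i + b * vk i) \<and> dotd d x x = 1 \<and> dotd d x vj = 0 \<and> 0 < dotd d x vk"
    then obtain a b where ab: "\<And>i. i < d \<Longrightarrow> x i = a * vj i + b * vk i" by blast
    have c: "dotd d x w = a * dotd d vj w + b * dotd d vk w" for w
      unfolding dotd_lin_left[symmetric] by (rule dotd_cong) (simp_all add: ab)
    \<comment> \<open>Orthogonality to v_j fixes the ratio of the coefficients, unit length gives (b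
      s)^2 = 1, and positivity against v_k picks the sign.\<close>
    have a: "a = - (b * \<rho>)" using x c[of vj] by (simp add: u rk)
    have k: "dotd d x vk = b * s\<^sup>2" using c[of vk] u unfolding s2 by (simp add: a \<rho>_def[symmetric] power2_eq_square algebra_simps)
    then have b: "0 < b" using x s by (simp add: zero_less_mult_iff)
    have x1: "dotd d x x = 1" "dotd d x vj = 0" using x by auto
    have "1 = b * dotd d x vk" using c[of x] x1 dotd_commute[of d vj x] dotd_commute[of d vk x] by simp
    then have "(b * s)\<^sup>2 = 1" unfolding k by (simp add: power2_eq_square mult_ac)
    then have "b * s = 1" using mult_pos_pos[OF b s] by (auto simp: power2_eq_1_iff)
    then have b': "b = 1 / s" using s by (simp add: field_simps)
    show "x = u0"
    proof
      fix i show "x i = u0 i"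
        using x ab[of i] by (cases "i < d") (auto simp: u0_def a b' PiE_def extensional_def)
    qed
  qed
  then show "vk i = \<rho> * vj i + s * vperp d vj vk i" if "i < d" for i
    using that s by (simp add: u0_def field_simps)
qed

text \<open>The frames \<open>(v\<^sub>j, v\<^sub>j\<^sub>k)\<close> and \<open>(v\<^sub>k, v\<^sub>k\<^sub>j)\<close> have opposite orientation, so the two off-diagonal
  terms nearly cancel when \<open>v\<^sub>j\<close> and \<open>v\<^sub>k\<close> are nearly parallel. The entry \<open>\<langle>v\<^sub>j\<^sub>k, M v\<^sub>j\<rangle>\<close>, which \<open>F\<close> does
  not bound, is recovered from the entries of the second frame up to a factor \<open>1 / s\<close>.\<close>

lemma pair_bound:
  assumes u: "dotd d vj vj = 1" "dotd d vk vk = 1"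
    and ne: "\<exists>i<d. vj i \<noteq> vk i" "\<not> (\<forall>i<d. vk i = - vj i)"
    and F1: "\<bar>qform d vj M vj\<bar> + \<bar>qform d vj M (vperp d vj vk)\<bar> + \<bar>qform d (vperp d vj vk) M (vperp d vj vk)\<bar> \<le> F"
    and F2: "\<bar>qform d vk M vk\<bar> + \<bar>qform d vk M (vperp d vk vj)\<bar> + \<bar>qform d (vperp d vk vj) M (vperp d vk vj)\<bar> \<le> F"
  defines "\<rho> \<equiv> dotd d vj vk"
  shows "\<bar>qform d vj M vk + qform d vk M vj - \<rho> * (qform d vj M vj + qform d vk M vk)\<bar> \<le> 11 * F * (1 - \<rho>\<^sup>2)"
    and "\<bar>qform d vj M vk\<bar> \<le> 2 * F"
proof -
  have r2: "(dotd d vj vk)\<^sup>2 < 1" by (rule dotd_strict_bound[OF u ne])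
  have r2': "(dotd d vk vj)\<^sup>2 < 1" using r2 by (simp add: dotd_commute)
  define s where "s = sqrt (1 - \<rho>\<^sup>2)"
  define x where "x = vperp d vj vk"
  define x' where "x' = vperp d vk vj"
  have s: "0 < s" "s\<^sup>2 = 1 - \<rho>\<^sup>2" and vk: "\<And>i. i < d \<Longrightarrow> vk i = \<rho> * vj i + s * x i"
    unfolding s_def \<rho>_def x_def by (rule vperp_props[OF u r2]; assumption)+
  have vj: "\<And>i. i < d \<Longrightarrow> vj i = \<rho> * vk i + s * x' i"
    using vperp_props(3)[OF u(2,1) r2'] unfolding s_def \<rho>_def x'_def by (simp add: dotd_commute)
  \<comment> \<open>In the basis (v_j, x) the second frame is (\<rho>, s), (s, - \<rho>): a
    reflection of the first.\<close>
  have x': "x' i = s * vj i + (- \<rho>) * x i" if "i < d" for i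
  proof -
    have "s * x' i = (1 - \<rho>\<^sup>2) * vj i - \<rho> * s * x i"
      using vj[OF that] vk[OF that] by (simp add: algebra_simps power2_eq_square)
    also have "\<dots> = s * (s * vj i + (- \<rho>) * x i)" unfolding s(2)[symmetric] by (simp add: algebra_simps power2_eq_square)
    finally show ?thesis using s(1) by simp
  qed
  define a where "a = qform d vj M vj"
  define p where "p = qform d vj M x"
  define r where "r = qform d x M vj"
  define q where "q = qform d x M x"
  define a' where "a' = qform d vk M vk"
  define p' where "p' = qform d vk M x'"
  define q' where "q' = qform d x' M x'"
  have F: "\<bar>a\<bar> + \<bar>p\<bar> + \<bar>q\<bar> \<le> F" "\<bar>a'\<bar> + \<bar>p'\<bar> + \<bar>q'\<bar> \<le> F"
    using F1 F2 unfolding a_def p_def q_def a'_def p'_def q'_def x_def x'_def by auto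
  have rho: "\<bar>\<rho>\<bar> \<le> 1" using r2 by (simp add: \<rho>_def abs_square_less_1 less_imp_le)
  have s1: "s \<le> 1" unfolding s_def by simp
  have mjk: "qform d vj M vk = \<rho> * a + s * p"
    unfolding a_def p_def qform_lin_right[symmetric] by (rule qform_cong) (simp_all add: vk)
  have mkj: "qform d vk M vj = \<rho> * a' + s * p'"
    unfolding a'_def p'_def qform_lin_right[symmetric] by (rule qform_cong[OF refl vj])
  have ea': "a' = \<rho>\<^sup>2 * a + \<rho> * s * p + \<rho> * s * r + s\<^sup>2 * q"
  proof -
    have "a' = qform d (\<lambda>i. \<rho> * vj i + s * x i) M (\<lambda>i. \<rho> * vj i + s * x i)"
      unfolding a'_def by (rule qform_cong[OF vk vk])
    then show ?thesis unfolding qform_lin_left qform_lin_right a_def p_def r_def q_def by (simp add: algebra_simps power2_eq_square)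
  qed
  have ep': "p' = \<rho> * s * a - \<rho>\<^sup>2 * p + s\<^sup>2 * r - \<rho> * s * q"
  proof -
    have "p' = qform d (\<lambda>i. \<rho> * vj i + s * x i) M (\<lambda>i. s * vj i + (- \<rho>) * x i)"
      unfolding p'_def by (rule qform_cong[OF vk x'])
    then show ?thesis unfolding qform_lin_left qform_lin_right a_def p_def r_def q_def by (simp add: algebra_simps power2_eq_square)
  qed
  have b: "\<bar>t * y\<bar> \<le> \<bar>y\<bar>" if "\<bar>t\<bar> \<le> 1" for t y :: real
    using that mult_right_mono[of "\<bar>t\<bar>" 1 "\<bar>y\<bar>"] by (simp add: abs_mult)
  have rs: "\<bar>\<rho> * s\<bar> \<le> 1" "\<bar>\<rho>\<^sup>2\<bar> \<le> 1" "\<bar>s\<^sup>2\<bar> \<le> 1" "\<bar>s\<bar> \<le> 1"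
    using rho s1 s(1) mult_mono[of "\<bar>\<rho>\<bar>" 1 s 1] by (auto simp: abs_mult abs_square_le_1 power2_le_iff_abs_le)
  have g: "\<bar>y\<bar> \<le> Y1 + Y2 + Y3 + Y4" if "y = y1 + y2 + y3 + y4" "\<bar>y1\<bar> \<le> Y1" "\<bar>y2\<bar> \<le> Y2" "\<bar>y3\<bar> \<le> Y3" "\<bar>y4\<bar> \<le> Y4"
    for y y1 y2 y3 y4 Y1 Y2 Y3 Y4 :: real
    using that by linarith
  have c1: "\<bar>\<rho> * s * r\<bar> \<le> 2 * F"
  proof -
    have "\<bar>\<rho> * s * r\<bar> \<le> \<bar>a'\<bar> + \<bar>a\<bar> + \<bar>p\<bar> + \<bar>q\<bar>"
    proof (rule g)
      show "\<rho> * s * r = a' + - (\<rho>\<^sup>2 * a) + - (\<rho> * s * p) + - (s\<^sup>2 * q)" using ea' by simp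
    qed (use b[OF rs(2), of a] b[OF rs(1), of p] b[OF rs(3), of q] in simp_all)
    then show ?thesis using F by linarith
  qed
  have c2: "\<bar>s\<^sup>2 * r\<bar> \<le> 2 * F"
  proof -
    have "\<bar>s\<^sup>2 * r\<bar> \<le> \<bar>p'\<bar> + \<bar>a\<bar> + \<bar>p\<bar> + \<bar>q\<bar>"
    proof (rule g)
      show "s\<^sup>2 * r = p' + - (\<rho> * s * a) + \<rho>\<^sup>2 * p + \<rho> * s * q" using ep' by simp
    qed (use b[OF rs(1), of a] b[OF rs(2), of p] b[OF rs(1), of q] in simp_all)
    then show ?thesis using F by linarith
  qed
  \<comment> \<open>a' determines \<rho> s r and p' determines s^2 r. Since \<rho>^2 + s^2 = 1,
    weighting them by \<rho> and s recovers s r, however small either of \<rho> and s is.\<close>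
  have sr: "\<bar>s * r\<bar> \<le> 4 * F"
  proof -
    have "s * r * 1 = s * r * (\<rho>\<^sup>2 + s\<^sup>2)" using s(2) by simp
    then have "s * r = \<rho> * (\<rho> * s * r) + s * (s\<^sup>2 * r)"
      by (simp add: algebra_simps power2_eq_square)
    then show ?thesis using c1 c2 b[OF rho, of "\<rho> * s * r"] b[OF rs(4), of "s\<^sup>2 * r"] by linarith
  qed
  \<comment> \<open>The leading parts of p and p' cancel, since p' contains - \<rho>^2 p, and a
    factor s remains. The second factor s comes from the decomposition of v_k, so the total is s^2 =
    1 - \<rho>^2.\<close>
  have "p + p' = s * (\<rho> * a + s * p + s * r - \<rho> * q)"
  proof -
    have "p - \<rho>\<^sup>2 * p = s\<^sup>2 * p" unfolding s(2) by (simp add: algebra_simps)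
    then have "p + p' = \<rho> * s * a + s\<^sup>2 * p + s\<^sup>2 * r - \<rho> * s * q" unfolding ep' by linarith
    then show ?thesis by (simp add: algebra_simps power2_eq_square)
  qed
  then have "\<bar>p + p'\<bar> = s * \<bar>\<rho> * a + s * p + s * r - \<rho> * q\<bar>" using s by (simp add: abs_mult)
  moreover have "\<bar>\<rho> * a + s * p + s * r - \<rho> * q\<bar> \<le> 11 * F"
  proof -
    have "\<bar>\<rho> * a + s * p + s * r - \<rho> * q\<bar> \<le> \<bar>a\<bar> + \<bar>p\<bar> + 4 * F + \<bar>q\<bar>"
    proof (rule g)
      show "\<rho> * a + s * p + s * r - \<rho> * q = \<rho> * a + s * p + s * r + - (\<rho> * q)" by simp
    qed (use sr b[OF rho, of a] b[OF rs(4), of p] b[OF rho, of q] in simp_all)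
    then show ?thesis using F by linarith
  qed
  ultimately have "\<bar>p + p'\<bar> \<le> s * (11 * F)" using s by simp
  then have "s * \<bar>p + p'\<bar> \<le> s * (s * (11 * F))" using s by (intro mult_left_mono) auto
  moreover have "qform d vj M vk + qform d vk M vj - \<rho> * (qform d vj M vj + qform d vk M vk) = s * (p + p')"
    unfolding mjk mkj a_def[symmetric] a'_def[symmetric] by (simp add: algebra_simps)
  moreover have "s * (s * (11 * F)) = 11 * F * (1 - \<rho>\<^sup>2)"
    unfolding s(2)[symmetric] by (simp add: power2_eq_square)
  ultimately show "\<bar>qform d vj M vk + qform d vk M vj - \<rho> * (qform d vj M vj + qform d vk M vk)\<bar> \<le> 11 * F * (1 - \<rho>\<^sup>2)"
    using s by (simp add: abs_mult)
  show "\<bar>qform d vj M vk\<bar> \<le> 2 * F"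
    unfolding mjk using F b[OF rho, of a] b[OF rs(4), of p] by linarith
qed

text \<open>Normalization with noise replaces \<rho> by t \<rho>, where t = \<beta>^2 / (\<beta>^2 +
  e^2). The correction (1 - t) \<rho> (a + b) is at most 2 F (1 - t), and (t \<rho>)^2 <= t turns 1
  - t into 1 - (t \<rho>)^2; this raises 11 to 13.\<close>

lemma pair_bound_regularized:
  fixes A B a b \<rho> t F :: real
  assumes "\<bar>A + B - \<rho> * (a + b)\<bar> \<le> 11 * F * (1 - \<rho>\<^sup>2)" "\<bar>a\<bar> \<le> F" "\<bar>b\<bar> \<le> F" "0 \<le> t" "t \<le> 1" "\<bar>\<rho>\<bar> \<le> 1"
  shows "\<bar>A + B - t * \<rho> * (a + b)\<bar> \<le> 13 * F * (1 - (t * \<rho>)\<^sup>2)"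
proof -
  have F: "0 \<le> F" using assms(2) by linarith
  have r1: "\<rho>\<^sup>2 \<le> 1" using assms(6) by (simp add: abs_square_le_1)
  have t2: "t\<^sup>2 \<le> t" using assms(4,5) by (simp add: power2_eq_square mult_left_le)
  then have t1: "t\<^sup>2 \<le> 1" using assms(5) by linarith
  have tr: "(t * \<rho>)\<^sup>2 \<le> \<rho>\<^sup>2" "(t * \<rho>)\<^sup>2 \<le> t\<^sup>2"
    unfolding power_mult_distrib using mult_right_mono[OF t1, of "\<rho>\<^sup>2"] mult_left_mono[OF r1, of "t\<^sup>2"] by simp_all
  have "A + B - t * \<rho> * (a + b) = (A + B - \<rho> * (a + b)) + (1 - t) * (\<rho> * (a + b))" by (simp add: algebra_simps)
  moreover have "\<bar>(1 - t) * (\<rho> * (a + b))\<bar> \<le> (1 - t) * (1 * (2 * F))"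
    unfolding abs_mult using assms by (intro mult_mono) auto
  moreover have "11 * F * (1 - \<rho>\<^sup>2) \<le> 11 * F * (1 - (t * \<rho>)\<^sup>2)" using F tr by (intro mult_left_mono) auto
  moreover have "(1 - t) * (1 * (2 * F)) \<le> (1 - (t * \<rho>)\<^sup>2) * (1 * (2 * F))" using F tr t2 by (intro mult_right_mono) auto
  ultimately show ?thesis using assms(1) by (simp add: algebra_simps)
qed

section \<open>The interpolation path\<close>

lemma J_partial:
  assumes l: "l < d" and e: "e \<noteq> 0"
  shows "((\<lambda>t. J d v e m \<beta> (\<lambda>i. b i - \<alpha> * dotd d (x(l := t)) (v i))) has_real_derivative
     (\<Sum>k<d. - (\<alpha> * v k l) / e * J d v e (inc m k) \<beta> (\<lambda>i. b i - \<alpha> * dotd d (x(l := t)) (v i)))) (at t)"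
proof -
  have *: "(\<lambda>i. b i - \<alpha> * dotd d (x(l := t)) (v i)) = (\<lambda>i. (b i - \<alpha> * (dotd d x (v i) - x l * v i l)) + t * (- (\<alpha> * v i l)))" for t
    by (rule ext) (simp add: dotd_upd[OF l] algebra_simps)
  show ?thesis unfolding * by (rule J_has_derivative[OF e])
qed

text \<open>A partial derivative of a smoothed probability is a linear combination of functions
  \<open>J\<close> with one index raised. The linear span of all of them is thus closed under
  partial derivatives, which makes an induction over the list of derivatives in
  \<open>smooth_Rd\<close> possible.\<close>

inductive Jspan :: "nat \<Rightarrow> (nat \<Rightarrow> nat \<Rightarrow> real) \<Rightarrow> real \<Rightarrow> real \<Rightarrow> (nat \<Rightarrow> real) \<Rightarrow> real \<Rightarrow> ((nat \<Rightarrow> real) \<Rightarrow> real) \<Rightarrow> bool"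
  for d v e \<beta> b \<alpha> where
  base: "Jspan d v e \<beta> b \<alpha> (\<lambda>x. J d v e m \<beta> (\<lambda>i. b i - \<alpha> * dotd d x (v i)))"
| add: "Jspan d v e \<beta> b \<alpha> f \<Longrightarrow> Jspan d v e \<beta> b \<alpha> g \<Longrightarrow> Jspan d v e \<beta> b \<alpha> (\<lambda>x. f x + g x)"
| scale: "Jspan d v e \<beta> b \<alpha> f \<Longrightarrow> Jspan d v e \<beta> b \<alpha> (\<lambda>x. r * f x)"

lemma Jspan_sum:
  fixes n :: nat
  assumes "\<And>k. k < n \<Longrightarrow> Jspan d v e \<beta> b \<alpha> (f k)"
  shows "Jspan d v e \<beta> b \<alpha> (\<lambda>x. \<Sum>k<n. f k x)"
  using assms
proof (induction n)
  case 0
  have "Jspan d v e \<beta> b \<alpha> (\<lambda>x. 0 * J d v e (\<lambda>_. 0) \<beta> (\<lambda>i. b i - \<alpha> * dotd d x (v i)))"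
    by (intro Jspan.intros)
  then show ?case by simp
qed (auto intro!: Jspan.add)

lemma Jspan_deriv:
  assumes l: "l < d" and e: "e \<noteq> 0"
  shows "Jspan d v e \<beta> b \<alpha> f \<Longrightarrow>
    \<exists>f'. Jspan d v e \<beta> b \<alpha> f' \<and> (\<forall>x t. ((\<lambda>t. f (x(l := t))) has_real_derivative f' (x(l := t))) (at t))"
proof (induction rule: Jspan.induct)
  case (base m)
  have "Jspan d v e \<beta> b \<alpha> (\<lambda>x. \<Sum>k<d. - (\<alpha> * v k l) / e * J d v e (inc m k) \<beta> (\<lambda>i. b i - \<alpha> * dotd d x (v i)))"
    by (intro Jspan_sum Jspan.scale Jspan.base)
  then show ?case using J_partial[OF l e] by (intro exI conjI allI)
next
  case (add f g)
  then obtain f' g' where "Jspan d v e \<beta> b \<alpha> f'" "\<forall>x t. ((\<lambda>t. f (x(l := t))) has_real_derivative f' (x(l := t))) (at t)"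
    "Jspan d v e \<beta> b \<alpha> g'" "\<forall>x t. ((\<lambda>t. g (x(l := t))) has_real_derivative g' (x(l := t))) (at t)" by blast
  then show ?case by (intro exI[of _ "\<lambda>x. f' x + g' x"]) (auto intro!: Jspan.add DERIV_add simp del: fun_upd_apply)
next
  case (scale f r)
  then obtain f' where "Jspan d v e \<beta> b \<alpha> f'" "\<forall>x t. ((\<lambda>t. f (x(l := t))) has_real_derivative f' (x(l := t))) (at t)" by blast
  then show ?case by (intro exI[of _ "\<lambda>x. r * f' x"]) (auto intro!: Jspan.scale DERIV_cmult simp del: fun_upd_apply)
qed

lemma pd_eq:
  assumes "\<And>x t. ((\<lambda>t. f (x(l := t))) has_real_derivative f' (x(l := t))) (at t)"
  shows "pd l f = f'"
proof
  fix x
  show "pd l f x = f' x" unfolding pd_def using DERIV_imp_deriv[OF assms[of x "x l"]] by simp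
qed

lemma Jspan_pd:
  assumes "l < d" "e \<noteq> 0" "Jspan d v e \<beta> b \<alpha> f"
  shows "Jspan d v e \<beta> b \<alpha> (pd l f)"
  using Jspan_deriv[OF assms] pd_eq[of f l] by metis

lemma tendsto_coord:
  fixes y :: "nat \<Rightarrow> nat \<Rightarrow> real"
  assumes "y \<longlonglongrightarrow> a"
  shows "(\<lambda>n. y n i) \<longlonglongrightarrow> a i"
proof -
  have "continuous_on UNIV (\<lambda>x :: nat \<Rightarrow> real. x i)" by (rule continuous_on_product_coordinates)
  then have "isCont (\<lambda>x. x i) a" using continuous_on_eq_continuous_at[OF open_UNIV] by blast
  then show ?thesis using assms by (rule isCont_tendsto_compose)
qed

text \<open>The topology on the points is that of pointwise convergence, so a convergent sequence
  converges in the finitely many coordinates that enter, and \<open>J_tendsto\<close>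
  applies.\<close>

lemma Jspan_continuous:
  assumes e: "e \<noteq> 0"
  shows "Jspan d v e \<beta> b \<alpha> f \<Longrightarrow> continuous_on S f"
proof (induction rule: Jspan.induct)
  case (base m)
  show ?case unfolding continuous_on_sequentially o_def
  proof (intro allI ballI impI J_tendsto e)
    fix y :: "nat \<Rightarrow> nat \<Rightarrow> real" and a i assume "(\<forall>n. y n \<in> S) \<and> y \<longlonglongrightarrow> a" "i < d"
    then show "(\<lambda>n. b i - \<alpha> * dotd d (y n) (v i)) \<longlonglongrightarrow> b i - \<alpha> * dotd d a (v i)"
      unfolding dotd_def by (intro tendsto_intros tendsto_coord) auto
  qed
qed (auto intro!: continuous_intros)

lemma Jspan_ipd:
  assumes "e \<noteq> 0" "Jspan d v e \<beta> b \<alpha> f" "set is \<subseteq> {..<d}"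
  shows "Jspan d v e \<beta> b \<alpha> (ipd is f)"
  using assms(3)
proof (induction "is")
  case Nil then show ?case using assms by (simp add: ipd_def)
next
  case (Cons i "is")
  then have "Jspan d v e \<beta> b \<alpha> (pd i (ipd is f))" using assms by (intro Jspan_pd) auto
  then show ?case by (simp add: ipd_def)
qed

lemma Jspan_smooth:
  assumes "e \<noteq> 0" "Jspan d v e \<beta> b \<alpha> f"
  shows "smooth_Rd d f"
  unfolding smooth_Rd_def
proof (intro allI impI conjI ballI)
  fix "is" assume "is": "set is \<subseteq> {..<d}"
  note ipd = Jspan_ipd[OF assms "is"]
  then show "continuous_on (Rd d) (ipd is f)" by (rule Jspan_continuous[OF assms(1)])
  fix i and x :: "nat \<Rightarrow> real" assume "i < d"
  from Jspan_deriv[OF this assms(1) ipd] obtain f' where "((\<lambda>t. ipd is f (x(i := t))) has_real_derivative f' (x(i := x i))) (at (x i))"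
    by blast
  then show "(\<lambda>t. ipd is f (x(i := t))) differentiable (at (x i))"
    by (auto simp: differentiable_def has_field_derivative_def)
qed

lemma J_measurable:
  assumes e: "e \<noteq> 0" and M: "sets M = sets (PiM {..<d} (\<lambda>_. borel))"
  shows "(\<lambda>x. J d v e m \<beta> (\<lambda>i. b i - \<alpha> * dotd d x (v i))) \<in> borel_measurable M"
proof -
  interpret G: prob_space "std_gauss d" by (rule prob_space_std_gauss)
  note [measurable_cong] = M
  show ?thesis unfolding J_def Jint_def by measurable
qed

section \<open>The Stein identity along the path from the Gaussian to W\<close>

lemma integrable_pair_fst:
  fixes f :: "'a \<Rightarrow> real"
  assumes "prob_space M2" "integrable M1 f"
  shows "integrable (M1 \<Otimes>\<^sub>M M2) (\<lambda>p. f (fst p))"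
proof -
  interpret prob_space M2 by fact
  have "integrable (distr (M1 \<Otimes>\<^sub>M M2) M1 fst) f" using assms(2) by (simp add: distr_pair_fst)
  then show ?thesis by (rule integrable_distr[OF measurable_fst])
qed

lemma integrable_pair_snd:
  fixes f :: "'b \<Rightarrow> real"
  assumes "prob_space M1" "prob_space M2" "integrable M2 f"
  shows "integrable (M1 \<Otimes>\<^sub>M M2) (\<lambda>p. f (snd p))"
proof -
  interpret A: prob_space M1 by fact
  interpret B: prob_space M2 by fact
  interpret pair_sigma_finite M2 M1 ..
  have "integrable (M2 \<Otimes>\<^sub>M M1) (\<lambda>p. f (fst p))" by (rule integrable_pair_fst[OF assms(1,3)])
  from integrable_product_swap[OF this] show ?thesis by (simp add: case_prod_beta')
qed

text \<open>The maximum of the theorem enters only through these three bounds. They are required for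
  antipodal normals as well, which the maximum leaves out and \<open>stein_setup_polytope\<close>
  supplies.\<close>

locale stein_setup =
  fixes d :: nat and \<mu> :: "(nat \<Rightarrow> real) measure" and \<tau> :: "(nat \<Rightarrow> real) \<Rightarrow> nat \<Rightarrow> nat \<Rightarrow> real"
    and v :: "nat \<Rightarrow> nat \<Rightarrow> real" and F :: "(nat \<Rightarrow> real) \<Rightarrow> real"
  assumes d: "3 \<le> d" and prob: "prob_space \<mu>" and sets_mu: "sets \<mu> = sets (PiM {..<d} (\<lambda>_. borel))"
    and int_coord: "\<And>i. i < d \<Longrightarrow> integrable \<mu> (\<lambda>x. x i)"
    and stein: "stein_kernel d \<mu> \<tau>"
    and unit: "\<And>i. i < d \<Longrightarrow> dotd d (v i) (v i) = 1"
    and int_F: "integrable \<mu> F"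
    and m_diag: "\<And>x j. j < d \<Longrightarrow> \<bar>qform d (v j) (\<lambda>i l. \<tau> x i l - (if i = l then 1 else 0)) (v j)\<bar> \<le> F x"
    and m_off: "\<And>x j k. j < d \<Longrightarrow> k < d \<Longrightarrow> \<bar>qform d (v j) (\<lambda>i l. \<tau> x i l - (if i = l then 1 else 0)) (v k)\<bar> \<le> 2 * F x"
    and m_pair: "\<And>x j k. j < d \<Longrightarrow> k < d \<Longrightarrow> j \<noteq> k \<Longrightarrow>
      \<bar>qform d (v j) (\<lambda>i l. \<tau> x i l - (if i = l then 1 else 0)) (v k) + qform d (v k) (\<lambda>i l. \<tau> x i l - (if i = l then 1 else 0)) (v j)
        - dotd d (v j) (v k) * (qform d (v j) (\<lambda>i l. \<tau> x i l - (if i = l then 1 else 0)) (v j) + qform d (v k) (\<lambda>i l. \<tau> x i l - (if i = l then 1 else 0)) (v k))\<bar>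
        \<le> 11 * F x * (1 - (dotd d (v j) (v k))\<^sup>2)"
begin

definition M :: "(nat \<Rightarrow> real) \<Rightarrow> nat \<Rightarrow> nat \<Rightarrow> real" where
  "M x i l = \<tau> x i l - (if i = l then 1 else 0)"

definition mm :: "(nat \<Rightarrow> real) \<Rightarrow> nat \<Rightarrow> nat \<Rightarrow> real" where
  "mm x j k = qform d (v j) (M x) (v k)"

lemma F_nonneg: "0 \<le> F x"
  using m_diag[of 0 x] d by (intro order_trans[OF abs_ge_zero]) auto

lemma M_eq: "M x = (\<lambda>i l. \<tau> x i l - (if i = l then 1 else 0))"
  by (intro ext) (simp add: M_def)

lemma mm_bound:
  assumes e: "0 < e"
  shows "\<bar>\<Sum>j<d. \<Sum>k<d. mm x j k * J d v e (e2 j k) \<beta> y\<bar>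
    \<le> e\<^sup>2 / (\<beta>\<^sup>2 + e\<^sup>2) * ((6 * exp (3 / 2) + 5 * 13 * exp 4) * F x * ln (real d))"
proof (rule key_bound[OF d e unit F_nonneg])
  fix j k assume jk: "j < d" "k < d" "j \<noteq> k"
  have "0 < \<beta>\<^sup>2 + e\<^sup>2" using e by (intro add_nonneg_pos) auto
  then have "0 \<le> \<beta>\<^sup>2 / (\<beta>\<^sup>2 + e\<^sup>2)" "\<beta>\<^sup>2 / (\<beta>\<^sup>2 + e\<^sup>2) \<le> 1" by (auto simp: divide_le_eq)
  then show "\<bar>mm x j k + mm x k j - \<beta>\<^sup>2 / (\<beta>\<^sup>2 + e\<^sup>2) * dotd d (v j) (v k) * (mm x j j + mm x k k)\<bar>
    \<le> 13 * F x * (1 - (\<beta>\<^sup>2 / (\<beta>\<^sup>2 + e\<^sup>2) * dotd d (v j) (v k))\<^sup>2)"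
    unfolding mm_def M_eq
    by (intro pair_bound_regularized[OF m_pair[OF jk] m_diag[OF jk(1)] m_diag[OF jk(2)] _ _ dotd_unit_bound[OF unit[OF jk(1)] unit[OF jk(2)]]])
next
  show "\<bar>mm x j j\<bar> \<le> F x" if "j < d" for j
    unfolding mm_def M_eq by (rule m_diag[OF that])
qed simp_all

lemma mm_measurable: "(\<lambda>x. mm x j k) \<in> borel_measurable \<mu>"
proof -
  have "(\<lambda>x. \<tau> x i l) \<in> borel_measurable \<mu>" if "i < d" "l < d" for i l
    using stein that unfolding stein_kernel_def by blast
  then show ?thesis unfolding mm_def qform_def M_def
    by (intro borel_measurable_sum borel_measurable_times borel_measurable_diff borel_measurable_const) auto
qed

lemma qform_tau: "qform d (v j) (\<tau> x) (v k) = mm x j k + dotd d (v j) (v k)"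
proof -
  have "qform d (v j) (\<tau> x) (v k) = mm x j k + (\<Sum>i<d. \<Sum>l<d. v j i * (if i = l then 1 else 0) * v k l)"
    unfolding mm_def qform_def M_def sum.distrib[symmetric] by (intro sum.cong refl) (simp add: algebra_simps)
  also have "(\<Sum>i<d. \<Sum>l<d. v j i * (if i = l then 1 else 0) * v k l) = dotd d (v j) (v k)"
    unfolding dotd_def by (intro sum.cong refl) (simp add: if_distrib[of "\<lambda>x. _ * x"] if_distrib[of "\<lambda>x. x * _"] cong: if_cong)
  finally show ?thesis .
qed

lemma integrable_bounded_mult:
  fixes f g :: "(nat \<Rightarrow> real) \<Rightarrow> real"
  assumes f: "integrable \<mu> f" and g: "g \<in> borel_measurable \<mu>" and B: "\<And>x. \<bar>g x\<bar> \<le> B"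
  shows "integrable \<mu> (\<lambda>x. f x * g x)"
proof (rule Bochner_Integration.integrable_bound[of _ "\<lambda>x. B * f x"])
  show "AE x in \<mu>. norm (f x * g x) \<le> norm (B * f x)"
  proof (rule AE_I2)
    fix x have "\<bar>f x\<bar> * \<bar>g x\<bar> \<le> \<bar>f x\<bar> * \<bar>B\<bar>" using B[of x] by (intro mult_left_mono) auto
    then show "norm (f x * g x) \<le> norm (B * f x)" by (simp add: abs_mult mult_ac)
  qed
qed (use f g in auto)

lemma integrable_mm: "j < d \<Longrightarrow> k < d \<Longrightarrow> integrable \<mu> (\<lambda>x. mm x j k)"
proof (rule Bochner_Integration.integrable_bound[of _ "\<lambda>x. 2 * F x"])
  assume "j < d" "k < d"
  then show "AE x in \<mu>. norm (mm x j k) \<le> norm (2 * F x)"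
    using m_off F_nonneg unfolding mm_def M_eq by (intro AE_I2) auto
qed (use int_F mm_measurable in auto)

lemma integrable_dotd_mu: "integrable \<mu> (\<lambda>x. dotd d x w)"
  unfolding dotd_def by (intro Bochner_Integration.integrable_sum integrable_mult_left int_coord) auto

text \<open>The Stein identity for the test function P (s V x + \<beta> V Z + e n <= b) of x. Its
  two sides carry the factors - s / e and (s / e)^2; cancelling one factor excludes s = 0, the start
  of the path.\<close>

lemma stein_J:
  fixes e s \<beta> :: real and b :: "nat \<Rightarrow> real"
  assumes e: "e \<noteq> 0" and s: "s \<noteq> 0"
  defines "Y \<equiv> \<lambda>x i. b i - s * dotd d x (v i)"
  shows "(\<integral>x. (\<Sum>k<d. dotd d x (v k) * J d v e (e1 k) \<beta> (Y x)) \<partial>\<mu>)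
    = - (s / e) * (\<integral>x. (\<Sum>j<d. \<Sum>k<d. (mm x j k + dotd d (v j) (v k)) * J d v e (e2 j k) \<beta> (Y x)) \<partial>\<mu>)"
proof -
  let ?f = "\<lambda>x. J d v e (\<lambda>_. 0) \<beta> (\<lambda>i. b i - s * dotd d x (v i))"
  have p1: "pd i ?f = (\<lambda>x. \<Sum>k<d. - (s * v k i) / e * J d v e (e1 k) \<beta> (\<lambda>i. b i - s * dotd d x (v i)))" if "i < d" for i
    by (rule pd_eq, rule J_partial[OF that e])
  have p2: "pd i (pd j ?f) = (\<lambda>x. \<Sum>k<d. - (s * v k j) / e * (\<Sum>l<d. - (s * v l i) / e * J d v e (e2 k l) \<beta> (\<lambda>i. b i - s * dotd d x (v i))))"
    if ij: "i < d" "j < d" for i j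
    unfolding p1[OF ij(2)]
    by (rule pd_eq, rule DERIV_sum, rule DERIV_cmult, rule J_partial[OF ij(1) e])
  have Jm: "(\<lambda>x. J d v e m \<beta> (Y x)) \<in> borel_measurable \<mu>" for m
    unfolding Y_def by (rule J_measurable[OF e sets_mu])
  have l: "(\<Sum>i<d. x i * pd i ?f x) = - (s / e) * (\<Sum>k<d. dotd d x (v k) * J d v e (e1 k) \<beta> (Y x))" for x
  proof -
    have "(\<Sum>i<d. x i * pd i ?f x) = (\<Sum>i<d. \<Sum>k<d. - (s / e) * (x i * v k i * J d v e (e1 k) \<beta> (Y x)))"
      by (intro sum.cong refl) (simp add: p1 Y_def sum_distrib_left mult_ac del: fun_upd_apply)
    also have "\<dots> = - (s / e) * (\<Sum>k<d. dotd d x (v k) * J d v e (e1 k) \<beta> (Y x))"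
      unfolding dotd_def by (subst sum.swap) (simp add: sum_distrib_left sum_distrib_right mult_ac del: fun_upd_apply)
    finally show ?thesis .
  qed
  have r: "(\<Sum>i<d. \<Sum>j<d. \<tau> x i j * pd i (pd j ?f) x)
    = (s / e)\<^sup>2 * (\<Sum>j<d. \<Sum>k<d. (mm x j k + dotd d (v j) (v k)) * J d v e (e2 j k) \<beta> (Y x))" for x
  proof -
    have "(\<Sum>i<d. \<Sum>j<d. \<tau> x i j * pd i (pd j ?f) x)
      = (\<Sum>i<d. \<Sum>j<d. \<Sum>k<d. \<Sum>l<d. (s / e)\<^sup>2 * (v l i * \<tau> x i j * v k j * J d v e (e2 l k) \<beta> (Y x)))"
    proof (intro sum.cong refl)
      fix i j assume "i \<in> {..<d}" "j \<in> {..<d}"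
      then have "\<tau> x i j * pd i (pd j ?f) x = \<tau> x i j * (\<Sum>k<d. - (s * v k j) / e * (\<Sum>l<d. - (s * v l i) / e * J d v e (e2 k l) \<beta> (Y x)))"
        by (simp add: p2 Y_def del: fun_upd_apply)
      also have "\<dots> = (\<Sum>k<d. \<Sum>l<d. (s / e)\<^sup>2 * (v l i * \<tau> x i j * v k j * J d v e (e2 l k) \<beta> (Y x)))"
        unfolding sum_distrib_left
      proof (intro sum.cong refl)
        fix k l
        have "e2 k l = e2 l k" by (cases "k = l") (auto simp: fun_upd_twist)
        then show "\<tau> x i j * (- (s * v k j) / e * (- (s * v l i) / e * J d v e (e2 k l) \<beta> (Y x)))
          = (s / e)\<^sup>2 * (v l i * \<tau> x i j * v k j * J d v e (e2 l k) \<beta> (Y x))"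
          by (simp add: power2_eq_square del: fun_upd_apply)
      qed
      finally show "\<tau> x i j * pd i (pd j ?f) x = (\<Sum>k<d. \<Sum>l<d. (s / e)\<^sup>2 * (v l i * \<tau> x i j * v k j * J d v e (e2 l k) \<beta> (Y x)))" .
    qed
    also have "\<dots> = (\<Sum>l<d. \<Sum>k<d. \<Sum>i<d. \<Sum>j<d. (s / e)\<^sup>2 * (v l i * \<tau> x i j * v k j * J d v e (e2 l k) \<beta> (Y x)))"
    proof -
      have sw: "(\<Sum>i\<in>A. \<Sum>j\<in>A. \<Sum>k\<in>A. \<Sum>l\<in>A. g i j k l) = (\<Sum>l\<in>A. \<Sum>k\<in>A. \<Sum>i\<in>A. \<Sum>j\<in>A. g i j k l)"
        for g :: "nat \<Rightarrow> nat \<Rightarrow> nat \<Rightarrow> nat \<Rightarrow> real" and A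
      proof -
        have "(\<Sum>i\<in>A. \<Sum>j\<in>A. \<Sum>k\<in>A. \<Sum>l\<in>A. g i j k l) = (\<Sum>i\<in>A. \<Sum>k\<in>A. \<Sum>j\<in>A. \<Sum>l\<in>A. g i j k l)"
          by (intro sum.cong refl sum.swap)
        also have "\<dots> = (\<Sum>k\<in>A. \<Sum>i\<in>A. \<Sum>l\<in>A. \<Sum>j\<in>A. g i j k l)"
          by (subst sum.swap) (intro sum.cong refl sum.swap)
        also have "\<dots> = (\<Sum>k\<in>A. \<Sum>l\<in>A. \<Sum>i\<in>A. \<Sum>j\<in>A. g i j k l)"
          by (intro sum.cong refl sum.swap)
        finally show ?thesis by (subst sum.swap)
      qed
      show ?thesis by (rule sw)
    qed
    also have "\<dots> = (\<Sum>l<d. \<Sum>k<d. (s / e)\<^sup>2 * (qform d (v l) (\<tau> x) (v k) * J d v e (e2 l k) \<beta> (Y x)))"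
      unfolding qform_def by (simp add: sum_distrib_left sum_distrib_right del: fun_upd_apply)
    finally show ?thesis unfolding qform_tau by (simp only: sum_distrib_left)
  qed
  have i1: "integrable \<mu> (\<lambda>x. \<Sum>k<d. dotd d x (v k) * J d v e (e1 k) \<beta> (Y x))"
    by (intro Bochner_Integration.integrable_sum integrable_bounded_mult[OF integrable_dotd_mu Jm J_bound])
  have i2: "integrable \<mu> (\<lambda>x. \<Sum>j<d. \<Sum>k<d. (mm x j k + dotd d (v j) (v k)) * J d v e (e2 j k) \<beta> (Y x))"
  proof -
    interpret prob_space \<mu> by (rule prob)
    show ?thesis
      by (intro Bochner_Integration.integrable_sum integrable_bounded_mult[OF _ Jm J_bound] Bochner_Integration.integrable_add integrable_mm) auto
  qed
  have sm: "smooth_Rd d ?f" by (rule Jspan_smooth[OF e Jspan.base])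
  have "integrable \<mu> (\<lambda>x. \<Sum>i<d. x i * pd i ?f x)" unfolding l by (intro integrable_mult_right i1)
  moreover have "integrable \<mu> (\<lambda>x. \<Sum>i<d. \<Sum>j<d. \<tau> x i j * pd i (pd j ?f) x)" unfolding r by (intro integrable_mult_right i2)
  ultimately have "(\<integral>x. (\<Sum>i<d. x i * pd i ?f x) \<partial>\<mu>) = (\<integral>x. (\<Sum>i<d. \<Sum>j<d. \<tau> x i j * pd i (pd j ?f) x) \<partial>\<mu>)"
    using stein sm unfolding stein_kernel_def by blast
  then have eq: "- (s / e) * (\<integral>x. (\<Sum>k<d. dotd d x (v k) * J d v e (e1 k) \<beta> (Y x)) \<partial>\<mu>)
    = (s / e)\<^sup>2 * (\<integral>x. (\<Sum>j<d. \<Sum>k<d. (mm x j k + dotd d (v j) (v k)) * J d v e (e2 j k) \<beta> (Y x)) \<partial>\<mu>)"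
    unfolding l r by simp
  have gen: "X = - q * X'" if "- q * X = q\<^sup>2 * X'" "q \<noteq> 0" for X X' q :: real
  proof -
    have "q * X = q * (- q * X')" using that(1) by (simp add: power2_eq_square algebra_simps)
    then show ?thesis by (simp only: mult_left_cancel[OF that(2)])
  qed
  show ?thesis by (rule gen[OF eq]) (use e s in simp)
qed

text \<open>This is P (V (sin \<theta> W + cos \<theta> Z) + e n <= b), with W and Z independent and
  the noise already integrated out.\<close>

definition G :: "real \<Rightarrow> (nat \<Rightarrow> real) \<Rightarrow> real \<Rightarrow> real" where
  "G e b \<theta> = (\<integral>p. Jint d v e (\<lambda>_. 0) (cos \<theta>) (\<lambda>i. b i - sin \<theta> * dotd d (fst p) (v i)) (snd p) \<partial>(\<mu> \<Otimes>\<^sub>M std_gauss d))"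

lemma Jint_pair_measurable:
  "(\<lambda>p. Jint d v e m \<beta> (\<lambda>i. b i - s * dotd d (fst p) (v i)) (snd p)) \<in> borel_measurable (\<mu> \<Otimes>\<^sub>M std_gauss d)"
proof -
  note [measurable_cong] = sets_mu
  show ?thesis unfolding Jint_def by measurable
qed

lemma integrable_pair_bounded_mult:
  fixes f :: "(nat \<Rightarrow> real) \<times> (nat \<Rightarrow> real) \<Rightarrow> real"
  assumes f: "integrable (\<mu> \<Otimes>\<^sub>M std_gauss d) f"
  shows "integrable (\<mu> \<Otimes>\<^sub>M std_gauss d) (\<lambda>p. f p * Jint d v e m \<beta> (\<lambda>i. b i - s * dotd d (fst p) (v i)) (snd p))"
proof (rule Bochner_Integration.integrable_bound[of _ "\<lambda>p. JB d m * f p"])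
  show "AE p in \<mu> \<Otimes>\<^sub>M std_gauss d. norm (f p * Jint d v e m \<beta> (\<lambda>i. b i - s * dotd d (fst p) (v i)) (snd p)) \<le> norm (JB d m * f p)"
  proof (rule AE_I2)
    fix p
    have "\<bar>f p\<bar> * \<bar>Jint d v e m \<beta> (\<lambda>i. b i - s * dotd d (fst p) (v i)) (snd p)\<bar> \<le> \<bar>f p\<bar> * \<bar>JB d m\<bar>"
      by (intro mult_left_mono order_trans[OF Jint_bound]) auto
    then show "norm (f p * Jint d v e m \<beta> (\<lambda>i. b i - s * dotd d (fst p) (v i)) (snd p)) \<le> norm (JB d m * f p)"
      by (simp add: abs_mult mult_ac)
  qed
  show "(\<lambda>p. f p * Jint d v e m \<beta> (\<lambda>i. b i - s * dotd d (fst p) (v i)) (snd p)) \<in> borel_measurable (\<mu> \<Otimes>\<^sub>M std_gauss d)"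
    by (intro borel_measurable_times Jint_pair_measurable borel_measurable_integrable[OF f])
qed (use f in simp)

lemma integrable_pair_dotd:
  "integrable (\<mu> \<Otimes>\<^sub>M std_gauss d) (\<lambda>p. dotd d (fst p) w)"
  "integrable (\<mu> \<Otimes>\<^sub>M std_gauss d) (\<lambda>p. dotd d (snd p) w)"
  using integrable_pair_fst[OF prob_space_std_gauss integrable_dotd_mu]
    integrable_pair_snd[OF prob prob_space_std_gauss integrable_dotd] by auto

lemma integrable_pair_Jint:
  "integrable (\<mu> \<Otimes>\<^sub>M std_gauss d) (\<lambda>p. Jint d v e m \<beta> (\<lambda>i. b i - s * dotd d (fst p) (v i)) (snd p))"
proof -
  interpret A: prob_space \<mu> by (rule prob)
  interpret B: prob_space "std_gauss d" by (rule prob_space_std_gauss)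
  interpret pair_prob_space \<mu> "std_gauss d" ..
  show ?thesis using integrable_pair_bounded_mult[of "\<lambda>_. 1"] by simp
qed

text \<open>The chain rule brings down V W and V Z linearly, so the first moments of W and Z give a
  dominating function that is uniform in \<theta>.\<close>

lemma G_has_derivative:
  assumes e: "e \<noteq> 0"
  shows "(G e b has_real_derivative
    (\<integral>p. (\<Sum>k<d. (- cos \<theta> * dotd d (fst p) (v k) + sin \<theta> * dotd d (snd p) (v k)) / e *
        Jint d v e (e1 k) (cos \<theta>) (\<lambda>i. b i - sin \<theta> * dotd d (fst p) (v i)) (snd p)) \<partial>(\<mu> \<Otimes>\<^sub>M std_gauss d))) (at \<theta>)"
  unfolding G_def[abs_def]
proof (rule has_real_derivative_integral[where w = "\<lambda>p. \<Sum>k<d. (\<bar>dotd d (fst p) (v k)\<bar> + \<bar>dotd d (snd p) (v k)\<bar>) / \<bar>e\<bar> * JB d (e1 k)"])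
  fix \<theta> and p :: "(nat \<Rightarrow> real) \<times> (nat \<Rightarrow> real)"
  show "((\<lambda>\<theta>. Jint d v e (\<lambda>_. 0) (cos \<theta>) (\<lambda>i. b i - sin \<theta> * dotd d (fst p) (v i)) (snd p)) has_real_derivative
    (\<Sum>k<d. (- cos \<theta> * dotd d (fst p) (v k) + sin \<theta> * dotd d (snd p) (v k)) / e *
        Jint d v e (e1 k) (cos \<theta>) (\<lambda>i. b i - sin \<theta> * dotd d (fst p) (v i)) (snd p))) (at \<theta>)"
    by (rule Jint_has_derivative) (use e in \<open>auto intro!: derivative_eq_intros\<close>)
  have b: "\<bar>- cos \<theta> * x + sin \<theta> * z\<bar> \<le> \<bar>x\<bar> + \<bar>z\<bar>" for x z :: real
  proof -
    have "\<bar>cos \<theta>\<bar> * \<bar>x\<bar> \<le> 1 * \<bar>x\<bar>" "\<bar>sin \<theta>\<bar> * \<bar>z\<bar> \<le> 1 * \<bar>z\<bar>" by (intro mult_right_mono; simp)+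
    moreover have "\<bar>- cos \<theta> * x + sin \<theta> * z\<bar> \<le> \<bar>cos \<theta>\<bar> * \<bar>x\<bar> + \<bar>sin \<theta>\<bar> * \<bar>z\<bar>"
      unfolding abs_mult[symmetric] by linarith
    ultimately show ?thesis by linarith
  qed
  show "\<bar>\<Sum>k<d. (- cos \<theta> * dotd d (fst p) (v k) + sin \<theta> * dotd d (snd p) (v k)) / e *
        Jint d v e (e1 k) (cos \<theta>) (\<lambda>i. b i - sin \<theta> * dotd d (fst p) (v i)) (snd p)\<bar>
    \<le> (\<Sum>k<d. (\<bar>dotd d (fst p) (v k)\<bar> + \<bar>dotd d (snd p) (v k)\<bar>) / \<bar>e\<bar> * JB d (e1 k))"
    by (rule order_trans[OF sum_abs], rule sum_mono)
       (simp only: abs_mult abs_divide, intro mult_mono divide_right_mono b Jint_bound JB_nonneg, auto)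
next
  show "integrable (\<mu> \<Otimes>\<^sub>M std_gauss d) (\<lambda>p. Jint d v e (\<lambda>_. 0) (cos \<theta>) (\<lambda>i. b i - sin \<theta> * dotd d (fst p) (v i)) (snd p))" for \<theta>
    by (rule integrable_pair_Jint)
  show "integrable (\<mu> \<Otimes>\<^sub>M std_gauss d) (\<lambda>p. \<Sum>k<d. (\<bar>dotd d (fst p) (v k)\<bar> + \<bar>dotd d (snd p) (v k)\<bar>) / \<bar>e\<bar> * JB d (e1 k))"
    by (intro Bochner_Integration.integrable_sum integrable_mult_left integrable_divide Bochner_Integration.integrable_add integrable_abs integrable_pair_dotd)
  have "integrable (\<mu> \<Otimes>\<^sub>M std_gauss d) (\<lambda>p. \<Sum>k<d. (- cos \<theta> * dotd d (fst p) (v k) + sin \<theta> * dotd d (snd p) (v k)) / e *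
        Jint d v e (e1 k) (cos \<theta>) (\<lambda>i. b i - sin \<theta> * dotd d (fst p) (v i)) (snd p))"
    by (intro Bochner_Integration.integrable_sum integrable_pair_bounded_mult integrable_divide Bochner_Integration.integrable_add integrable_mult_right integrable_pair_dotd)
  then show "(\<lambda>p. \<Sum>k<d. (- cos \<theta> * dotd d (fst p) (v k) + sin \<theta> * dotd d (snd p) (v k)) / e *
        Jint d v e (e1 k) (cos \<theta>) (\<lambda>i. b i - sin \<theta> * dotd d (fst p) (v i)) (snd p)) \<in> borel_measurable (\<mu> \<Otimes>\<^sub>M std_gauss d)"
    by (rule borel_measurable_integrable)
qed

text \<open>The part with V Z, integrated by parts, gives - sin cos / e^2 times the sum with
  coefficients <v_j, v_k>. The part with V W, by the Stein identity, gives the same with <v_j,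
  \<tau> v_k> and the opposite sign. As \<tau> = M + I, only M is left.\<close>

lemma G_derivative_value:
  fixes e \<theta> :: real and b :: "nat \<Rightarrow> real"
  assumes e: "e \<noteq> 0" and s: "sin \<theta> \<noteq> 0"
  defines "Y \<equiv> \<lambda>x i. b i - sin \<theta> * dotd d x (v i)"
  shows "(\<integral>p. (\<Sum>k<d. (- cos \<theta> * dotd d (fst p) (v k) + sin \<theta> * dotd d (snd p) (v k)) / e *
        Jint d v e (e1 k) (cos \<theta>) (Y (fst p)) (snd p)) \<partial>(\<mu> \<Otimes>\<^sub>M std_gauss d))
    = sin \<theta> * cos \<theta> / e\<^sup>2 * (\<integral>x. (\<Sum>j<d. \<Sum>k<d. mm x j k * J d v e (e2 j k) (cos \<theta>) (Y x)) \<partial>\<mu>)"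
proof -
  interpret A: prob_space \<mu> by (rule prob)
  interpret B: prob_space "std_gauss d" by (rule prob_space_std_gauss)
  interpret pair_sigma_finite \<mu> "std_gauss d" ..
  let ?c = "cos \<theta>" and ?s = "sin \<theta>"
  let ?T = "\<lambda>x. \<Sum>j<d. \<Sum>k<d. dotd d (v j) (v k) * J d v e (e2 j k) ?c (Y x)"
  let ?X = "\<lambda>x. \<Sum>k<d. dotd d x (v k) * J d v e (e1 k) ?c (Y x)"
  let ?M = "\<lambda>x. \<Sum>j<d. \<Sum>k<d. mm x j k * J d v e (e2 j k) ?c (Y x)"
  have Jm: "(\<lambda>x. J d v e m ?c (Y x)) \<in> borel_measurable \<mu>" for m
    unfolding Y_def by (rule J_measurable[OF e sets_mu])
  let ?f = "\<lambda>p. \<Sum>k<d. (- ?c * dotd d (fst p) (v k) + ?s * dotd d (snd p) (v k)) / e * Jint d v e (e1 k) ?c (Y (fst p)) (snd p)"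
  have int: "integrable (\<mu> \<Otimes>\<^sub>M std_gauss d) ?f"
    unfolding Y_def
    by (intro Bochner_Integration.integrable_sum integrable_pair_bounded_mult integrable_divide Bochner_Integration.integrable_add integrable_mult_right integrable_pair_dotd)
  have inner: "(\<integral>z. ?f (x, z) \<partial>std_gauss d) = - (?c / e) * ?X x + - (?s * ?c / e\<^sup>2) * ?T x" for x
  proof -
    have "(\<integral>z. ?f (x, z) \<partial>std_gauss d)
      = (\<integral>z. (\<Sum>k<d. (- ?c / e * dotd d x (v k)) * Jint d v e (e1 k) ?c (Y x) z + ?s / e * (dotd d z (v k) * Jint d v e (e1 k) ?c (Y x) z)) \<partial>std_gauss d)"
      by (intro Bochner_Integration.integral_cong sum.cong refl)
         (simp add: add_divide_distrib diff_divide_distrib left_diff_distrib distrib_right mult.assoc del: fun_upd_apply)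
    also have "\<dots> = (\<Sum>k<d. (- ?c / e * dotd d x (v k)) * J d v e (e1 k) ?c (Y x) + ?s / e * (\<integral>z. dotd d z (v k) * Jint d v e (e1 k) ?c (Y x) z \<partial>std_gauss d))"
      unfolding J_def
      by (subst Bochner_Integration.integral_sum, intro Bochner_Integration.integrable_add integrable_mult_right integrable_Jint integrable_dotd_Jint)
         (intro sum.cong refl, subst Bochner_Integration.integral_add, auto intro!: integrable_mult_right integrable_Jint integrable_dotd_Jint simp del: fun_upd_apply)
    also have "\<dots> = - (?c / e) * ?X x + - (?s * ?c / e\<^sup>2) * ?T x"
      unfolding J_ibp[OF e] by (simp add: sum.distrib sum_distrib_left sum_negf sum_subtractf power2_eq_square mult_ac del: fun_upd_apply)
    finally show ?thesis .
  qed
  have i1: "integrable \<mu> ?X"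
    by (intro Bochner_Integration.integrable_sum integrable_bounded_mult[OF integrable_dotd_mu Jm J_bound])
  have i2: "integrable \<mu> ?T"
    by (intro Bochner_Integration.integrable_sum integrable_bounded_mult[OF _ Jm J_bound]) auto
  have i3: "integrable \<mu> ?M"
    by (intro Bochner_Integration.integrable_sum integrable_bounded_mult[OF _ Jm J_bound] integrable_mm) auto
  have st: "(\<integral>x. ?X x \<partial>\<mu>) = - (?s / e) * ((\<integral>x. ?M x \<partial>\<mu>) + (\<integral>x. ?T x \<partial>\<mu>))"
  proof -
    have "(\<integral>x. ?X x \<partial>\<mu>) = - (?s / e) * (\<integral>x. ?M x + ?T x \<partial>\<mu>)"
      using stein_J[OF e s, of ?c b] unfolding Y_def by (simp add: distrib_right sum.distrib del: fun_upd_apply)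
    then show ?thesis using i2 i3 by simp
  qed
  have "(\<integral>p. ?f p \<partial>(\<mu> \<Otimes>\<^sub>M std_gauss d)) = (\<integral>x. \<integral>z. ?f (x, z) \<partial>std_gauss d \<partial>\<mu>)"
    by (rule integral_fst'[OF int, symmetric])
  also have "\<dots> = - (?c / e) * (\<integral>x. ?X x \<partial>\<mu>) + - (?s * ?c / e\<^sup>2) * (\<integral>x. ?T x \<partial>\<mu>)"
    unfolding inner using i1 i2 by (simp del: fun_upd_apply)
  also have "\<dots> = ?s * ?c / e\<^sup>2 * (\<integral>x. ?M x \<partial>\<mu>)"
    unfolding st by (simp add: power2_eq_square algebra_simps del: fun_upd_apply)
  finally show ?thesis .
qed

text \<open>The constant of \<open>key_bound\<close> for K = 13, the value supplied by
  \<open>pair_bound_regularized\<close>.\<close>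

definition KC :: real where "KC = 6 * exp (3 / 2) + 5 * 13 * exp 4"

lemma G_derivative_bound:
  assumes e: "0 < e" and \<theta>: "0 < \<theta>" "\<theta> < pi / 2"
  obtains D where "(G e b has_real_derivative D) (at \<theta>)"
    and "\<bar>D\<bar> \<le> KC * (\<integral>x. F x \<partial>\<mu>) * ln (real d) * (sin \<theta> * cos \<theta> / ((cos \<theta>)\<^sup>2 + e\<^sup>2))"
proof -
  let ?c = "cos \<theta>" and ?s = "sin \<theta>"
  have s: "0 < ?s" using \<theta> by (intro sin_gt_zero) auto
  have c: "0 < ?c" using \<theta> by (intro cos_gt_zero) auto
  have e0: "e \<noteq> 0" using e by simp
  let ?M = "\<lambda>x. \<Sum>j<d. \<Sum>k<d. mm x j k * J d v e (e2 j k) ?c (\<lambda>i. b i - ?s * dotd d x (v i))"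
  let ?C = "e\<^sup>2 / (?c\<^sup>2 + e\<^sup>2) * (KC * ln (real d))"
  have b: "\<bar>?M x\<bar> \<le> ?C * F x" for x
    using mm_bound[OF e, of x ?c] unfolding KC_def by (simp add: mult_ac del: fun_upd_apply)
  have "\<bar>\<integral>x. ?M x \<partial>\<mu>\<bar> \<le> (\<integral>x. ?C * F x \<partial>\<mu>)"
  proof (rule order_trans[OF integral_abs_bound], rule integral_mono')
    show "integrable \<mu> (\<lambda>x. ?C * F x)" by (intro integrable_mult_right int_F)
  qed (use b order_trans[OF abs_ge_zero b] in auto)
  then have "\<bar>\<integral>x. ?M x \<partial>\<mu>\<bar> \<le> ?C * (\<integral>x. F x \<partial>\<mu>)" by simp
  then have "?s * ?c / e\<^sup>2 * \<bar>\<integral>x. ?M x \<partial>\<mu>\<bar> \<le> ?s * ?c / e\<^sup>2 * (?C * (\<integral>x. F x \<partial>\<mu>))"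
    using s c by (intro mult_left_mono) auto
  also have "\<dots> = KC * (\<integral>x. F x \<partial>\<mu>) * ln (real d) * (?s * ?c / (?c\<^sup>2 + e\<^sup>2))"
    using e by simp
  finally have "\<bar>?s * ?c / e\<^sup>2 * (\<integral>x. ?M x \<partial>\<mu>)\<bar> \<le> KC * (\<integral>x. F x \<partial>\<mu>) * ln (real d) * (?s * ?c / (?c\<^sup>2 + e\<^sup>2))"
    using s c by (simp add: abs_mult)
  moreover have "(G e b has_real_derivative (?s * ?c / e\<^sup>2 * (\<integral>x. ?M x \<partial>\<mu>))) (at \<theta>)"
    using G_has_derivative[OF e0, of b \<theta>] G_derivative_value[OF e0, of \<theta> b] s by simp
  ultimately show ?thesis using that by blast
qed

text \<open>H is an antiderivative of the bound on |G'|, so H + G and H - G are nondecreasing. The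
  bound is available on the open quarter circle; continuity takes care of the end points.\<close>

lemma G_diff_bound:
  assumes e: "0 < e"
  shows "\<bar>G e b (pi / 2) - G e b 0\<bar> \<le> KC * (\<integral>x. F x \<partial>\<mu>) * ln (real d) * (ln ((1 + e\<^sup>2) / e\<^sup>2) / 2)"
proof -
  let ?K = "KC * (\<integral>x. F x \<partial>\<mu>) * ln (real d)"
  define H where "H \<theta> = - (?K / 2) * ln ((cos \<theta>)\<^sup>2 + e\<^sup>2)" for \<theta>
  have pos: "0 < (cos \<theta>)\<^sup>2 + e\<^sup>2" for \<theta> using e by (intro add_nonneg_pos) auto
  have H: "(H has_real_derivative ?K * (sin \<theta> * cos \<theta> / ((cos \<theta>)\<^sup>2 + e\<^sup>2))) (at \<theta>)" for \<theta>
  proof -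
    have "((\<lambda>\<theta>. ln ((cos \<theta>)\<^sup>2 + e\<^sup>2)) has_real_derivative - 2 * (sin \<theta> * cos \<theta>) / ((cos \<theta>)\<^sup>2 + e\<^sup>2)) (at \<theta>)"
      using pos[of \<theta>] by (auto intro!: derivative_eq_intros simp: mult_ac)
    from DERIV_cmult[OF this, of "- (?K / 2)"] show ?thesis unfolding H_def by (simp add: mult_ac)
  qed
  have e0: "e \<noteq> 0" using e by simp
  have cG: "continuous_on A (G e b)" for A
    by (intro continuous_at_imp_continuous_on ballI DERIV_isCont[OF G_has_derivative[OF e0]])
  have cH: "continuous_on A H" for A
    by (intro continuous_at_imp_continuous_on ballI DERIV_isCont[OF H])
  have "H 0 + G e b 0 \<le> H (pi / 2) + G e b (pi / 2)"
  proof (rule DERIV_nonneg_imp_increasing_open[where f = "\<lambda>\<theta>. H \<theta> + G e b \<theta>"])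
    fix \<theta> :: real assume "0 < \<theta>" "\<theta> < pi / 2"
    then obtain D where D: "(G e b has_real_derivative D) (at \<theta>)" "\<bar>D\<bar> \<le> ?K * (sin \<theta> * cos \<theta> / ((cos \<theta>)\<^sup>2 + e\<^sup>2))"
      by (rule G_derivative_bound[OF e])
    then show "\<exists>y. ((\<lambda>\<theta>. H \<theta> + G e b \<theta>) has_real_derivative y) (at \<theta>) \<and> 0 \<le> y"
      using DERIV_add[OF H D(1)] by (intro exI[of _ "?K * (sin \<theta> * cos \<theta> / ((cos \<theta>)\<^sup>2 + e\<^sup>2)) + D"]) (auto simp: abs_le_iff)
  qed (auto intro!: continuous_intros cG cH)
  moreover have "H 0 - G e b 0 \<le> H (pi / 2) - G e b (pi / 2)"
  proof (rule DERIV_nonneg_imp_increasing_open[where f = "\<lambda>\<theta>. H \<theta> - G e b \<theta>"])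
    fix \<theta> :: real assume "0 < \<theta>" "\<theta> < pi / 2"
    then obtain D where D: "(G e b has_real_derivative D) (at \<theta>)" "\<bar>D\<bar> \<le> ?K * (sin \<theta> * cos \<theta> / ((cos \<theta>)\<^sup>2 + e\<^sup>2))"
      by (rule G_derivative_bound[OF e])
    then show "\<exists>y. ((\<lambda>\<theta>. H \<theta> - G e b \<theta>) has_real_derivative y) (at \<theta>) \<and> 0 \<le> y"
      using DERIV_diff[OF H D(1)] by (intro exI[of _ "?K * (sin \<theta> * cos \<theta> / ((cos \<theta>)\<^sup>2 + e\<^sup>2)) - D"]) (auto simp: abs_le_iff)
  qed (auto intro!: continuous_intros cG cH)
  moreover have "H (pi / 2) - H 0 = ?K * (ln ((1 + e\<^sup>2) / e\<^sup>2) / 2)"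
  proof -
    have ln: "ln ((1 + e\<^sup>2) / e\<^sup>2) = ln (1 + e\<^sup>2) - ln (e\<^sup>2)"
      using e pos[of 0] by (intro ln_divide_pos) auto
    show ?thesis unfolding H_def ln by (simp add: algebra_simps diff_divide_distrib)
  qed
  ultimately show ?thesis by linarith
qed

lemma G_0: "G e b 0 = J d v e (\<lambda>_. 0) 1 b"
proof -
  interpret A: prob_space \<mu> by (rule prob)
  interpret B: prob_space "std_gauss d" by (rule prob_space_std_gauss)
  interpret pair_sigma_finite \<mu> "std_gauss d" ..
  have "G e b 0 = (\<integral>x. \<integral>z. Jint d v e (\<lambda>_. 0) 1 b z \<partial>std_gauss d \<partial>\<mu>)"
    unfolding G_def using integral_fst'[OF integrable_pair_Jint[of e "\<lambda>_. 0" 1 b 0]] by simp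
  then show ?thesis by (simp add: J_def A.prob_space)
qed

lemma G_pi_half: "G e b (pi / 2) = (\<integral>x. (\<Prod>i<d. psi 0 ((b i - dotd d x (v i)) / e)) \<partial>\<mu>)"
proof -
  interpret A: prob_space \<mu> by (rule prob)
  interpret B: prob_space "std_gauss d" by (rule prob_space_std_gauss)
  interpret pair_sigma_finite \<mu> "std_gauss d" ..
  have "G e b (pi / 2) = (\<integral>x. \<integral>z. Jint d v e (\<lambda>_. 0) 0 (\<lambda>i. b i - 1 * dotd d x (v i)) z \<partial>std_gauss d \<partial>\<mu>)"
    unfolding G_def using integral_fst'[OF integrable_pair_Jint[of e "\<lambda>_. 0" 0 b 1]] by simp
  then show ?thesis by (simp add: Jint_def B.prob_space)
qed

end

section \<open>Removing the smoothing\<close>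

text \<open>Shifting by R or - R moves the half-line to one on which the factor exp (- s y) is at
  most 1, leaving exp (- R^2 / 2).\<close>

lemma std_normal_tail:
  assumes "0 \<le> R"
  shows "measure std_normal_distribution {x. R < \<bar>x\<bar>} \<le> 2 * exp (- R\<^sup>2 / 2)"
proof -
  interpret prob_space std_normal_distribution by (rule prob_space_std_normal)
  have half: "measure std_normal_distribution A \<le> exp (- R\<^sup>2 / 2)"
    if A: "A \<in> sets borel" and s: "\<bar>s\<bar> = R" and sgn: "\<And>y. y + s \<in> A \<Longrightarrow> 0 \<le> s * y" for A s
  proof -
    have s2: "s\<^sup>2 = R\<^sup>2" using s by (metis power2_abs)
    have "emeasure std_normal_distribution A = (\<integral>\<^sup>+y. indicator A y \<partial>std_normal_distribution)"
      using A by simp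
    also have "\<dots> = (\<integral>\<^sup>+y. indicator A (y + s) * ennreal (exp (- s * y - s\<^sup>2 / 2)) \<partial>std_normal_distribution)"
      using A by (intro nn_integral_std_normal_shift) auto
    also have "\<dots> \<le> (\<integral>\<^sup>+y. ennreal (exp (- R\<^sup>2 / 2)) \<partial>std_normal_distribution)"
      by (intro nn_integral_mono) (auto simp: indicator_def s2 dest: sgn)
    also have "\<dots> = ennreal (exp (- R\<^sup>2 / 2))"
      using emeasure_space_1 by simp
    finally show ?thesis by (simp add: emeasure_eq_measure)
  qed
  have 1: "measure std_normal_distribution {R<..} \<le> exp (- R\<^sup>2 / 2)"
    by (rule half[of "{R<..}" R]) (use assms in auto)
  have 2: "measure std_normal_distribution {..<- R} \<le> exp (- R\<^sup>2 / 2)"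
    by (rule half[of "{..<- R}" "- R"]) (use assms in \<open>auto intro: mult_nonneg_nonpos\<close>)
  have "{x. R < \<bar>x\<bar>} = {R<..} \<union> {..<- R}" by auto
  then have "measure std_normal_distribution {x. R < \<bar>x\<bar>} \<le> measure std_normal_distribution {R<..} + measure std_normal_distribution {..<- R}"
    using measure_Un_le[of "{R<..}" std_normal_distribution "{..<- R}"] by simp
  then show ?thesis using 1 2 by linarith
qed

definition cubeR :: "nat \<Rightarrow> real \<Rightarrow> (nat \<Rightarrow> real) set" where
  "cubeR d R = {n \<in> Rd d. \<forall>i<d. \<bar>n i\<bar> \<le> R}"

lemma cubeR_sets: "cubeR d R \<in> sets (std_gauss d)"
proof -
  have "cubeR d R = {n \<in> space (std_gauss d). \<forall>i\<in>{..<d}. \<bar>n i\<bar> \<le> R}"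
    by (auto simp: cubeR_def space_std_gauss)
  also have "\<dots> \<in> sets (std_gauss d)"
  proof (rule sets.sets_Collect_finite_All)
    fix i assume "i \<in> {..<d}"
    then have [measurable]: "(\<lambda>n. n i) \<in> borel_measurable (std_gauss d)"
      by (simp add: borel_measurable_std_gauss coord_measurable)
    show "{n \<in> space (std_gauss d). \<bar>n i\<bar> \<le> R} \<in> sets (std_gauss d)" by measurable
  qed simp
  finally show ?thesis .
qed

lemma cubeR_prob:
  assumes "0 \<le> R"
  shows "1 - 2 * real d * exp (- R\<^sup>2 / 2) \<le> measure (std_gauss d) (cubeR d R)"
proof -
  interpret G: prob_space "std_gauss d" by (rule prob_space_std_gauss)
  interpret P: product_prob_space "\<lambda>_::nat. std_normal_distribution" "{..<d}"
    by (intro product_prob_spaceI prob_space_std_normal)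
  let ?B = "\<lambda>i. {n \<in> space (std_gauss d). R < \<bar>n i\<bar>}"
  have Bm: "?B i \<in> sets (std_gauss d)" if "i < d" for i
  proof -
    have [measurable]: "(\<lambda>n. n i) \<in> borel_measurable (std_gauss d)"
      using that by (simp add: borel_measurable_std_gauss coord_measurable)
    show ?thesis by measurable
  qed
  have Bp: "measure (std_gauss d) (?B i) \<le> 2 * exp (- R\<^sup>2 / 2)" if i: "i < d" for i
  proof -
    have "distr (std_gauss d) std_normal_distribution (\<lambda>z. z i) = std_normal_distribution"
      unfolding std_gauss_def using P.PiM_component[of i] i by simp
    then have "measure std_normal_distribution {x. R < \<bar>x\<bar>} = measure (distr (std_gauss d) std_normal_distribution (\<lambda>z. z i)) {x. R < \<bar>x\<bar>}"
      by simp
    also have "\<dots> = measure (std_gauss d) ((\<lambda>z. z i) -` {x. R < \<bar>x\<bar>} \<inter> space (std_gauss d))"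
      using i by (intro measure_distr) (auto simp: std_gauss_def)
    also have "(\<lambda>z. z i) -` {x. R < \<bar>x\<bar>} \<inter> space (std_gauss d) = ?B i" by auto
    finally show ?thesis using std_normal_tail[OF assms] by simp
  qed
  have compl: "X - {n \<in> X. \<forall>i<d. \<bar>n i\<bar> \<le> R} = (\<Union>i\<in>{..<d}. {n \<in> X. R < \<bar>n i\<bar>})" for X :: "(nat \<Rightarrow> real) set"
    by (auto simp: not_le)
  have "space (std_gauss d) - cubeR d R = (\<Union>i\<in>{..<d}. ?B i)"
    unfolding cubeR_def space_std_gauss
    by (rule compl)
  then have "measure (std_gauss d) (space (std_gauss d) - cubeR d R) \<le> (\<Sum>i<d. measure (std_gauss d) (?B i))"
    using Bm by (simp only:) (intro measure_UNION_le, auto)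
  also have "\<dots> \<le> (\<Sum>i<d. 2 * exp (- R\<^sup>2 / 2))" by (intro sum_mono Bp) auto
  finally show ?thesis using G.prob_compl[OF cubeR_sets, of R] by simp
qed

definition halfspaces :: "nat \<Rightarrow> (nat \<Rightarrow> nat \<Rightarrow> real) \<Rightarrow> (nat \<Rightarrow> real) \<Rightarrow> (nat \<Rightarrow> real) set" where
  "halfspaces d v b = {x \<in> Rd d. \<forall>j<d. dotd d x (v j) \<le> b j}"

text \<open>Stated for an arbitrary law, since the law of W and the Gaussian law are compared
  through the same smoothing.\<close>

locale law =
  fixes d :: nat and v :: "nat \<Rightarrow> nat \<Rightarrow> real" and N :: "(nat \<Rightarrow> real) measure"
  assumes probN: "prob_space N" and setsN: "sets N = sets (PiM {..<d} (\<lambda>_. borel))"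
begin

definition P :: "(nat \<Rightarrow> real) \<Rightarrow> real" where
  "P b = measure N (halfspaces d v b)"

lemma space_N: "space N = Rd d"
  using sets_eq_imp_space_eq[OF setsN] by (simp add: space_PiM)

lemma halfspaces_sets: "halfspaces d v b \<in> sets N"
proof -
  have "halfspaces d v b = {n \<in> space N. \<forall>i\<in>{..<d}. dotd d n (v i) \<le> b i}"
    by (auto simp: halfspaces_def space_N)
  also have "\<dots> \<in> sets N"
  proof (rule sets.sets_Collect_finite_All)
    fix i assume "i \<in> {..<d}"
    note [measurable_cong] = setsN
    show "{n \<in> space N. dotd d n (v i) \<le> b i} \<in> sets N" by measurable
  qed simp
  finally show ?thesis .
qed

lemma P_mono: "(\<And>j. j < d \<Longrightarrow> b j \<le> b' j) \<Longrightarrow> P b \<le> P b'"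
proof -
  interpret prob_space N by (rule probN)
  assume *: "\<And>j. j < d \<Longrightarrow> b j \<le> b' j"
  have "halfspaces d v b \<subseteq> halfspaces d v b'" unfolding halfspaces_def using * by (blast intro: order_trans)
  then show ?thesis unfolding P_def by (intro finite_measure_mono halfspaces_sets)
qed

lemma P_bounds: "0 \<le> P b" "P b \<le> 1"
  unfolding P_def using prob_space.prob_le_1[OF probN] by auto

text \<open>Fubini: integrating out the noise first gives the product of distribution functions,
  integrating out x first gives the probability of the polytope with random thresholds b - e
  n.\<close>

lemma smoothing:
  assumes e: "0 < e"
  shows "(\<lambda>n. P (\<lambda>i. b i - e * n i)) \<in> borel_measurable (std_gauss d)"
    and "(\<integral>x. (\<Prod>i<d. psi 0 ((b i - dotd d x (v i)) / e)) \<partial>N) = (\<integral>n. P (\<lambda>i. b i - e * n i) \<partial>std_gauss d)"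
proof -
  interpret A: prob_space N by (rule probN)
  interpret B: prob_space "std_gauss d" by (rule prob_space_std_gauss)
  interpret pair_prob_space N "std_gauss d" ..
  interpret Q: product_prob_space "\<lambda>_::nat. std_normal_distribution" "{..<d}"
    by (intro product_prob_spaceI prob_space_std_normal)
  note [measurable_cong] = setsN
  let ?f = "\<lambda>x n. \<Prod>i<d. indicator {..(b i - dotd d x (v i)) / e} (n i) :: real"
  have fm: "(\<lambda>(x, n). ?f x n) \<in> borel_measurable (N \<Otimes>\<^sub>M std_gauss d)"
    unfolding case_prod_beta
  proof (rule borel_measurable_prod)
    fix i assume "i \<in> {..<d}"
    then have i: "i < d" by simp
    have [measurable]: "(\<lambda>x. snd x i) \<in> borel_measurable (N \<Otimes>\<^sub>M std_gauss d)"
      by (rule measurable_compose[OF measurable_snd, of "\<lambda>n. n i"]) (simp add: borel_measurable_std_gauss coord_measurable i)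
    show "(\<lambda>x. indicator {..(b i - dotd d (fst x) (v i)) / e} (snd x i) :: real) \<in> borel_measurable (N \<Otimes>\<^sub>M std_gauss d)"
      unfolding indicator_def atMost_iff by measurable
  qed
  have int: "integrable (N \<Otimes>\<^sub>M std_gauss d) (\<lambda>(x, n). ?f x n)"
  proof (rule integrable_const_bound[of _ 1])
    show "AE p in N \<Otimes>\<^sub>M std_gauss d. norm (case p of (x, n) \<Rightarrow> ?f x n) \<le> 1"
    proof (rule AE_I2)
      fix p show "norm (case p of (x, n) \<Rightarrow> ?f x n) \<le> 1"
        unfolding case_prod_beta real_norm_def abs_prod by (intro prod_le_1) (auto simp: indicator_def)
    qed
  qed (rule fm)
  have in1: "(\<integral>n. ?f x n \<partial>std_gauss d) = (\<Prod>i<d. psi 0 ((b i - dotd d x (v i)) / e))" for x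
  proof -
    have "(\<integral>n. ?f x n \<partial>std_gauss d) = (\<Prod>i<d. \<integral>t. indicator {..(b i - dotd d x (v i)) / e} t \<partial>std_normal_distribution)"
      unfolding std_gauss_def
    proof (rule Q.product_integral_prod)
      fix i
      show "integrable std_normal_distribution (indicator {..(b i - dotd d x (v i)) / e} :: real \<Rightarrow> real)"
        by (rule finite_measure.integrable_const_bound[OF prob_space.finite_measure[OF prob_space_std_normal], of _ 1])
           (auto simp: indicator_def)
    qed simp
    then show ?thesis by (simp add: psi_0_measure)
  qed
  have in2: "(\<integral>x. ?f x n \<partial>N) = P (\<lambda>i. b i - e * n i)" for n
  proof -
    have "?f x n = indicator (halfspaces d v (\<lambda>i. b i - e * n i)) x" if "x \<in> space N" for x
    proof -
      have "(n i \<le> (b i - dotd d x (v i)) / e) = (dotd d x (v i) \<le> b i - e * n i)" for i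
        using e by (simp add: field_simps)
      then show ?thesis using that by (auto simp: indicator_def halfspaces_def space_N)
    qed
    then have "(\<integral>x. ?f x n \<partial>N) = (\<integral>x. indicator (halfspaces d v (\<lambda>i. b i - e * n i)) x \<partial>N)"
      by (intro Bochner_Integration.integral_cong) auto
    then show ?thesis unfolding P_def using halfspaces_sets by simp
  qed
  have "(\<lambda>n. \<integral>x. ?f x n \<partial>N) \<in> borel_measurable (std_gauss d)"
    by (rule A.borel_measurable_lebesgue_integral) (use measurable_pair_swap[OF fm] in \<open>simp add: case_prod_beta'\<close>)
  then show "(\<lambda>n. P (\<lambda>i. b i - e * n i)) \<in> borel_measurable (std_gauss d)" by (simp add: in2)
  show "(\<integral>x. (\<Prod>i<d. psi 0 ((b i - dotd d x (v i)) / e)) \<partial>N) = (\<integral>n. P (\<lambda>i. b i - e * n i) \<partial>std_gauss d)"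
    using Fubini_integral[OF int] by (simp add: in1 in2)
qed

end

interpretation gauss: law d v "std_gauss d" for d v
  by (rule law.intro[OF prob_space_std_gauss sets_std_gauss])

lemma gauss_smoothing:
  "0 < e \<Longrightarrow> J d v e (\<lambda>_. 0) 1 b = (\<integral>n. gauss.P d v (\<lambda>i. b i - e * n i) \<partial>std_gauss d)"
  using gauss.smoothing(2)[of e d b v] by (simp add: J_def Jint_def)

lemma ind_split_bounds:
  fixes f :: "'a \<Rightarrow> real"
  assumes M: "prob_space M" and f: "f \<in> borel_measurable M" and A: "A \<in> sets M"
  shows "\<lbrakk>\<And>x. x \<in> A \<Longrightarrow> l \<le> f x; \<And>x. l' \<le> f x; \<And>x. \<bar>f x\<bar> \<le> 1\<rbrakk> \<Longrightarrow> measure M A * l + (1 - measure M A) * l' \<le> (\<integral>x. f x \<partial>M)"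
    and "\<lbrakk>\<And>x. x \<in> A \<Longrightarrow> f x \<le> l; \<And>x. f x \<le> l'; \<And>x. \<bar>f x\<bar> \<le> 1\<rbrakk> \<Longrightarrow> (\<integral>x. f x \<partial>M) \<le> measure M A * l + (1 - measure M A) * l'"
proof -
  interpret prob_space M by fact
  let ?g = "\<lambda>x. l * indicator A x + l' * (1 - indicator A x)"
  have g: "integrable M ?g" using A by (intro Bochner_Integration.integrable_add integrable_mult_right Bochner_Integration.integrable_diff) (auto simp: integrable_indicator_iff emeasure_eq_measure)
  have ig: "(\<integral>x. ?g x \<partial>M) = measure M A * l + (1 - measure M A) * l'"
    using A by (subst Bochner_Integration.integral_add) (auto simp: prob_space emeasure_eq_measure)
  have fi: "integrable M f" if "\<And>x. \<bar>f x\<bar> \<le> 1"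
    by (rule integrable_const_bound[of _ 1]) (use f that in auto)
  show "measure M A * l + (1 - measure M A) * l' \<le> (\<integral>x. f x \<partial>M)"
    if "\<And>x. x \<in> A \<Longrightarrow> l \<le> f x" "\<And>x. l' \<le> f x" "\<And>x. \<bar>f x\<bar> \<le> 1"
    unfolding ig[symmetric] by (rule integral_mono[OF g fi[OF that(3)]]) (use that in \<open>auto simp: indicator_def\<close>)
  show "(\<integral>x. f x \<partial>M) \<le> measure M A * l + (1 - measure M A) * l'"
    if "\<And>x. x \<in> A \<Longrightarrow> f x \<le> l" "\<And>x. f x \<le> l'" "\<And>x. \<bar>f x\<bar> \<le> 1"
    unfolding ig[symmetric] by (rule integral_mono[OF fi[OF that(3)] g]) (use that in \<open>auto simp: indicator_def\<close>)
qed

definition CN :: real where "CN = 4 * exp (3 / 2)"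

text \<open>The derivative in the direction (1, ..., 1) is 1 / e times the sum of the
  \<open>J\<close> of order one, hence bounded uniformly in e.\<close>

lemma J_anticoncentration:
  assumes d: "3 \<le> d" and e: "0 < e" and unit: "\<And>i. i < d \<Longrightarrow> dotd d (v i) (v i) = 1" and h: "0 \<le> h"
  shows "J d v e (\<lambda>_. 0) 1 (\<lambda>i. b i + h) - J d v e (\<lambda>_. 0) 1 b \<le> h * (CN * sqrt (ln (real d)))"
proof -
  let ?C = "CN * sqrt (ln (real d))"
  let ?f = "\<lambda>t. J d v e (\<lambda>_. 0) 1 (\<lambda>i. b i + t * 1)"
  have "?C * 0 - ?f 0 \<le> ?C * h - ?f h"
  proof (rule DERIV_nonneg_imp_nondecreasing[where f = "\<lambda>t. ?C * t - ?f t"])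
    fix t :: real
    have "((\<lambda>t. ?C * t - ?f t) has_real_derivative ?C * 1 - (\<Sum>k<d. 1 / e * J d v e (e1 k) 1 (\<lambda>i. b i + t * 1))) (at t)"
      using e by (intro DERIV_diff DERIV_cmult DERIV_ident J_has_derivative) auto
    moreover have "(\<Sum>k<d. 1 / e * J d v e (e1 k) 1 (\<lambda>i. b i + t * 1)) \<le> ?C"
    proof -
      have "(\<Sum>k<d. J d v e (e1 k) 1 (\<lambda>i. b i + t * 1)) \<le> e * ?C"
        unfolding CN_def by (rule sum_J_e1_bound[OF d e unit])
      then have "1 / e * (\<Sum>k<d. J d v e (e1 k) 1 (\<lambda>i. b i + t * 1)) \<le> 1 / e * (e * ?C)"
        using e by (intro mult_left_mono) auto
      then show ?thesis using e by (simp add: sum_distrib_left del: fun_upd_apply)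
    qed
    ultimately show "\<exists>y. ((\<lambda>t. ?C * t - ?f t) has_real_derivative y) (at t) \<and> 0 \<le> y"
      by (intro exI conjI) auto
  qed (rule h)
  then show ?thesis by (simp add: mult.commute)
qed

text \<open>Nazarov's inequality, obtained from its smoothed version by letting first \<open>e \<rightarrow> 0\<close>, then \<open>R \<rightarrow> \<infinity>\<close>.\<close>

lemma gauss_anticoncentration:
  assumes d: "3 \<le> d" and unit: "\<And>i. i < d \<Longrightarrow> dotd d (v i) (v i) = 1" and h: "0 \<le> h"
  shows "gauss.P d v (\<lambda>i. b i + h) - gauss.P d v b \<le> h * (CN * sqrt (ln (real d)))"
proof -
  let ?C = "CN * sqrt (ln (real d))"
  let ?P = "gauss.P d v"
  have cube: "n i \<le> R" "- R \<le> n i" if "n \<in> cubeR d R" "i < d" for n i R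
    using that by (auto simp: cubeR_def abs_le_iff)
  \<comment> \<open>On the cube the noise moves each threshold by at most e R, so raising the upper
    thresholds and lowering the lower ones by e R sandwiches the unsmoothed difference. Off the cube
    probabilities are only known to lie in [0, 1].\<close>
  have 1: "?P (\<lambda>i. b i + h) - ?P b \<le> (h + 2 * e * R) * ?C + 2 * (1 - measure (std_gauss d) (cubeR d R))"
    if e: "0 < e" and R: "0 \<le> R" for e R
  proof -
    let ?q = "measure (std_gauss d) (cubeR d R)"
    have q: "0 \<le> ?q" "?q \<le> 1" using prob_space.prob_le_1[OF prob_space_std_gauss] by auto
    have A: "?q * ?P (\<lambda>i. b i + h) + (1 - ?q) * 0 \<le> (\<integral>n. ?P (\<lambda>i. (b i + h + e * R) - e * n i) \<partial>std_gauss d)"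
    proof (rule ind_split_bounds(1)[OF prob_space_std_gauss gauss.smoothing(1)[OF e] cubeR_sets])
      fix n assume n: "n \<in> cubeR d R"
      show "?P (\<lambda>i. b i + h) \<le> ?P (\<lambda>i. (b i + h + e * R) - e * n i)"
        by (rule gauss.P_mono) (use cube(1)[OF n] e in auto)
    next
      fix n show "\<bar>?P (\<lambda>i. (b i + h + e * R) - e * n i)\<bar> \<le> 1"
        using gauss.P_bounds[of d v "\<lambda>i. (b i + h + e * R) - e * n i"] by auto
    qed (rule gauss.P_bounds)
    have B: "(\<integral>n. ?P (\<lambda>i. (b i - e * R) - e * n i) \<partial>std_gauss d) \<le> ?q * ?P b + (1 - ?q) * 1"
    proof (rule ind_split_bounds(2)[OF prob_space_std_gauss gauss.smoothing(1)[OF e] cubeR_sets])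
      fix n assume n: "n \<in> cubeR d R"
      show "?P (\<lambda>i. (b i - e * R) - e * n i) \<le> ?P b"
      proof (rule gauss.P_mono)
        fix j assume "j < d"
        then have "e * (- R) \<le> e * n j" using cube(2)[OF n] e by (intro mult_left_mono) auto
        then show "b j - e * R - e * n j \<le> b j" by simp
      qed
    next
      fix n show "\<bar>?P (\<lambda>i. (b i - e * R) - e * n i)\<bar> \<le> 1"
        using gauss.P_bounds[of d v "\<lambda>i. (b i - e * R) - e * n i"] by auto
    qed (rule gauss.P_bounds)
    have "(\<lambda>i. (b i - e * R) + (h + 2 * e * R)) = (\<lambda>i. b i + h + e * R)" by (rule ext) simp
    moreover have "J d v e (\<lambda>_. 0) 1 (\<lambda>i. (b i - e * R) + (h + 2 * e * R)) - J d v e (\<lambda>_. 0) 1 (\<lambda>i. b i - e * R) \<le> (h + 2 * e * R) * ?C"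
      using e R h by (intro J_anticoncentration[OF d e unit]) auto
    ultimately have "(\<integral>n. ?P (\<lambda>i. (b i + h + e * R) - e * n i) \<partial>std_gauss d) - (\<integral>n. ?P (\<lambda>i. (b i - e * R) - e * n i) \<partial>std_gauss d) \<le> (h + 2 * e * R) * ?C"
      by (simp only: gauss_smoothing[OF e])
    then have "?q * ?P (\<lambda>i. b i + h) - (?q * ?P b + (1 - ?q)) \<le> (h + 2 * e * R) * ?C"
      using A[unfolded mult_zero_right add_0_right] B[unfolded mult_1_right] by linarith
    moreover have "(1 - ?q) * ?P (\<lambda>i. b i + h) \<le> (1 - ?q) * 1"
      using q by (intro mult_left_mono gauss.P_bounds) auto
    moreover have "0 \<le> (1 - ?q) * ?P b"
      using q by (intro mult_nonneg_nonneg gauss.P_bounds) auto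
    ultimately show ?thesis by (simp add: algebra_simps)
  qed
  have 2: "?P (\<lambda>i. b i + h) - ?P b \<le> h * ?C + 2 * (1 - measure (std_gauss d) (cubeR d R))" if R: "0 \<le> R" for R
  proof -
    have "(\<lambda>n. (h + 2 * inverse (real (Suc n)) * R) * ?C + 2 * (1 - measure (std_gauss d) (cubeR d R)))
      \<longlonglongrightarrow> (h + 2 * 0 * R) * ?C + 2 * (1 - measure (std_gauss d) (cubeR d R))"
      by (intro tendsto_intros LIMSEQ_inverse_real_of_nat)
    then have "?P (\<lambda>i. b i + h) - ?P b \<le> (h + 2 * 0 * R) * ?C + 2 * (1 - measure (std_gauss d) (cubeR d R))"
      by (rule LIMSEQ_le_const) (use 1 R in auto)
    then show ?thesis by simp
  qed
  have "(\<lambda>n. exp (- real n)) \<longlonglongrightarrow> 0"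
    by (intro filterlim_compose[OF exp_at_bot] filterlim_uminus_at_bot_at_top[THEN filterlim_compose] filterlim_real_sequentially)
  then have "(\<lambda>n. h * ?C + 4 * real d * exp (- real n)) \<longlonglongrightarrow> h * ?C + 4 * real d * 0"
    by (intro tendsto_intros)
  then have "?P (\<lambda>i. b i + h) - ?P b \<le> h * ?C + 4 * real d * 0"
  proof (rule LIMSEQ_le_const, intro exI allI impI)
    fix n :: nat
    \<comment> \<open>The radius sqrt (2 n) turns exp (- R^2 / 2) into exp (- n).\<close>
    have "1 - 2 * real d * exp (- real n) \<le> measure (std_gauss d) (cubeR d (sqrt (2 * real n)))"
      using cubeR_prob[of "sqrt (2 * real n)" d] by simp
    then show "?P (\<lambda>i. b i + h) - ?P b \<le> h * ?C + 4 * real d * exp (- real n)"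
      using 2[of "sqrt (2 * real n)"] by simp
  qed
  then show ?thesis by simp
qed

section \<open>The error bound for polytopes\<close>

context stein_setup
begin

lemma law_mu: "law d \<mu>"
  by (rule law.intro[OF prob sets_mu])

abbreviation (input) Delta :: real where "Delta \<equiv> \<integral>x. F x \<partial>\<mu>"

lemma Delta_nonneg: "0 \<le> Delta"
  by (intro Bochner_Integration.integral_nonneg F_nonneg)

text \<open>The error at \<open>b\<close> is at most \<open>4 / 3\<close> times the smoothed error, plus a Gaussian boundary term and a
  third of the supremum \<open>\<delta>\<close> of the error over all \<open>b\<close>; take the supremum and solve for \<open>\<delta>\<close>.\<close>

lemma desmoothing:
  assumes e: "0 < e"
  shows "\<bar>law.P d v \<mu> b - gauss.P d v b\<bar> \<le>
    2 * (KC * Delta * ln (real d) * (ln ((1 + e\<^sup>2) / e\<^sup>2) / 2)) + 3 * (e * sqrt (6 * ln (real d)) * (CN * sqrt (ln (real d))))"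
proof -
  interpret mu: law d v \<mu> by (rule law_mu)
  let ?P = "gauss.P d v"
  \<comment> \<open>With this radius 2 d exp (- R^2 / 2) = 2 / d^2 <= 2 / 9, so the cube has
    probability at least 3 / 4.\<close>
  define R where "R = sqrt (6 * ln (real d))"
  define \<eta> where "\<eta> = e * R"
  define D where "D b = mu.P b - ?P b" for b
  define B where "B = KC * Delta * ln (real d) * (ln ((1 + e\<^sup>2) / e\<^sup>2) / 2)"
  define C where "C = 2 * \<eta> * (CN * sqrt (ln (real d)))"
  define q where "q = measure (std_gauss d) (cubeR d R)"
  \<comment> \<open>The normals stay fixed and b ranges over all thresholds. Both the noise and the
    shifts by \<eta> stay in this family, so off the cube the error is at most \<delta>.\<close>
  define \<delta> where "\<delta> = (SUP b. \<bar>D b\<bar>)"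
  have ln1: "1 \<le> ln (real d)" by (rule ln_ge_1[OF d])
  have R0: "0 \<le> R" and \<eta>0: "0 \<le> \<eta>" using e ln1 by (simp_all add: R_def \<eta>_def)
  have q: "3 / 4 \<le> q" "q \<le> 1"
  proof -
    have "exp (- R\<^sup>2 / 2) = exp (ln (real d) * (- 3))" unfolding R_def using ln1 by simp
    also have "\<dots> = 1 / real d ^ 3"
      using d exp_of_nat_mult[of 3 "ln (real d)"] by (simp add: exp_minus inverse_eq_divide mult.commute)
    finally have "2 * real d * exp (- R\<^sup>2 / 2) = 2 / (real d)\<^sup>2"
      using d by (simp add: power2_eq_square power3_eq_cube)
    also have "\<dots> \<le> 2 / 3\<^sup>2" using d by (intro divide_left_mono power_mono) auto
    finally show "3 / 4 \<le> q" using cubeR_prob[OF R0, of d] unfolding q_def by simp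
    show "q \<le> 1" unfolding q_def using prob_space.prob_le_1[OF prob_space_std_gauss] by auto
  qed
  have D1: "\<bar>D b\<bar> \<le> 1" for b
    using mu.P_bounds[of b] gauss.P_bounds[of d v b] unfolding D_def by linarith
  have bdd: "bdd_above (range (\<lambda>b. \<bar>D b\<bar>))" by (rule bdd_aboveI[of _ 1]) (use D1 in auto)
  have D\<delta>: "\<bar>D b\<bar> \<le> \<delta>" for b unfolding \<delta>_def by (rule cSUP_upper[OF UNIV_I bdd])
  then have \<delta>0: "0 \<le> \<delta>" by (rule order_trans[OF abs_ge_zero])
  have m: "(\<lambda>n. D (\<lambda>i. b i - e * n i)) \<in> borel_measurable (std_gauss d)" for b
    unfolding D_def by (intro borel_measurable_diff mu.smoothing(1) gauss.smoothing(1) e)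
  have S: "\<bar>\<integral>n. D (\<lambda>i. b i - e * n i) \<partial>std_gauss d\<bar> \<le> B" for b
  proof -
    interpret std: prob_space "std_gauss d" by (rule prob_space_std_gauss)
    have i: "integrable (std_gauss d) (\<lambda>n. mu.P (\<lambda>i. b i - e * n i))" "integrable (std_gauss d) (\<lambda>n. ?P (\<lambda>i. b i - e * n i))"
      using mu.P_bounds gauss.P_bounds[of d v]
      by (auto intro!: std.integrable_const_bound[of _ 1] mu.smoothing(1) gauss.smoothing(1) e)
    have "(\<integral>n. D (\<lambda>i. b i - e * n i) \<partial>std_gauss d) = G e b (pi / 2) - G e b 0"
      unfolding D_def G_0 G_pi_half gauss_smoothing[OF e] mu.smoothing(2)[OF e] using i by simp
    then show ?thesis using G_diff_bound[OF e, of b] unfolding B_def by simp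
  qed
  have B0: "0 \<le> B" using order_trans[OF abs_ge_zero S] .
  have anti: "?P (\<lambda>i. b i + 2 * \<eta>) - ?P b \<le> C" for b
    unfolding C_def by (rule gauss_anticoncentration[OF d unit]) (use \<eta>0 in auto)
  have cube: "e * n i \<le> \<eta>" "- \<eta> \<le> e * n i" if "n \<in> cubeR d R" "i < d" for n i
  proof -
    have "n i \<le> R" "- R \<le> n i" using that by (auto simp: cubeR_def abs_le_iff)
    then show "e * n i \<le> \<eta>" "- \<eta> \<le> e * n i"
      using e mult_left_mono[of "n i" R e] mult_left_mono[of "- R" "n i" e] by (auto simp: \<eta>_def)
  qed
  have arith: "x \<le> c + (4 / 3 * y + 1 / 3 * z)" if "3 / 4 * (x - c) - 1 / 4 * z \<le> y" for x c y z :: real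
    using that by (simp add: field_simps)
  have up: "D b \<le> C + (4 / 3 * B + 1 / 3 * \<delta>)" for b
  proof (cases "D b \<le> C")
    case True
    moreover have "0 \<le> (4 / 3 * B + 1 / 3 * \<delta>)" using B0 \<delta>0 by simp
    ultimately show ?thesis by linarith
  next
    case False
    have "q * (D b - C) + (1 - q) * (- \<delta>) \<le> (\<integral>n. D (\<lambda>i. (b i + \<eta>) - e * n i) \<partial>std_gauss d)"
      unfolding q_def
    proof (rule ind_split_bounds(1)[OF prob_space_std_gauss m cubeR_sets])
      fix n assume n: "n \<in> cubeR d R"
      \<comment> \<open>For the law of W only monotonicity in the thresholds is available. Shifting
        by \<eta> makes the sign right there and leaves the cost C, for a shift by 2 \<eta>, to the
        Gaussian side.\<close>
      have "mu.P b \<le> mu.P (\<lambda>i. (b i + \<eta>) - e * n i)"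
        by (rule mu.P_mono) (use cube[OF n] in \<open>auto simp: le_diff_eq\<close>)
      moreover have "?P (\<lambda>i. (b i + \<eta>) - e * n i) \<le> ?P (\<lambda>i. b i + 2 * \<eta>)"
      proof (rule gauss.P_mono)
        fix j assume "j < d"
        from cube(2)[OF n this] show "b j + \<eta> - e * n j \<le> b j + 2 * \<eta>" by linarith
      qed
      ultimately show "D b - C \<le> D (\<lambda>i. (b i + \<eta>) - e * n i)" using anti[of b] unfolding D_def by linarith
    next
      show "- \<delta> \<le> D (\<lambda>i. (b i + \<eta>) - e * n i)" for n using D\<delta>[of "\<lambda>i. (b i + \<eta>) - e * n i"] by linarith
    qed (rule D1)
    \<comment> \<open>D b - C is positive in this case, so q may be replaced by its lower
      bound.\<close>
    moreover have "3 / 4 * (D b - C) \<le> q * (D b - C)" using q False by (intro mult_right_mono) auto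
    moreover have "(1 - q) * \<delta> \<le> 1 / 4 * \<delta>" using q \<delta>0 by (intro mult_right_mono) auto
    ultimately have "3 / 4 * (D b - C) - 1 / 4 * \<delta> \<le> B" using S[of "\<lambda>i. b i + \<eta>"] unfolding mult_minus_right by linarith
    then show ?thesis by (rule arith)
  qed
  have low: "- D b \<le> C + (4 / 3 * B + 1 / 3 * \<delta>)" for b
  proof (cases "- D b \<le> C")
    case True
    moreover have "0 \<le> (4 / 3 * B + 1 / 3 * \<delta>)" using B0 \<delta>0 by simp
    ultimately show ?thesis by linarith
  next
    case False
    have "(\<integral>n. D (\<lambda>i. (b i - \<eta>) - e * n i) \<partial>std_gauss d) \<le> q * (D b + C) + (1 - q) * \<delta>"
      unfolding q_def
    proof (rule ind_split_bounds(2)[OF prob_space_std_gauss m cubeR_sets])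
      fix n assume n: "n \<in> cubeR d R"
      have "mu.P (\<lambda>i. (b i - \<eta>) - e * n i) \<le> mu.P b"
      proof (rule mu.P_mono)
        fix j assume "j < d"
        from cube(2)[OF n this] show "b j - \<eta> - e * n j \<le> b j" by linarith
      qed
      moreover have "?P (\<lambda>i. b i - 2 * \<eta>) \<le> ?P (\<lambda>i. (b i - \<eta>) - e * n i)"
      proof (rule gauss.P_mono)
        fix j assume "j < d"
        from cube(1)[OF n this] show "b j - 2 * \<eta> \<le> b j - \<eta> - e * n j" by linarith
      qed
      moreover have "?P b - ?P (\<lambda>i. b i - 2 * \<eta>) \<le> C" using anti[of "\<lambda>i. b i - 2 * \<eta>"] by simp
      ultimately show "D (\<lambda>i. (b i - \<eta>) - e * n i) \<le> D b + C" unfolding D_def by linarith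
    next
      show "D (\<lambda>i. (b i - \<eta>) - e * n i) \<le> \<delta>" for n using D\<delta>[of "\<lambda>i. (b i - \<eta>) - e * n i"] by linarith
    qed (rule D1)
    moreover have "3 / 4 * (- D b - C) \<le> q * (- D b - C)" using q False by (intro mult_right_mono) auto
    moreover have "q * (- D b - C) = - (q * (D b + C))" by (simp add: algebra_simps)
    moreover have "(1 - q) * \<delta> \<le> 1 / 4 * \<delta>" using q \<delta>0 by (intro mult_right_mono) auto
    ultimately have "3 / 4 * (- D b - C) - 1 / 4 * \<delta> \<le> B" using S[of "\<lambda>i. b i - \<eta>"] by linarith
    then show ?thesis by (rule arith)
  qed
  have "\<delta> \<le> C + (4 / 3 * B + 1 / 3 * \<delta>)"
    unfolding \<delta>_def by (rule cSUP_least) (use up low in \<open>auto simp: \<delta>_def[symmetric] abs_le_iff\<close>)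
  then have "\<delta> \<le> 2 * B + 3 / 2 * C" by linarith
  then have "\<bar>D b\<bar> \<le> 2 * B + 3 / 2 * C" using D\<delta>[of b] by linarith
  also have "3 / 2 * C = 3 * (e * sqrt (6 * ln (real d)) * (CN * sqrt (ln (real d))))"
    unfolding C_def \<eta>_def R_def by simp
  finally show ?thesis unfolding D_def B_def .
qed

text \<open>The radius of the cube and Nazarov's inequality contribute sqrt (log d) each, so the
  noise costs a multiple of e log d.\<close>

lemma desmoothing':
  assumes e: "0 < e"
  shows "\<bar>law.P d v \<mu> b - gauss.P d v b\<bar> \<le> (KC * Delta * ln ((1 + e\<^sup>2) / e\<^sup>2) + 9 * CN * e) * ln (real d)"
proof -
  have ln0: "0 \<le> ln (real d)" using d by simp
  have s6: "sqrt 6 \<le> 3" by (rule real_le_lsqrt) auto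
  have "3 * (e * sqrt (6 * ln (real d)) * (CN * sqrt (ln (real d)))) = 3 * sqrt 6 * CN * e * (sqrt (ln (real d)) * sqrt (ln (real d)))"
    by (simp add: real_sqrt_mult mult_ac)
  also have "\<dots> = 3 * sqrt 6 * CN * e * ln (real d)" using ln0 by simp
  also have "\<dots> \<le> 3 * 3 * CN * e * ln (real d)"
    using s6 e ln0 by (intro mult_right_mono mult_left_mono) (auto simp: CN_def)
  finally have "3 * (e * sqrt (6 * ln (real d)) * (CN * sqrt (ln (real d)))) \<le> 3 * 3 * CN * e * ln (real d)" .
  then show ?thesis using desmoothing[OF e, of b] by (simp add: algebra_simps)
qed

text \<open>The choice e = Delta serves 0 < Delta < 1 / 2. For Delta = 0 the positive e tends to 0
  instead. For Delta >= 1 / 2 the trivial bound 1 <= 2 Delta suffices and accounts for the summand 2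
  in the constant.\<close>

lemma polytope_bound:
  "\<bar>law.P d v \<mu> b - gauss.P d v b\<bar> \<le> (4 * KC + 9 * CN + 2) * Delta * ln (real d) * max \<bar>ln Delta\<bar> 1"
proof -
  interpret mu: law d v \<mu> by (rule law_mu)
  have ln1: "1 \<le> ln (real d)" by (rule ln_ge_1[OF d])
  have KC: "0 \<le> KC" "0 \<le> CN" by (simp_all add: KC_def CN_def)
  let ?x = "\<bar>mu.P b - gauss.P d v b\<bar>"
  let ?m = "max \<bar>ln Delta\<bar> 1"
  consider "Delta = 0" | "0 < Delta" "Delta < 1 / 2" | "1 / 2 \<le> Delta" using Delta_nonneg by linarith
  then show ?thesis
  proof cases
    case 1
    have "?x \<le> 9 * CN * ln (real d) * inverse (real (Suc n))" for n
      using desmoothing'[of "inverse (real (Suc n))" b] 1 by (simp add: mult_ac)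
    moreover have "(\<lambda>n. 9 * CN * ln (real d) * inverse (real (Suc n))) \<longlonglongrightarrow> 9 * CN * ln (real d) * 0"
      by (intro tendsto_intros LIMSEQ_inverse_real_of_nat)
    ultimately have "?x \<le> 9 * CN * ln (real d) * 0" by (intro LIMSEQ_le_const) auto
    then show ?thesis using 1 by simp
  next
    case 2
    \<comment> \<open>The fourth power absorbs the factor 1 + Delta^2, since (1 + Delta^2) Delta^2
      <= 1; the logarithm is then at most 4 |ln Delta|.\<close>
    have "(1 + Delta\<^sup>2) / Delta\<^sup>2 \<le> (1 / Delta) ^ 4"
    proof -
      have d2: "Delta\<^sup>2 \<le> (1 / 2)\<^sup>2" using 2 by (intro power_mono) auto
      have "(1 + Delta\<^sup>2) * Delta\<^sup>2 \<le> 2 * (1 / 2)\<^sup>2"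
        using d2 by (intro mult_mono) (auto simp: power2_eq_square)
      then have "(1 + Delta\<^sup>2) * Delta\<^sup>2 \<le> 1" by (simp add: power2_eq_square)
      then have "(1 + Delta\<^sup>2) / Delta\<^sup>2 \<le> (1 / Delta\<^sup>2) / Delta\<^sup>2"
        using 2 by (intro divide_right_mono) (auto simp: field_simps)
      also have "\<dots> = (1 / Delta) ^ 4" by (simp add: power_divide power2_eq_square power4_eq_xxxx)
      finally show ?thesis .
    qed
    moreover have pos: "0 < (1 + Delta\<^sup>2) / Delta\<^sup>2" using 2 by (intro divide_pos_pos add_pos_nonneg) auto
    ultimately have "ln ((1 + Delta\<^sup>2) / Delta\<^sup>2) \<le> ln ((1 / Delta) ^ 4)" using 2 by (subst ln_le_cancel_iff) auto
    also have "\<dots> = 4 * ln (1 / Delta)" using 2 by (subst ln_realpow) auto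
    also have "ln (1 / Delta) = - ln Delta" using 2 by (simp add: ln_divide_pos)
    also have "\<dots> \<le> ?m" by simp
    finally have l: "ln ((1 + Delta\<^sup>2) / Delta\<^sup>2) \<le> 4 * ?m" by simp
    have "KC * Delta * ln ((1 + Delta\<^sup>2) / Delta\<^sup>2) \<le> KC * Delta * (4 * ?m)"
      using KC 2 by (intro mult_left_mono l) auto
    moreover have "9 * CN * Delta * 1 \<le> 9 * CN * Delta * ?m" using KC 2 by (intro mult_left_mono) auto
    moreover have "0 \<le> 2 * Delta * ?m" using 2 by simp
    ultimately have "KC * Delta * ln ((1 + Delta\<^sup>2) / Delta\<^sup>2) + 9 * CN * Delta \<le> (4 * KC + 9 * CN + 2) * Delta * ?m"
      by (simp add: algebra_simps)
    then have "(KC * Delta * ln ((1 + Delta\<^sup>2) / Delta\<^sup>2) + 9 * CN * Delta) * ln (real d) \<le> (4 * KC + 9 * CN + 2) * Delta * ?m * ln (real d)"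
      using ln1 by (intro mult_right_mono) auto
    then show ?thesis using desmoothing'[OF 2(1), of b] by (simp add: mult_ac)
  next
    case 3
    have "?x \<le> 1" using mu.P_bounds[of b] gauss.P_bounds[of d v b] by linarith
    also have "1 \<le> 2 * Delta * 1 * 1" using 3 by simp
    also have "\<dots> \<le> (4 * KC + 9 * CN + 2) * Delta * ln (real d) * ?m"
      using 3 KC ln1 by (intro mult_mono) auto
    finally show ?thesis .
  qed
qed

end

text \<open>Because d >= 3 there are two further normals, and being distinct they cannot both be -
  v_j. Hence every j occurs in the maximum, which then bounds all the diagonal entries.\<close>

lemma non_antipodal_exists:
  fixes d :: nat
  assumes d: "3 \<le> d" and j: "j < d"
    and dist: "\<forall>j<d. \<forall>k<d. j \<noteq> k \<longrightarrow> (\<exists>i<d. v j i \<noteq> (v k i :: real))"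
  shows "\<exists>k<d. j \<noteq> k \<and> \<not> (\<forall>i<d. v k i = - v j i)"
proof -
  have "\<exists>k l. k < d \<and> l < d \<and> k \<noteq> l \<and> j \<noteq> k \<and> j \<noteq> l"
  proof (cases "j = 0")
    case True
    then show ?thesis using d by (intro exI[of _ 1] exI[of _ 2]) auto
  next
    case False
    then show ?thesis using d by (intro exI[of _ 0] exI[of _ "if j = 1 then 2 else 1"]) auto
  qed
  then obtain k l where kl: "k < d" "l < d" "k \<noteq> l" "j \<noteq> k" "j \<noteq> l" by blast
  from dist[rule_format, OF kl(1-3)] obtain i where "i < d" "v k i \<noteq> v l i" by blast
  show ?thesis
  proof (cases "v k i = - v j i")
    case True
    then have "v l i \<noteq> - v j i" using \<open>v k i \<noteq> v l i\<close> by simp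
    then show ?thesis using kl \<open>i < d\<close> by (intro exI[of _ l]) auto
  next
    case False
    then show ?thesis using kl \<open>i < d\<close> by (intro exI[of _ k]) auto
  qed
qed

lemma stein_setup_polytope:
  fixes v :: "nat \<Rightarrow> nat \<Rightarrow> real"
  assumes d: "3 \<le> d" and prob: "prob_space \<mu>" and sets_mu: "sets \<mu> = sets (PiM {..<d} (\<lambda>_. borel))"
    and int: "\<And>i. i < d \<Longrightarrow> integrable \<mu> (\<lambda>x. x i)" and stein: "stein_kernel d \<mu> \<tau>"
    and unit: "\<And>i. i < d \<Longrightarrow> dotd d (v i) (v i) = 1"
    and dist: "\<forall>j<d. \<forall>k<d. j \<noteq> k \<longrightarrow> (\<exists>i<d. v j i \<noteq> v k i)"
  defines "M \<equiv> \<lambda>x i l. \<tau> x i l - (if i = l then 1 else 0)"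
  defines "F \<equiv> \<lambda>x. Max {\<bar>qform d (v j) (M x) (v j)\<bar>
                          + \<bar>qform d (v j) (M x) (vperp d (v j) (v k))\<bar>
                          + \<bar>qform d (vperp d (v j) (v k)) (M x) (vperp d (v j) (v k))\<bar>
                        | j k. j < d \<and> k < d \<and> j \<noteq> k \<and> \<not> (\<forall>i<d. v k i = - v j i)}"
  assumes int_F: "integrable \<mu> F"
  shows "stein_setup d \<mu> \<tau> v F"
proof -
  let ?f = "\<lambda>x j k. \<bar>qform d (v j) (M x) (v j)\<bar> + \<bar>qform d (v j) (M x) (vperp d (v j) (v k))\<bar>
     + \<bar>qform d (vperp d (v j) (v k)) (M x) (vperp d (v j) (v k))\<bar>"
  have le: "?f x j k \<le> F x" if "j < d" "k < d" "j \<noteq> k" "\<not> (\<forall>i<d. v k i = - v j i)" for x j k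
    unfolding F_def
  proof (rule Max_ge)
    show "finite {?f x j k | j k. j < d \<and> k < d \<and> j \<noteq> k \<and> \<not> (\<forall>i<d. v k i = - v j i)}"
      by (rule finite_subset[of _ "(\<lambda>(j, k). ?f x j k) ` ({..<d} \<times> {..<d})"]) auto
  qed (use that in blast)
  have diag: "\<bar>qform d (v j) (M x) (v j)\<bar> \<le> F x" if j: "j < d" for x j
  proof -
    obtain k where k: "k < d" "j \<noteq> k" "\<not> (\<forall>i<d. v k i = - v j i)" using non_antipodal_exists[OF d j dist] by blast
    show ?thesis using le[OF j k(1-3), of x] by linarith
  qed
  have F0: "0 \<le> F x" for x using diag[of 0 x] d by (intro order_trans[OF abs_ge_zero]) auto
  \<comment> \<open>For v_k = - v_j all four entries agree up to sign and v_j . v_k = - 1, so both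
    sides of the pair bound are 0.\<close>
  have anti: "qform d (v j) (M x) (v k) = - qform d (v j) (M x) (v j)" "qform d (v k) (M x) (v j) = - qform d (v j) (M x) (v j)"
    "qform d (v k) (M x) (v k) = qform d (v j) (M x) (v j)" "dotd d (v j) (v k) = - dotd d (v j) (v j)"
    if "\<forall>i<d. v k i = - v j i" for x j k
    using that unfolding qform_def dotd_def by (auto simp: sum_negf[symmetric] intro!: sum.cong)
  have pair: "\<bar>qform d (v j) (M x) (v k) + qform d (v k) (M x) (v j) - dotd d (v j) (v k) * (qform d (v j) (M x) (v j) + qform d (v k) (M x) (v k))\<bar>
      \<le> 11 * F x * (1 - (dotd d (v j) (v k))\<^sup>2)" "\<bar>qform d (v j) (M x) (v k)\<bar> \<le> 2 * F x"
    if jk: "j < d" "k < d" "j \<noteq> k" for x j k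
  proof -
    show "\<bar>qform d (v j) (M x) (v k) + qform d (v k) (M x) (v j) - dotd d (v j) (v k) * (qform d (v j) (M x) (v j) + qform d (v k) (M x) (v k))\<bar>
      \<le> 11 * F x * (1 - (dotd d (v j) (v k))\<^sup>2)"
    proof (cases "\<forall>i<d. v k i = - v j i")
      case True
      show ?thesis unfolding anti[OF True] unit[OF jk(1)] by simp
    next
      case False
      then have F': "\<not> (\<forall>i<d. v j i = - v k i)" by force
      show ?thesis using pair_bound(1)[OF unit[OF jk(1)] unit[OF jk(2)] _ False le[OF jk False] le[OF jk(2,1) jk(3)[symmetric] F']] dist jk by blast
    qed
    show "\<bar>qform d (v j) (M x) (v k)\<bar> \<le> 2 * F x"
    proof (cases "\<forall>i<d. v k i = - v j i")
      case True
      show ?thesis unfolding anti[OF True] using diag[OF jk(1), of x] by linarith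
    next
      case False
      then have F': "\<not> (\<forall>i<d. v j i = - v k i)" by force
      show ?thesis using pair_bound(2)[OF unit[OF jk(1)] unit[OF jk(2)] _ False le[OF jk False] le[OF jk(2,1) jk(3)[symmetric] F']] dist jk by blast
    qed
  qed
  show ?thesis
  proof (rule stein_setup.intro[OF d prob sets_mu int stein unit int_F])
    fix x j k assume jk: "j < d" "k < d"
    show "\<bar>qform d (v j) (\<lambda>i l. \<tau> x i l - (if i = l then 1 else 0)) (v k)\<bar> \<le> 2 * F x"
    proof (cases "j = k")
      case True
      then show ?thesis using diag[OF jk(1), of x] F0[of x] unfolding M_def True[symmetric] by linarith
    next
      case False
      then show ?thesis using pair(2)[OF jk False, of x] unfolding M_def by simp
    qed
  qed (use diag pair(1) in \<open>auto simp: M_def\<close>)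
qed

theorem theorem1p2:
  "\<exists>C::real. \<forall>(d::nat) (\<mu>::(nat \<Rightarrow> real) measure) \<tau> (v::nat \<Rightarrow> nat \<Rightarrow> real) (b::nat \<Rightarrow> real).
     d \<ge> 3 \<longrightarrow>
     prob_space \<mu> \<longrightarrow>
     sets \<mu> = sets (PiM {..<d} (\<lambda>_. borel)) \<longrightarrow>
     (\<forall>i<d. integrable \<mu> (\<lambda>x. x i) \<and> (\<integral>x. x i \<partial>\<mu>) = 0) \<longrightarrow>
     stein_kernel d \<mu> \<tau> \<longrightarrow>
     (\<forall>j<d. dotd d (v j) (v j) = 1) \<longrightarrow>
     (\<forall>j<d. \<forall>k<d. j \<noteq> k \<longrightarrow> (\<exists>i<d. v j i \<noteq> v k i)) \<longrightarrow>
     (let A = {x \<in> Rd d. \<forall>j<d. dotd d x (v j) \<le> b j};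
          M = (\<lambda>x i l. \<tau> x i l - (if i = l then 1 else 0));
          F = (\<lambda>x. Max {\<bar>qform d (v j) (M x) (v j)\<bar>
                          + \<bar>qform d (v j) (M x) (vperp d (v j) (v k))\<bar>
                          + \<bar>qform d (vperp d (v j) (v k)) (M x) (vperp d (v j) (v k))\<bar>
                        | j k. j < d \<and> k < d \<and> j \<noteq> k \<and> \<not> (\<forall>i<d. v k i = - v j i)});
          \<Delta> = (\<integral>x. F x \<partial>\<mu>)
      in integrable \<mu> F \<longrightarrow>
         \<bar>measure \<mu> A - measure (std_gauss d) A\<bar> \<le> C * \<Delta> * ln (real d) * max \<bar>ln \<Delta>\<bar> 1)"
  unfolding Let_def
\<comment> \<open>\<open>KC\<close> depends on none of the parameters of its locale, so its global
  form is an absolute constant, as is \<open>CN\<close>.\<close>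
proof (rule exI[of _ "4 * stein_setup.KC + 9 * CN + 2"], intro allI impI, goal_cases)
  case (1 d \<mu> \<tau> v b)
  interpret stein_setup d \<mu> \<tau> v "\<lambda>x. Max {\<bar>qform d (v j) (\<lambda>i l. \<tau> x i l - (if i = l then 1 else 0)) (v j)\<bar>
      + \<bar>qform d (v j) (\<lambda>i l. \<tau> x i l - (if i = l then 1 else 0)) (vperp d (v j) (v k))\<bar>
      + \<bar>qform d (vperp d (v j) (v k)) (\<lambda>i l. \<tau> x i l - (if i = l then 1 else 0)) (vperp d (v j) (v k))\<bar>
    | j k. j < d \<and> k < d \<and> j \<noteq> k \<and> \<not> (\<forall>i<d. v k i = - v j i)}"
    by (rule stein_setup_polytope) (use 1 in auto)
  show ?case
    using polytope_bound[of b] unfolding law.P_def[OF law_mu] gauss.P_def halfspaces_def .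
qed

end
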